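(* Let $I \subseteq \mathbb{R}$ be an open interval. Consider a curve of (complex) polynomials $$P(t)(x) = x^n + \sum_{j=1}^n (-1)^j a_j(t)\, x^{n-j},\qquad t\in I,$$ with definable $C^\infty$ coefficients $a_j:I\to\mathbb{C}$. Then, for each $t_0\in I$, there is an $N\in\mathbb{N}_{>0}$ such that, for each choice of sign $\pm$, the curve $t\mapsto P(t_0\pm(t-t_0)^N)$ admits definable $C^\infty$ parameterizations of its roots locally near $t_0$, i.e. there are definable $C^\infty$ functions $\lambda_1,\dots,\lambda_n$ with values in $\mathbb{C}$, defined on a neighborhood of $t_0$, such that $P(t_0\pm(t-t_0)^N)(x)=\prod_{j=1}^n(x-\lambda_j(t))$ for all $t$ near $t_0$.
   Context: Fix an arbitrary o-minimal structure $\mathcal{M}$ on $(\mathbb{R},+,\cdot)$: families $\mathcal{M}_n$ of subsets of $\mathbb{R}^n$ ($n\ge 1$) closed under finite set-theoretical operations, products and coordinate projections, containing all sets $\{f=0, g_1>0,\dots,g_l>0\}$ with $f,g_i$ real polynomials, and such that $\mathcal{M}_1$ consists exactly of the finite unions of open intervals and points. A set is definable if it belongs to some $\mathcal{M}_n$; a map between subsets of Euclidean spaces is definable if its graph is definable. A complex valued function $f$ on an interval is definable if $(\operatorname{Re} f,\operatorname{Im} f)$ is definable as a map into $\mathbb{R}^2$. *)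

theory Defs
  imports "HOL-Analysis.Analysis" "HOL-Computational_Algebra.Polynomial"
begin

text \<open>
  Since the dimension varies, a point of $R^n$ is a real list of length \<open>n\<close>
  and a subset of $R^n$ is a set of such lists; a Cartesian product is formed by appending.
\<close>

abbreviation Rn :: "nat \<Rightarrow> real list set" where
  "Rn n \<equiv> {x. length x = n}"

text \<open>The counterpart of \<^const>\<open>real_polynomial_function\<close> for points given as lists.\<close>

inductive polynomial_fun :: "nat \<Rightarrow> (real list \<Rightarrow> real) \<Rightarrow> bool" for n :: nat where
  const: "polynomial_fun n (\<lambda>x. c)"
| coord: "i < n \<Longrightarrow> polynomial_fun n (\<lambda>x. x ! i)"
| add: "polynomial_fun n f \<Longrightarrow> polynomial_fun n g \<Longrightarrow> polynomial_fun n (\<lambda>x. f x + g x)"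
| mult: "polynomial_fun n f \<Longrightarrow> polynomial_fun n g \<Longrightarrow> polynomial_fun n (\<lambda>x. f x * g x)"

text \<open>Possibly unbounded (and possibly empty).\<close>

definition open_interval :: "real set \<Rightarrow> bool" where
  "open_interval I \<longleftrightarrow> open I \<and> is_interval I"

text \<open>
  The families are indexed by \<open>n \<ge> 1\<close>; the value \<open>M 0\<close> is irrelevant.
  The coordinate projections of $R^n$ keep the coordinates with index in a nonempty set \<open>J\<close>.
\<close>

locale o_minimal_structure =
  fixes M :: "nat \<Rightarrow> real list set set"
  assumes subset_Rn: "\<And>n S. n \<ge> 1 \<Longrightarrow> S \<in> M n \<Longrightarrow> S \<subseteq> Rn n"
    and union: "\<And>n S T. n \<ge> 1 \<Longrightarrow> S \<in> M n \<Longrightarrow> T \<in> M n \<Longrightarrow> S \<union> T \<in> M n"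
    and inter: "\<And>n S T. n \<ge> 1 \<Longrightarrow> S \<in> M n \<Longrightarrow> T \<in> M n \<Longrightarrow> S \<inter> T \<in> M n"
    and complement: "\<And>n S. n \<ge> 1 \<Longrightarrow> S \<in> M n \<Longrightarrow> Rn n - S \<in> M n"
    and product: "\<And>m n S T. m \<ge> 1 \<Longrightarrow> n \<ge> 1 \<Longrightarrow> S \<in> M m \<Longrightarrow> T \<in> M n \<Longrightarrow>
                    {x @ y | x y. x \<in> S \<and> y \<in> T} \<in> M (m + n)"
    and projection: "\<And>n S J. n \<ge> 1 \<Longrightarrow> S \<in> M n \<Longrightarrow> J \<subseteq> {..<n} \<Longrightarrow> J \<noteq> {} \<Longrightarrow>
                    (\<lambda>x. nths x J) ` S \<in> M (card J)"
    and semialgebraic: "\<And>n f G. n \<ge> 1 \<Longrightarrow> polynomial_fun n f \<Longrightarrow> finite G \<Longrightarrow>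
                    (\<And>g. g \<in> G \<Longrightarrow> polynomial_fun n g) \<Longrightarrow>
                    {x \<in> Rn n. f x = 0 \<and> (\<forall>g\<in>G. g x > 0)} \<in> M n"
    and o_minimal: "M 1 = {(\<lambda>t. [t]) ` (\<Union>\<F>) | \<F>. finite \<F> \<and>
                    (\<forall>A\<in>\<F>. open_interval A \<or> (\<exists>t. A = {t}))}"

definition definable_map ::
  "(nat \<Rightarrow> real list set set) \<Rightarrow> nat \<Rightarrow> nat \<Rightarrow> real list set \<Rightarrow> (real list \<Rightarrow> real list) \<Rightarrow> bool" where
  "definable_map M m k A f \<longleftrightarrow>
     A \<subseteq> Rn m \<and> f ` A \<subseteq> Rn k \<and> {x @ f x | x. x \<in> A} \<in> M (m + k)"

definition definable_complex_on ::
  "(nat \<Rightarrow> real list set set) \<Rightarrow> real set \<Rightarrow> (real \<Rightarrow> complex) \<Rightarrow> bool" where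
  "definable_complex_on M I f \<longleftrightarrow>
     definable_map M 1 2 ((\<lambda>t. [t]) ` I) (\<lambda>x. [Re (f (hd x)), Im (f (hd x))])"

text \<open>
  All iterated derivatives exist at every point of \<open>I\<close>. Only meant for open \<open>I\<close>,
  where values outside \<open>I\<close> play no role.
\<close>

definition C_infinity_on :: "real set \<Rightarrow> (real \<Rightarrow> complex) \<Rightarrow> bool" where
  "C_infinity_on I f \<longleftrightarrow>
     (\<forall>k. \<forall>t\<in>I. ((\<lambda>g s. vector_derivative g (at s)) ^^ k) f differentiable (at t))"

definition curve_poly :: "nat \<Rightarrow> (nat \<Rightarrow> real \<Rightarrow> complex) \<Rightarrow> real \<Rightarrow> complex poly" where
  "curve_poly n a t = monom 1 n + (\<Sum>j=1..n. monom ((-1) ^ j * a j t) (n - j))"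

end

theory Submission
  imports Defs "HOL-Computational_Algebra.Computational_Algebra"
begin

text \<open>
  After a translation let \<open>t0 = 0\<close>. Replacing the coefficients by their Taylor series at \<open>0\<close> turns
  the curve \<open>P\<close> into a monic polynomial over the ring of formal power series, and by Puiseux's theorem
  (\<open>puiseux\<close>) it splits into linear factors after the substitution of \<open>X\<^sup>N\<close> for \<open>X\<close>; multiplying
  the exponents for \<open>P(t)\<close> and \<open>P(-t)\<close> yields an \<open>N\<close> that serves both signs. It remains to show that
  the formal roots are the Taylor series of smooth definable roots. The coefficients may differ from
  their Taylor series by flat functions, and o-minimality is what keeps these harmless.

  Consider \<open>t > 0\<close> first, and the germs at \<open>0\<close> of definable functions that are smooth for small
  \<open>t > 0\<close> and have an asymptotic expansion in powers of \<open>t\<close> (\<open>regular\<close>). They form a ring, and their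
  expansions may be differentiated: a smooth definable function that is \<open>O(t\<^sup>K\<^sup>+\<^sup>2)\<close> has a derivative that is
  \<open>O(t\<^sup>K)\<close>, since a definable derivative that fails this bound is larger than \<open>t\<^sup>K\<close> with constant sign
  and can be integrated (\<open>derivative_small\<close>, \<open>regular_deriv\<close>).

  The lexicographically largest root of the polynomial is a definable function of \<open>t\<close>. It is
  semicontinuous, hence has points of continuity by Baire's theorem, hence is continuous for small
  \<open>t > 0\<close> by o-minimality. Its multiplicity is constant for small \<open>t\<close>, so it is a simple root of a
  derivative of the polynomial and therefore smooth (\<open>smooth_root_exists\<close>). Comparison with truncations
  of the formal roots shows that it has one of the formal roots as its expansion (\<open>root_expansion\<close>).
  Dividing by the linear factor and iterating gives a complete set of roots in the ring, one for each
  formal root (\<open>regular_roots\<close>).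

  For \<open>t < 0\<close> the same applies in the variable \<open>-t\<close>. The germs on the two sides that belong to the same
  formal root have matching limits of all derivatives at \<open>0\<close>, so together they form a smooth function
  (\<open>glue_Ck\<close>), which is definable because it is defined by cases from definable functions.
\<close>

unbundle no vec_syntax

section \<open>Definable predicates and functions\<close>

context o_minimal_structure
begin

lemma Rn_definable: "n \<ge> 1 \<Longrightarrow> Rn n \<in> M n"
  using semialgebraic[of n "\<lambda>x. 0" "{}"] by (simp add: polynomial_fun.const)

lemma polynomial_fun_sum:
  assumes "finite A" "\<And>a. a \<in> A \<Longrightarrow> polynomial_fun n (f a)"
  shows "polynomial_fun n (\<lambda>x. \<Sum>a\<in>A. f a x)"
  using assms by (induction A) (auto intro: polynomial_fun.intros)

lemma polynomial_fun_diff: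
  assumes "polynomial_fun n f" "polynomial_fun n g"
  shows "polynomial_fun n (\<lambda>x. f x - g x)"
proof -
  have "polynomial_fun n (\<lambda>x. f x + (-1) * g x)"
    by (intro polynomial_fun.intros assms)
  then show ?thesis by simp
qed

text \<open>
  Every change of variables comes from this one construction: form all pairs of a point of \<open>S\<close> and a
  point \<open>y\<close>, impose the equations \<open>x ! i = y ! j\<close> (the zero set of a sum of squares) and
  project to \<open>y\<close>. Dummy variables, renaming of variables and existential quantification
  are obtained by choosing the equations.
\<close>

lemma relational_image_in_M:
  assumes "S \<in> M n" "n \<ge> 1" "m \<ge> 1" "E \<subseteq> {..<n} \<times> {..<m}"
  shows "{y \<in> Rn m. \<exists>x\<in>S. \<forall>(i, j)\<in>E. x ! i = y ! j} \<in> M m"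
proof -
  have fE: "finite E"
    by (rule finite_subset[OF assms(4)]) simp
  define f :: "real list \<Rightarrow> real" where
    "f z = (\<Sum>a\<in>E. (z ! fst a - z ! (n + snd a)) * (z ! fst a - z ! (n + snd a)))" for z
  define T where "T = {x @ y | x y. x \<in> S \<and> y \<in> Rn m} \<inter> {z \<in> Rn (n + m). f z = 0}"
  have "polynomial_fun (n + m) f"
    unfolding f_def using assms(4)
    by (intro polynomial_fun_sum fE polynomial_fun.mult polynomial_fun_diff polynomial_fun.coord)
       auto
  then have "{z \<in> Rn (n + m). f z = 0} \<in> M (n + m)"
    using semialgebraic[of "n + m" f "{}"] assms by simp
  then have T: "T \<in> M (n + m)"
    unfolding T_def using assms by (intro inter product Rn_definable) auto
  have S: "length x = n" if "x \<in> S" for x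
    using subset_Rn[OF assms(2,1)] that by auto
  have f0: "f (x @ y) = 0 \<longleftrightarrow> (\<forall>(i, j)\<in>E. x ! i = y ! j)" if "x \<in> S" for x y
  proof -
    have "f (x @ y) = (\<Sum>a\<in>E. (x ! fst a - y ! snd a) * (x ! fst a - y ! snd a))"
      unfolding f_def using assms(4) S[OF that]
      by (intro sum.cong refl) (auto simp: nth_append)
    also have "\<dots> = 0 \<longleftrightarrow> (\<forall>(i, j)\<in>E. x ! i = y ! j)"
      by (subst sum_nonneg_eq_0_iff[OF fE]) auto
    finally show ?thesis .
  qed
  have "(\<lambda>x. nths x {n..<n+m}) ` T \<in> M (card {n..<n+m})"
    using assms by (intro projection[OF _ T]) auto
  moreover have nt: "nths (x @ y) {n..<n+m} = y" if "length x = n" "length y = m" for x y :: "real list"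
  proof -
    have a: "nths x {n..<n+m} = []"
    proof -
      have "set (nths x {n..<n+m}) = {}"
        using that by (auto simp: set_nths)
      then show ?thesis by simp
    qed
    have "{j. j + length x \<in> {n..<n+m}} = {..<m}" using that by auto
    then show ?thesis using that a by (simp add: nths_append)
  qed
  have "(\<lambda>x. nths x {n..<n+m}) ` T = {y \<in> Rn m. \<exists>x\<in>S. \<forall>(i, j)\<in>E. x ! i = y ! j}"
  proof (intro equalityI subsetI)
    fix y assume "y \<in> (\<lambda>x. nths x {n..<n+m}) ` T"
    then obtain x y' where "x \<in> S" "length y' = m" "f (x @ y') = 0" "y = nths (x @ y') {n..<n+m}"
      unfolding T_def by auto
    then show "y \<in> {y \<in> Rn m. \<exists>x\<in>S. \<forall>(i, j)\<in>E. x ! i = y ! j}"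
      using nt[of x y'] S f0 by auto
  next
    fix y assume "y \<in> {y \<in> Rn m. \<exists>x\<in>S. \<forall>(i, j)\<in>E. x ! i = y ! j}"
    then obtain x where x: "x \<in> S" "length y = m" "\<forall>(i, j)\<in>E. x ! i = y ! j" by auto
    then have "x @ y \<in> T" unfolding T_def using S f0 by auto
    then show "y \<in> (\<lambda>x. nths x {n..<n+m}) ` T"
      using nt[of x y] x S by (metis imageI)
  qed
  ultimately show ?thesis by simp
qed

text \<open>
  Predicates on assignments \<open>e :: nat \<Rightarrow> real\<close> of infinitely many variables, finitely
  many of which matter. This treats all arities at once and makes quantification the updating of
  one variable.
\<close>

definition definable :: "((nat \<Rightarrow> real) \<Rightarrow> bool) \<Rightarrow> bool" where
  "definable \<phi> \<longleftrightarrow> (\<exists>n\<ge>1. (\<forall>e e'. (\<forall>i<n. e i = e' i) \<longrightarrow> \<phi> e = \<phi> e') \<and>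
                {x \<in> Rn n. \<phi> ((!) x)} \<in> M n)"

lemma definable_relational_image:
  assumes "n \<ge> 1" "{x \<in> Rn n. \<phi> ((!) x)} \<in> M n" "\<And>i j. (i, j) \<in> E \<Longrightarrow> i < n \<and> j < m" "m \<ge> 1"
    "\<And>e e'. (\<forall>i<m. e i = e' i) \<Longrightarrow> \<psi> e = \<psi> e'"
    "\<And>y. length y = m \<Longrightarrow>
       \<psi> ((!) y) = (\<exists>x. length x = n \<and> \<phi> ((!) x) \<and> (\<forall>(i, j)\<in>E. x ! i = y ! j))"
  shows "definable \<psi>"
  unfolding definable_def
proof (intro exI conjI)
  show "m \<ge> 1" by fact
  show "\<forall>e e'. (\<forall>i<m. e i = e' i) \<longrightarrow> \<psi> e = \<psi> e'" using assms(5) by blast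
  have "{y \<in> Rn m. \<psi> ((!) y)} = {y \<in> Rn m. \<exists>x\<in>{x \<in> Rn n. \<phi> ((!) x)}. \<forall>(i, j)\<in>E. x ! i = y ! j}"
    using assms(6) by auto
  moreover have "E \<subseteq> {..<n} \<times> {..<m}" using assms(3) by auto
  ultimately show "{y \<in> Rn m. \<psi> ((!) y)} \<in> M m"
    using relational_image_in_M[OF assms(2,1,4), of E] by simp
qed

lemma definable_raise:
  assumes "n \<ge> 1" "\<And>e e'. (\<forall>i<n. e i = e' i) \<Longrightarrow> \<phi> e = \<phi> e'"
    "{x \<in> Rn n. \<phi> ((!) x)} \<in> M n" "n \<le> m"
  shows "{x \<in> Rn m. \<phi> ((!) x)} \<in> M m"
proof -
  have "{y \<in> Rn m. \<phi> ((!) y)} =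
        {y \<in> Rn m. \<exists>x\<in>{x \<in> Rn n. \<phi> ((!) x)}. \<forall>(i, j)\<in>{(i, i) | i. i < n}. x ! i = y ! j}"
    (is "?L = ?R")
  proof (intro equalityI subsetI)
    fix y assume y: "y \<in> ?L"
    have "\<phi> ((!) (take n y)) = \<phi> ((!) y)" by (rule assms(2)) simp
    then show "y \<in> ?R" using y assms(4)
      by (auto intro!: exI[of _ "take n y"])
  next
    fix y assume "y \<in> ?R"
    then obtain x where x: "length y = m" "length x = n" "\<phi> ((!) x)" "\<forall>i<n. x ! i = y ! i" by auto
    then show "y \<in> ?L" using assms(2)[of "(!) x" "(!) y"] by auto
  qed
  also have "\<dots> \<in> M m"
    using assms by (intro relational_image_in_M) auto
  finally show ?thesis .
qed

lemma definable_common: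
  assumes "definable \<phi>"
  shows "\<exists>n0\<ge>1. \<forall>n\<ge>n0. {x \<in> Rn n. \<phi> ((!) x)} \<in> M n \<and>
           (\<forall>e e'. (\<forall>i<n. e i = e' i) \<longrightarrow> \<phi> e = \<phi> e')"
proof -
  from assms obtain n0 where n0: "n0 \<ge> 1" "\<And>e e'. (\<forall>i<n0. e i = e' i) \<Longrightarrow> \<phi> e = \<phi> e'"
    "{x \<in> Rn n0. \<phi> ((!) x)} \<in> M n0" unfolding definable_def by blast
  show ?thesis
  proof (intro exI[of _ n0] conjI allI impI)
    show "{x \<in> Rn n. \<phi> ((!) x)} \<in> M n" if "n \<ge> n0" for n
      by (rule definable_raise[OF n0 that])
    show "\<phi> e = \<phi> e'" if "n \<ge> n0" "\<forall>i<n. e i = e' i" for n e e'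
      using that by (intro n0(2)) auto
  qed (use n0 in auto)
qed

lemma definable_not:
  assumes "definable \<phi>"
  shows "definable (\<lambda>e. \<not> \<phi> e)"
proof -
  obtain n where n: "n \<ge> 1" "{x \<in> Rn n. \<phi> ((!) x)} \<in> M n"
    "\<And>e e'. (\<forall>i<n. e i = e' i) \<Longrightarrow> \<phi> e = \<phi> e'" using assms unfolding definable_def by blast
  have "{x \<in> Rn n. \<not> \<phi> ((!) x)} = Rn n - {x \<in> Rn n. \<phi> ((!) x)}" by auto
  also have "\<dots> \<in> M n" using n by (intro complement)
  finally show ?thesis unfolding definable_def using n by blast
qed

lemma definable_and:
  assumes "definable \<phi>" "definable \<psi>"
  shows "definable (\<lambda>e. \<phi> e \<and> \<psi> e)"
proof -
  from definable_common[OF assms(1)] obtain n where n: "n \<ge> 1"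
    "\<And>m. m \<ge> n \<Longrightarrow> {x \<in> Rn m. \<phi> ((!) x)} \<in> M m"
    "\<And>m e e'. m \<ge> n \<Longrightarrow> (\<forall>i<m. e i = e' i) \<Longrightarrow> \<phi> e = \<phi> e'" by blast
  from definable_common[OF assms(2)] obtain k where k: "k \<ge> 1"
    "\<And>m. m \<ge> k \<Longrightarrow> {x \<in> Rn m. \<psi> ((!) x)} \<in> M m"
    "\<And>m e e'. m \<ge> k \<Longrightarrow> (\<forall>i<m. e i = e' i) \<Longrightarrow> \<psi> e = \<psi> e'" by blast
  define m where "m = max n k"
  have m: "m \<ge> 1" "m \<ge> n" "m \<ge> k" using n k by (auto simp: m_def)
  have "{x \<in> Rn m. \<phi> ((!) x) \<and> \<psi> ((!) x)} = {x \<in> Rn m. \<phi> ((!) x)} \<inter> {x \<in> Rn m. \<psi> ((!) x)}"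
    by auto
  also have "\<dots> \<in> M m" using n k m by (intro inter) auto
  finally show ?thesis unfolding definable_def
    using m n(3)[OF m(2)] k(3)[OF m(3)] by (intro exI[of _ m]) blast
qed

lemma definable_or:
  assumes "definable \<phi>" "definable \<psi>"
  shows "definable (\<lambda>e. \<phi> e \<or> \<psi> e)"
proof -
  have "definable (\<lambda>e. \<not> (\<not> \<phi> e \<and> \<not> \<psi> e))"
    by (rule definable_not, rule definable_and; rule definable_not, rule assms)
  moreover have "(\<lambda>e. \<not> (\<not> \<phi> e \<and> \<not> \<psi> e)) = (\<lambda>e. \<phi> e \<or> \<psi> e)" by blast
  ultimately show ?thesis by metis
qed

lemma definable_imp:
  assumes "definable \<phi>" "definable \<psi>"
  shows "definable (\<lambda>e. \<phi> e \<longrightarrow> \<psi> e)"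
  unfolding imp_conv_disj by (rule definable_or, rule definable_not; rule assms)

lemma definable_rename:
  assumes "definable \<phi>"
  shows "definable (\<lambda>e. \<phi> (\<lambda>i. e (\<pi> i)))"
proof -
  obtain n where n: "n \<ge> 1" "{x \<in> Rn n. \<phi> ((!) x)} \<in> M n"
    "\<And>e e'. (\<forall>i<n. e i = e' i) \<Longrightarrow> \<phi> e = \<phi> e'" using assms unfolding definable_def by blast
  define m where "m = Suc (Max (\<pi> ` {..<n}))"
  have m: "\<pi> i < m" if "i < n" for i
    using that by (auto simp: m_def less_Suc_eq_le)
  show ?thesis
  proof (rule definable_relational_image[OF n(1,2), of "{(i, \<pi> i) | i. i < n}" m])
    fix y :: "real list" assume y: "length y = m"
    show "\<phi> (\<lambda>i. y ! \<pi> i) = (\<exists>x. length x = n \<and> \<phi> ((!) x) \<and>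
             (\<forall>(i, j)\<in>{(i, \<pi> i) |i. i < n}. x ! i = y ! j))"
    proof
      assume a: "\<phi> (\<lambda>i. y ! \<pi> i)"
      have "\<phi> ((!) (map (\<lambda>i. y ! \<pi> i) [0..<n])) = \<phi> (\<lambda>i. y ! \<pi> i)"
        by (rule n(3)) auto
      with a show "\<exists>x. length x = n \<and> \<phi> ((!) x) \<and> (\<forall>(i, j)\<in>{(i, \<pi> i) |i. i < n}. x ! i = y ! j)"
        by (intro exI[of _ "map (\<lambda>i. y ! \<pi> i) [0..<n]"]) auto
    next
      assume "\<exists>x. length x = n \<and> \<phi> ((!) x) \<and> (\<forall>(i, j)\<in>{(i, \<pi> i) |i. i < n}. x ! i = y ! j)"
      then obtain x where "\<phi> ((!) x)" "\<forall>i<n. x ! i = y ! \<pi> i" by auto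
      then show "\<phi> (\<lambda>i. y ! \<pi> i)" using n(3)[of "(!) x" "\<lambda>i. y ! \<pi> i"] by auto
    qed
  next
    show "\<phi> (\<lambda>i. e (\<pi> i)) = \<phi> (\<lambda>i. e' (\<pi> i))" if "\<forall>i<m. e i = e' i" for e e'
      using that m by (intro n(3)) auto
  qed (use m n in \<open>auto simp: m_def\<close>)
qed

lemma definable_ex_upd:
  assumes "definable \<phi>"
  shows "definable (\<lambda>e. \<exists>v. \<phi> (e(k := v)))"
proof -
  obtain n where n: "n \<ge> 1" "{x \<in> Rn n. \<phi> ((!) x)} \<in> M n"
    "\<And>e e'. (\<forall>i<n. e i = e' i) \<Longrightarrow> \<phi> e = \<phi> e'" using assms unfolding definable_def by blast
  show ?thesis
  proof (rule definable_relational_image[OF n(1,2), of "{(i, i) | i. i < n \<and> i \<noteq> k}" n])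
    fix y :: "real list" assume y: "length y = n"
    show "(\<exists>v. \<phi> (((!) y)(k := v))) = (\<exists>x. length x = n \<and> \<phi> ((!) x) \<and>
             (\<forall>(i, j)\<in>{(i, i) |i. i < n \<and> i \<noteq> k}. x ! i = y ! j))"
    proof
      assume "\<exists>v. \<phi> (((!) y)(k := v))"
      then obtain v where a: "\<phi> (((!) y)(k := v))" ..
      have "\<phi> ((!) (y[k := v])) = \<phi> (((!) y)(k := v))"
        using y by (intro n(3)) (auto simp: nth_list_update)
      with a show "\<exists>x. length x = n \<and> \<phi> ((!) x) \<and>
             (\<forall>(i, j)\<in>{(i, i) |i. i < n \<and> i \<noteq> k}. x ! i = y ! j)"
        using y by (intro exI[of _ "y[k := v]"]) (auto simp: nth_list_update)
    next
      assume "\<exists>x. length x = n \<and> \<phi> ((!) x) \<and>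
             (\<forall>(i, j)\<in>{(i, i) |i. i < n \<and> i \<noteq> k}. x ! i = y ! j)"
      then obtain x where "\<phi> ((!) x)" "\<forall>i<n. i \<noteq> k \<longrightarrow> x ! i = y ! i" by auto
      then show "\<exists>v. \<phi> (((!) y)(k := v))"
        using n(3)[of "(!) x" "((!) y)(k := x ! k)"] by auto
    qed
  next
    show "(\<exists>v. \<phi> (e(k := v))) = (\<exists>v. \<phi> (e'(k := v)))" if "\<forall>i<n. e i = e' i" for e e'
      using n(3)[of "e(k := _)" "e'(k := _)"] that by (metis fun_upd_apply)
  qed (use n in auto)
qed

text \<open>
  The second assumption says that the variable \<open>k\<close> is fresh for \<open>P y\<close>.
\<close>

lemma definable_ex:
  assumes "definable (\<lambda>e. P (e k) e)" "\<And>y z e. P y (e(k := z)) = P y e"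
  shows "definable (\<lambda>e. \<exists>y. P y e)"
  using definable_ex_upd[OF assms(1), of k] by (simp add: assms(2))

lemma definable_all:
  assumes "definable (\<lambda>e. P (e k) e)" "\<And>y z e. P y (e(k := z)) = P y e"
  shows "definable (\<lambda>e. \<forall>y. P y e)"
proof -
  have "definable (\<lambda>e. \<not> (\<exists>y. \<not> P y e))"
    by (rule definable_not, rule definable_ex[where k = k], rule definable_not, rule assms(1)) (simp only: assms(2))
  then show ?thesis by (simp only: not_ex not_not)
qed

lemma definable_polynomial:
  assumes "polynomial_fun n f" "n \<ge> 1" "\<And>e. f (map e [0..<n]) = F e"
    "\<And>e e'. (\<forall>i<n. e i = e' i) \<Longrightarrow> F e = F e'"
  shows "definable (\<lambda>e. F e = (0::real))" "definable (\<lambda>e. F e > 0)"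
proof -
  have F: "F ((!) x) = f x" if "length x = n" for x
    using assms(3)[of "(!) x"] map_nth[of x] that by simp
  have "{x \<in> Rn n. F ((!) x) = 0} = {x \<in> Rn n. f x = 0 \<and> (\<forall>g\<in>({} :: (real list \<Rightarrow> real) set). g x > 0)}"
    using F by auto
  also have "\<dots> \<in> M n" using assms by (intro semialgebraic) auto
  finally have *: "{x \<in> Rn n. F ((!) x) = 0} \<in> M n" .
  show "definable (\<lambda>e. F e = 0)" unfolding definable_def
  proof (intro exI conjI)
    show "\<forall>e e'. (\<forall>i<n. e i = e' i) \<longrightarrow> (F e = 0) = (F e' = 0)"
      using assms(4) by metis
  qed (use * assms in auto)
  have "{x \<in> Rn n. F ((!) x) > 0} = {x \<in> Rn n. (\<lambda>_. 0) x = (0::real) \<and> (\<forall>g\<in>{f}. g x > 0)}"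
    using F by auto
  also have "\<dots> \<in> M n" using assms by (intro semialgebraic) (auto intro: polynomial_fun.intros)
  finally have *: "{x \<in> Rn n. F ((!) x) > 0} \<in> M n" .
  show "definable (\<lambda>e. F e > 0)" unfolding definable_def
  proof (intro exI conjI)
    show "\<forall>e e'. (\<forall>i<n. e i = e' i) \<longrightarrow> (F e > 0) = (F e' > 0)"
      using assms(4) by metis
  qed (use * assms in auto)
qed

lemma definable_atom_add: "definable (\<lambda>e. e 0 = e 1 + e 2)"
proof -
  have "definable (\<lambda>e. e 0 - (e 1 + e 2) = 0)"
    by (rule definable_polynomial[where n = 3 and f = "\<lambda>x. x ! 0 - (x ! 1 + x ! 2)"])
       (auto intro!: polynomial_fun.intros polynomial_fun_diff simp: numeral_2_eq_2)
  then show ?thesis by simp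
qed

lemma definable_atom_mult: "definable (\<lambda>e. e 0 = e 1 * e 2)"
proof -
  have "definable (\<lambda>e. e 0 - (e 1 * e 2) = 0)"
    by (rule definable_polynomial[where n = 3 and f = "\<lambda>x. x ! 0 - (x ! 1 * x ! 2)"])
       (auto intro!: polynomial_fun.intros polynomial_fun_diff simp: numeral_2_eq_2)
  then show ?thesis by simp
qed

lemma definable_atom_eq: "definable (\<lambda>e. e 0 = e 1)"
proof -
  have "definable (\<lambda>e. e 0 - e 1 = 0)"
    by (rule definable_polynomial[where n = 3 and f = "\<lambda>x. x ! 0 - x ! 1"])
       (auto intro!: polynomial_fun.intros polynomial_fun_diff simp: numeral_2_eq_2)
  then show ?thesis by simp
qed

lemma definable_atom_less: "definable (\<lambda>e. e 0 < e 1)"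
proof -
  have "definable (\<lambda>e. e 1 - e 0 > 0)"
    by (rule definable_polynomial[where n = 3 and f = "\<lambda>x. x ! 1 - x ! 0"])
       (auto intro!: polynomial_fun.intros polynomial_fun_diff simp: numeral_2_eq_2)
  then show ?thesis by simp
qed

lemma definable_atom_const: "definable (\<lambda>e. e 0 = c)"
proof -
  have "definable (\<lambda>e. e 0 - c = 0)"
    by (rule definable_polynomial[where n = 1 and f = "\<lambda>x. x ! 0 - c"])
       (auto intro!: polynomial_fun.intros polynomial_fun_diff simp: numeral_2_eq_2)
  then show ?thesis by simp
qed

text \<open>
  The value is named by a variable \<open>k\<close>, and \<open>n\<close> bounds the variables of \<open>f\<close>, so that
  \<open>k \<ge> n\<close> is fresh.
\<close>

definition definable_fun :: "((nat \<Rightarrow> real) \<Rightarrow> real) \<Rightarrow> bool" where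
  "definable_fun f \<longleftrightarrow> (\<exists>n. (\<forall>e e'. (\<forall>i<n. e i = e' i) \<longrightarrow> f e = f e') \<and>
                   (\<forall>k\<ge>n. definable (\<lambda>e. e k = f e)))"

lemma definable_fun_var: "definable_fun (\<lambda>e. e i)"
  unfolding definable_fun_def
proof (intro exI conjI allI impI)
  fix k
  show "definable (\<lambda>e. e k = e i)"
    using definable_rename[OF definable_atom_eq, of "\<lambda>j. if j = 0 then k else i"] by simp
  show "e i = e' i" if "\<forall>j<Suc i. e j = e' j" for e e' :: "nat \<Rightarrow> real"
    using that by simp
qed

lemma definable_fun_const: "definable_fun (\<lambda>e. c)"
  unfolding definable_fun_def
proof (intro exI conjI allI impI)
  fix k
  show "definable (\<lambda>e. e k = c)"
    using definable_rename[OF definable_atom_const, of "\<lambda>j. k"] by simp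
qed auto

text \<open>
  Substitution of functions for variables: name the values by three fresh variables and quantify
  them away.
\<close>

lemma definable_rel3:
  assumes R: "definable (\<lambda>e. R (e 0) (e 1) (e 2))" and "definable_fun f" "definable_fun g" "definable_fun h"
  shows "definable (\<lambda>e. R (f e) (g e) (h e))"
proof -
  obtain n1 where n1: "\<And>e e'. (\<forall>i<n1. e i = e' i) \<Longrightarrow> f e = f e'" "\<And>k. k \<ge> n1 \<Longrightarrow> definable (\<lambda>e. e k = f e)"
    using assms(2) unfolding definable_fun_def by blast
  obtain n2 where n2: "\<And>e e'. (\<forall>i<n2. e i = e' i) \<Longrightarrow> g e = g e'" "\<And>k. k \<ge> n2 \<Longrightarrow> definable (\<lambda>e. e k = g e)"
    using assms(3) unfolding definable_fun_def by blast
  obtain n3 where n3: "\<And>e e'. (\<forall>i<n3. e i = e' i) \<Longrightarrow> h e = h e'" "\<And>k. k \<ge> n3 \<Longrightarrow> definable (\<lambda>e. e k = h e)"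
    using assms(4) unfolding definable_fun_def by blast
  define k where "k = n1 + n2 + n3"
  have fr: "f (e(j := v)) = f e" "g (e(j := v)) = g e" "h (e(j := v)) = h e" if "j \<ge> k" for e j v
    using that by (auto simp: k_def intro!: n1(1) n2(1) n3(1))
  have "definable (\<lambda>e. R (e k) (e (k+1)) (e (k+2)))"
    using definable_rename[OF R, of "\<lambda>i. k + i"] by simp
  then have "definable (\<lambda>e. R (e k) (e (k+1)) (e (k+2)) \<and> e k = f e \<and> e (k+1) = g e \<and> e (k+2) = h e)"
    by (intro definable_and n1 n2 n3) (auto simp: k_def)
  from definable_ex_upd[OF definable_ex_upd[OF definable_ex_upd[OF this, of k], of "k+1"], of "k+2"]
  show ?thesis using fr by simp
qed

lemma definable_rel2: "definable (\<lambda>e. R (e 0) (e 1)) \<Longrightarrow> definable_fun f \<Longrightarrow> definable_fun g \<Longrightarrow> definable (\<lambda>e. R (f e) (g e))"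
  using definable_rel3[of "\<lambda>x y z. R x y" f g f] by simp

lemma definable_eq: "definable_fun f \<Longrightarrow> definable_fun g \<Longrightarrow> definable (\<lambda>e. f e = g e)"
  using definable_rel2[of "(=)"] definable_atom_eq by simp

lemma definable_less: "definable_fun f \<Longrightarrow> definable_fun g \<Longrightarrow> definable (\<lambda>e. f e < g e)"
  using definable_rel2[of "(<)"] definable_atom_less by simp

lemma definable_le: "definable_fun f \<Longrightarrow> definable_fun g \<Longrightarrow> definable (\<lambda>e. f e \<le> g e)"
  using definable_not[OF definable_less, of g f] by (simp add: not_less)

lemma definable_fun_op2:
  assumes R: "definable (\<lambda>e. e 0 = h (e 1) (e 2))" and "definable_fun f" "definable_fun g"
  shows "definable_fun (\<lambda>e. h (f e) (g e))"
proof -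
  obtain n1 where n1: "\<And>e e'. (\<forall>i<n1. e i = e' i) \<Longrightarrow> f e = f e'"
    "\<And>k. k \<ge> n1 \<Longrightarrow> definable (\<lambda>e. e k = f e)"
    using assms(2) unfolding definable_fun_def by blast
  obtain n2 where n2: "\<And>e e'. (\<forall>i<n2. e i = e' i) \<Longrightarrow> g e = g e'"
    "\<And>k. k \<ge> n2 \<Longrightarrow> definable (\<lambda>e. e k = g e)"
    using assms(3) unfolding definable_fun_def by blast
  show ?thesis unfolding definable_fun_def
  proof (intro exI[of _ "n1 + n2"] conjI allI impI)
    show "definable (\<lambda>e. e k = h (f e) (g e))" for k
      by (rule definable_rel3[of "\<lambda>x y z. x = h y z"]) (use R assms definable_fun_var in auto)
    show "h (f e) (g e) = h (f e') (g e')" if "\<forall>i<n1 + n2. e i = e' i" for e e'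
      using n1(1)[of e e'] n2(1)[of e e'] that by auto
  qed
qed

lemma definable_fun_add: "definable_fun f \<Longrightarrow> definable_fun g \<Longrightarrow> definable_fun (\<lambda>e. f e + g e)"
  by (rule definable_fun_op2[OF definable_atom_add])

lemma definable_fun_mult: "definable_fun f \<Longrightarrow> definable_fun g \<Longrightarrow> definable_fun (\<lambda>e. f e * g e)"
  by (rule definable_fun_op2[OF definable_atom_mult])

lemma definable_fun_diff: "definable_fun f \<Longrightarrow> definable_fun g \<Longrightarrow> definable_fun (\<lambda>e. f e - g e)"
  using definable_fun_add[OF _ definable_fun_mult[OF definable_fun_const[of "-1"]], of f g] by simp

lemma definable_fun_if:
  assumes "definable \<phi>" "definable_fun f" "definable_fun g"
  shows "definable_fun (\<lambda>e. if \<phi> e then f e else g e)"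
proof -
  obtain n1 where n1: "\<And>e e'. (\<forall>i<n1. e i = e' i) \<Longrightarrow> f e = f e'"
    "\<And>k. k \<ge> n1 \<Longrightarrow> definable (\<lambda>e. e k = f e)"
    using assms(2) unfolding definable_fun_def by blast
  obtain n2 where n2: "\<And>e e'. (\<forall>i<n2. e i = e' i) \<Longrightarrow> g e = g e'"
    "\<And>k. k \<ge> n2 \<Longrightarrow> definable (\<lambda>e. e k = g e)"
    using assms(3) unfolding definable_fun_def by blast
  obtain n3 where n3: "n3 \<ge> 1" "{x \<in> Rn n3. \<phi> ((!) x)} \<in> M n3" "\<And>e e'. (\<forall>i<n3. e i = e' i) \<Longrightarrow> \<phi> e = \<phi> e'"
    using assms(1) unfolding definable_def by blast
  show ?thesis unfolding definable_fun_def
  proof (intro exI[of _ "n1 + n2 + n3"] conjI allI impI)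
    have "definable (\<lambda>e. (\<phi> e \<and> e k = f e) \<or> (\<not> \<phi> e \<and> e k = g e))" for k
      by (intro definable_or definable_and definable_not definable_eq definable_fun_var assms)
    moreover have "(\<lambda>e. (\<phi> e \<and> e k = f e) \<or> (\<not> \<phi> e \<and> e k = g e)) =
        (\<lambda>e. e k = (if \<phi> e then f e else g e))" for k by auto
    ultimately show "definable (\<lambda>e. e k = (if \<phi> e then f e else g e))" for k by simp
    show "(if \<phi> e then f e else g e) = (if \<phi> e' then f e' else g e')"
      if "\<forall>i<n1 + n2 + n3. e i = e' i" for e e'
      using n1(1)[of e e'] n2(1)[of e e'] n3(3)[of e e'] that by auto
  qed
qed

lemma definable_fun_abs: "definable_fun f \<Longrightarrow> definable_fun (\<lambda>e. \<bar>f e\<bar>)"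
  unfolding abs_if using definable_fun_diff[OF definable_fun_const[of 0], of f]
  by (intro definable_fun_if definable_less definable_fun_const) auto

lemma definable_fun_comp:
  assumes F: "definable_fun (\<lambda>e. F (e 0))" and f: "definable_fun f"
  shows "definable_fun (\<lambda>e. F (f e))"
proof -
  obtain n1 where n1: "\<And>e e' :: nat \<Rightarrow> real. (\<forall>i<n1. e i = e' i) \<Longrightarrow> F (e 0) = F (e' 0)"
    "\<And>k. k \<ge> n1 \<Longrightarrow> definable (\<lambda>e. e k = F (e 0))"
    using F unfolding definable_fun_def by blast
  from definable_rename[OF n1(2)[of "Suc n1"], of "\<lambda>i. if i = 0 then 1 else 0"]
  have "definable (\<lambda>e. e 0 = F (e 1))" by simp
  then show ?thesis using definable_fun_op2[of "\<lambda>x y. F x" f f] f by simp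
qed

lemma definable_unary_to_M1:
  assumes "definable (\<lambda>e. P (e 0))"
  shows "(\<lambda>t. [t]) ` {t. P t} \<in> M 1"
proof -
  obtain n where n: "n \<ge> 1" "{x \<in> Rn n. P (x ! 0)} \<in> M n"
    "\<And>e e' :: nat \<Rightarrow> real. (\<forall>i<n. e i = e' i) \<Longrightarrow> P (e 0) = P (e' 0)"
    using assms unfolding definable_def by blast
  have "{y \<in> Rn 1. \<exists>x\<in>{x \<in> Rn n. P (x ! 0)}. \<forall>(i, j)\<in>{(0, 0)}. x ! i = y ! j} \<in> M 1"
    using n by (intro relational_image_in_M) auto
  also have "{y \<in> Rn 1. \<exists>x\<in>{x \<in> Rn n. P (x ! 0)}. \<forall>(i, j)\<in>{(0, 0)}. x ! i = y ! j} =
     (\<lambda>t. [t]) ` {t. P t}"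
    using n(1) by (auto simp: length_Suc_conv intro!: exI[of _ "replicate n _"])
  finally show ?thesis .
qed

lemma interval_right_germ:
  assumes "is_interval (A :: real set)"
  shows "eventually (\<lambda>t. t \<in> A) (at_right c) \<or> eventually (\<lambda>t. t \<notin> A) (at_right c)"
proof (cases "\<exists>\<epsilon>>c. \<forall>t. c < t \<and> t < \<epsilon> \<longrightarrow> t \<notin> A")
  case True
  then have "eventually (\<lambda>t. t \<notin> A) (at_right c)" by (auto simp: eventually_at_right_field)
  then show ?thesis ..
next
  case False
  then have f: "\<exists>t. c < t \<and> t < \<epsilon> \<and> t \<in> A" if "\<epsilon> > c" for \<epsilon> using that by blast
  from f[of "c + 1"] obtain a where a: "a > c" "a \<in> A" by auto
  have "t \<in> A" if "c < t" "t < a" for t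
  proof -
    from f[OF that(1)] obtain b where "b < t" "b \<in> A" by blast
    then show ?thesis using assms a that unfolding is_interval_1 by (meson less_imp_le)
  qed
  then have "eventually (\<lambda>t. t \<in> A) (at_right c)"
    using a by (auto simp: eventually_at_right_field)
  then show ?thesis ..
qed

text \<open>
  A definable set of reals is a finite union of intervals and points, and each of these contains or
  misses a right neighbourhood of \<open>c\<close>. O-minimality enters the whole proof only here.
\<close>

lemma definable_germ_dichotomy:
  assumes "definable (\<lambda>e. P (e 0))"
  shows "eventually P (at_right c) \<or> eventually (\<lambda>t. \<not> P t) (at_right c)"
proof -
  from definable_unary_to_M1[OF assms] obtain F where F: "finite F"
    "\<forall>A\<in>F. open_interval A \<or> (\<exists>t. A = {t})" "(\<lambda>t. [t]) ` {t. P t} = (\<lambda>t. [t]) ` \<Union>F"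
    unfolding o_minimal by blast
  have "{t. P t} = \<Union>F" using F(3) by (subst (asm) inj_image_eq_iff) (auto simp: inj_def)
  then have P: "P t \<longleftrightarrow> (\<exists>A\<in>F. t \<in> A)" for t by auto
  have A: "eventually (\<lambda>t. t \<in> A) (at_right c) \<or> eventually (\<lambda>t. t \<notin> A) (at_right c)" if "A \<in> F" for A
  proof (rule interval_right_germ)
    from F(2) that consider "open_interval A" | t where "A = {t}" by blast
    then show "is_interval A"
    proof cases
      case 1
      then show ?thesis by (simp add: open_interval_def)
    next
      case 2
      then show ?thesis using is_interval_cc[of t t] by simp
    qed
  qed
  show ?thesis
  proof (cases "\<exists>A\<in>F. eventually (\<lambda>t. t \<in> A) (at_right c)")
    case True
    then obtain A where "A \<in> F" "eventually (\<lambda>t. t \<in> A) (at_right c)" by blast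
    then have "eventually P (at_right c)" using P by (metis (mono_tags, lifting) eventually_mono)
    then show ?thesis ..
  next
    case False
    then have "\<forall>A\<in>F. eventually (\<lambda>t. t \<notin> A) (at_right c)" using A by blast
    then have "eventually (\<lambda>t. \<forall>A\<in>F. t \<notin> A) (at_right c)" by (simp add: eventually_ball_finite_distrib F)
    then have "eventually (\<lambda>t. \<not> P t) (at_right c)" using P by (metis (mono_tags, lifting) eventually_mono)
    then show ?thesis ..
  qed
qed

end

section \<open>The theorem of Puiseux for formal power series\<close>

text \<open>
  Homomorphisms of coefficient rings act on polynomials. The instances that occur are substitution
  of a power series for the variable, the constant term of a power series, the inclusion of the
  polynomials into the power series, and evaluation of a polynomial at a point.
\<close>

locale coeff_hom =
  fixes h :: "'a::comm_ring_1 \<Rightarrow> 'b::comm_ring_1"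
  assumes h0 [simp]: "h 0 = 0" and h1 [simp]: "h 1 = 1"
    and h_add: "h (x + y) = h x + h y" and h_mult: "h (x * y) = h x * h y"
begin


lemma h_sum: "h (sum f A) = (\<Sum>a\<in>A. h (f a))"
  by (induction A rule: infinite_finite_induct) (auto simp: h_add)

lemma h_uminus: "h (- x) = - h x"
  using h_add[of x "-x"] by (simp add: eq_neg_iff_add_eq_0 add.commute)

lemma map_poly_add': "map_poly h (p + q) = map_poly h p + map_poly h q"
  by (intro poly_eqI) (simp add: coeff_map_poly h_add)

lemma map_poly_mult': "map_poly h (p * q) = map_poly h p * map_poly h q"
  by (intro poly_eqI) (simp add: coeff_map_poly coeff_mult h_sum h_mult)

lemma map_poly_linear: "map_poly h [:a, 1:] = [:h a, 1:]"
  by (simp add: map_poly_pCons)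

lemma map_poly_prod_linear:
  "map_poly h (\<Prod>i\<in>S. [:- L i, 1:]) = (\<Prod>i\<in>S. [:- h (L i), 1:])"
  by (induction S rule: infinite_finite_induct)
     (auto simp: map_poly_mult' map_poly_linear h_uminus simp del: mult_pCons_left)

lemma map_poly_pcompose: "map_poly h (pcompose p q) = pcompose (map_poly h p) (map_poly h q)"
  by (induction p) (auto simp: pcompose_pCons map_poly_add' map_poly_mult' map_poly_pCons)

end

lemma coeff_hom_compose:
  fixes c :: "'a::idom fps"
  assumes "c $ 0 = 0"
  shows "coeff_hom (\<lambda>F. F oo c)"
  by standard (use assms in \<open>auto simp: fps_compose_add_distrib fps_compose_mult_distrib\<close>)

lemma coeff_hom_nth0: "coeff_hom (\<lambda>F :: 'a::comm_ring_1 fps. F $ 0)"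
  by standard auto

definition dilate :: "nat \<Rightarrow> complex fps \<Rightarrow> complex fps" where
  "dilate N F = F oo fps_X ^ N"

lemma coeff_hom_dilate: "N > 0 \<Longrightarrow> coeff_hom (dilate N)"
  using coeff_hom_compose[of "fps_X ^ N :: complex fps"] by (simp add: dilate_def[abs_def])

lemma dilate_1: "dilate 1 F = F" "dilate (Suc 0) F = F"
  by (simp_all add: dilate_def)

lemma dilate_dil: "N > 0 \<Longrightarrow> N' > 0 \<Longrightarrow> dilate N' (dilate N F) = dilate (N * N') F"
  unfolding dilate_def
  by (subst fps_compose_assoc [symmetric])
     (simp_all add: fps_compose_power [symmetric] power_mult [symmetric] mult.commute
        fps_X_fps_compose_startby0)

lemma dilate_const [simp]: "dilate N (fps_const c) = fps_const c"
  by (simp add: dilate_def)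

lemma dilate_0 [simp]: "dilate N 0 = 0"
  by (simp add: dilate_def)

lemma dilate_nth_0 [simp]: "dilate N F $ 0 = F $ 0"
  by (simp add: dilate_def)

lemma dilate_X_power: "N > 0 \<Longrightarrow> dilate N (fps_X ^ k) = fps_X ^ (N * k)"
  by (simp add: dilate_def fps_compose_power [symmetric] fps_X_fps_compose_startby0 power_mult)

lemma fps_X_power_dvd_iff: "(fps_X ^ n :: 'a::comm_ring_1 fps) dvd F \<longleftrightarrow> (\<forall>i<n. F $ i = 0)"
proof
  assume "fps_X ^ n dvd F"
  then show "\<forall>i<n. F $ i = 0" by (auto simp: fps_X_power_mult_nth elim!: dvdE)
next
  assume "\<forall>i<n. F $ i = 0"
  then have "F = fps_X ^ n * fps_shift n F"
    by (intro fps_ext) (simp add: fps_X_power_mult_nth)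
  then show "fps_X ^ n dvd F" by (metis dvd_triv_left)
qed

lemma poly_diff_dvd: "(x - y :: 'a::comm_ring_1) dvd poly p x - poly p y"
proof (induction p)
  case (pCons a p)
  have "poly (pCons a p) x - poly (pCons a p) y = (x - y) * poly p x + y * (poly p x - poly p y)"
    by (simp add: algebra_simps)
  then show ?case using pCons by simp
qed simp

text \<open>
  The order at \<open>0\<close> of the reduction of \<open>P\<close> modulo the variable of the power series. It counts the
  roots of \<open>P\<close> that vanish at the origin; an induction on it looks only at these roots and takes the
  place of splitting off the factor of \<open>P\<close> to which they belong.
\<close>

definition weierstrass_degree :: "nat \<Rightarrow> complex fps poly \<Rightarrow> bool" where
  "weierstrass_degree m P \<longleftrightarrow> (\<forall>i<m. coeff P i $ 0 = 0) \<and> coeff P m $ 0 \<noteq> 0"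

text \<open>
  Taylor's formula, with \<open>pochhammer 1 k\<close> in the role of \<open>k!\<close>.
\<close>

lemma coeff_pcompose_shift:
  "pochhammer 1 k * coeff (pcompose p [:c, 1:]) k = poly ((pderiv ^^ k) p) (c :: 'a::idom)"
proof -
  have "(pderiv ^^ k) (pcompose p [:c, 1:]) = pcompose ((pderiv ^^ k) p) [:c, 1:]"
    by (induction k) (simp_all add: pderiv_pcompose pderiv_pCons)
  then have "coeff ((pderiv ^^ k) (pcompose p [:c, 1:])) 0 = coeff (pcompose ((pderiv ^^ k) p) [:c, 1:]) 0"
    by simp
  then show ?thesis by (simp add: coeff_higher_pderiv pcompose_coeff_0)
qed

text \<open>
  One step of Newton's iteration: adding \<open>c X\<^sup>n\<^sup>+\<^sup>1\<close> to \<open>S\<close> changes the coefficient of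
  \<open>X\<^sup>n\<^sup>+\<^sup>1\<close> in \<open>P(S)\<close> by \<open>c\<close> times the constant term of the linear coefficient
  of \<open>P\<close>, which is nonzero.
\<close>

lemma weierstrass_degree_1_root_step:
  assumes "weierstrass_degree 1 P" "S $ 0 = 0" "fps_X ^ Suc n dvd poly P S"
  shows "\<exists>c. fps_X ^ Suc (Suc n) dvd poly P (S + fps_const c * fps_X ^ Suc n)"
proof -
  interpret z: coeff_hom "\<lambda>F :: complex fps. F $ 0" by (rule coeff_hom_nth0)
  define Q where "Q = pcompose P [:S, 1:]"
  obtain b0 b1 Q' where Q: "Q = pCons b0 (pCons b1 Q')" by (metis pCons_cases)
  have "map_poly (\<lambda>F. F $ 0) Q = map_poly (\<lambda>F. F $ 0) P"
    unfolding Q_def z.map_poly_pcompose using assms(2) by (simp add: map_poly_pCons)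
  then have "coeff Q 1 $ 0 = coeff P 1 $ 0" by (metis coeff_map_poly fps_zero_nth)
  then have b1: "b1 $ 0 \<noteq> 0" using assms(1) by (simp add: Q weierstrass_degree_def)
  have "b0 = poly P S"
    using arg_cong[OF Q[unfolded Q_def], of "\<lambda>p. poly p 0"] by (simp add: poly_pcompose)
  with assms(3) have b0: "b0 $ i = 0" if "i \<le> n" for i
    using that unfolding fps_X_power_dvd_iff by auto
  define c where "c = - b0 $ Suc n / b1 $ 0"
  define h where "h = fps_const c * fps_X ^ Suc n"
  have eq: "poly P (S + h) = b0 + h * b1 + fps_X ^ Suc (Suc n) * (fps_const (c * c) * fps_X ^ n * poly Q' h)"
  proof -
    have "poly P (S + h) = poly Q h" by (simp add: Q_def poly_pcompose)
    also have "\<dots> = b0 + h * b1 + h * h * poly Q' h" by (simp add: Q algebra_simps)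
    also have "h * h = fps_X ^ Suc (Suc n) * (fps_const (c * c) * fps_X ^ n)"
      by (simp add: h_def fps_const_mult[symmetric] algebra_simps power_add[symmetric] del: fps_const_mult)
    finally show ?thesis by (simp add: mult.assoc)
  qed
  have "fps_X ^ Suc (Suc n) dvd b0 + h * b1"
    unfolding fps_X_power_dvd_iff
  proof (intro allI impI)
    fix i assume i: "i < Suc (Suc n)"
    have "(h * b1) $ i = c * (if i < Suc n then 0 else b1 $ (i - Suc n))"
      unfolding h_def mult.assoc by (simp only: fps_mult_left_const_nth fps_X_power_mult_nth)
    then show "(b0 + h * b1) $ i = 0"
      using i b0[of i] b1 by (cases "i = Suc n") (auto simp: c_def)
  qed
  then have "fps_X ^ Suc (Suc n) dvd poly P (S + h)" unfolding eq by (rule dvd_add) (rule dvd_triv_left)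
  then show ?thesis unfolding h_def by blast
qed

text \<open>
  Hensel's lemma for a simple root: the successive approximations stabilize coefficientwise.
\<close>

lemma weierstrass_degree_1_root:
  assumes "weierstrass_degree 1 P"
  shows "\<exists>s. s $ 0 = 0 \<and> poly P s = 0"
proof -
  have "\<exists>S. \<forall>n. (S n $ 0 = 0 \<and> fps_X ^ Suc n dvd poly P (S n)) \<and>
            (\<exists>c. S (Suc n) = S n + fps_const c * fps_X ^ Suc n)"
  proof (rule dependent_nat_choice)
    have "poly P 0 $ 0 = 0" using assms by (simp add: weierstrass_degree_def poly_0_coeff_0)
    then have "fps_X ^ Suc 0 dvd poly P 0" unfolding fps_X_power_dvd_iff by simp
    then show "\<exists>S. S $ 0 = 0 \<and> fps_X ^ Suc 0 dvd poly P S"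
      by (intro exI[of _ 0] conjI) simp_all
  next
    fix S n assume "S $ 0 = 0 \<and> fps_X ^ Suc n dvd poly P S"
    with weierstrass_degree_1_root_step[OF assms, of S n] obtain c
      where "fps_X ^ Suc (Suc n) dvd poly P (S + fps_const c * fps_X ^ Suc n)" by blast
    then show "\<exists>S'. (S' $ 0 = 0 \<and> fps_X ^ Suc (Suc n) dvd poly P S') \<and>
       (\<exists>c. S' = S + fps_const c * fps_X ^ Suc n)"
      using \<open>S $ 0 = 0 \<and> _\<close> by (intro exI[of _ "S + fps_const c * fps_X ^ Suc n"]) auto
  qed
  then obtain S where S: "\<And>n. S n $ 0 = 0" "\<And>n. fps_X ^ Suc n dvd poly P (S n)"
    "\<And>n. \<exists>c. S (Suc n) = S n + fps_const c * fps_X ^ Suc n" by blast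
  have stepeq: "S (Suc n) $ i = S n $ i" if "i \<le> n" for n i
  proof -
    from S(3)[of n] obtain c where "S (Suc n) = S n + fps_const c * fps_X ^ Suc n" ..
    with that show ?thesis by (simp only: fps_add_nth fps_mult_left_const_nth fps_X_power_nth) simp
  qed
  have stable: "S n $ i = S i $ i" if "i \<le> n" for n i
    using that by (induction n rule: dec_induct) (auto simp: stepeq)
  define s where "s = Abs_fps (\<lambda>i. S i $ i)"
  have "fps_X ^ Suc n dvd poly P s" for n
  proof -
    have "fps_X ^ Suc n dvd s - S n"
      unfolding fps_X_power_dvd_iff
    proof (intro allI impI)
      fix i assume "i < Suc n"
      then have "S n $ i = S i $ i" by (intro stable) simp
      then show "(s - S n) $ i = 0" by (simp add: s_def)
    qed
    then have "fps_X ^ Suc n dvd poly P s - poly P (S n)"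
      using poly_diff_dvd dvd_trans by blast
    from dvd_add[OF this S(2)[of n]] show ?thesis by simp
  qed
  then have "poly P s $ n = 0" for n using fps_X_power_dvd_iff by blast
  then have "poly P s = 0" by (simp add: fps_eq_iff)
  then show ?thesis using S(1) by (intro exI[of _ s]) (auto simp: s_def)
qed

lemma dilate_nth_mult: "N > 0 \<Longrightarrow> dilate N F $ (N * k) = F $ k"
proof -
  assume N: "N > 0"
  have "dilate N F $ (N * k) = (\<Sum>i=0..N*k. F $ i * (if N * k = N * i then 1 else 0))"
    by (simp add: dilate_def fps_compose_nth power_mult [symmetric])
  also have "\<dots> = (\<Sum>i\<in>{k}. F $ i)"
    using N by (intro sum.mono_neutral_cong_right) (auto split: if_splits)
  finally show ?thesis by simp
qed

lemma dilate_X_power_dvd: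
  assumes "N > 0" "fps_X ^ k dvd F"
  shows "fps_X ^ (N * k) dvd dilate N F"
proof -
  interpret d: coeff_hom "dilate N" by (rule coeff_hom_dilate) fact
  from assms(2) obtain G where "F = fps_X ^ k * G" ..
  then show ?thesis using assms(1) by (simp add: d.h_mult dilate_X_power)
qed

text \<open>
  Moving a root of the reduction of \<open>P\<close> to the origin gives a positive Weierstrass degree, to
  which \<open>weierstrass_degree_root\<close> below applies.
\<close>

lemma shift_to_root:
  fixes P :: "complex fps poly"
  defines "P0 \<equiv> map_poly (\<lambda>F. F $ 0) P"
  assumes "degree P0 \<ge> 1"
  obtains c m where "m \<ge> 1" "weierstrass_degree m (pcompose P [:fps_const c, 1:])"
    "\<And>i. i < m \<Longrightarrow> coeff (pcompose P0 [:c, 1:]) i = 0"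
proof -
  interpret z: coeff_hom "\<lambda>F :: complex fps. F $ 0" by (rule coeff_hom_nth0)
  obtain c where c: "poly P0 c = 0"
    using alg_closed_imp_poly_has_root[of P0] assms(2) by auto
  define T where "T = pcompose P0 [:c, 1:]"
  define P' where "P' = pcompose P [:fps_const c, 1:]"
  have "map_poly (\<lambda>F. F $ 0) P' = T"
    unfolding P'_def T_def z.map_poly_pcompose P0_def by (simp add: map_poly_pCons)
  then have P': "coeff P' i $ 0 = coeff T i" for i by (metis coeff_map_poly fps_zero_nth)
  have "degree T = degree P0" by (simp add: T_def degree_pcompose)
  then have Tm: "coeff T (degree P0) \<noteq> 0"
    using assms(2) by (metis degree_0 leading_coeff_0_iff not_one_le_zero)
  define m where "m = (LEAST i. coeff T i \<noteq> 0)"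
  have m: "coeff T m \<noteq> 0" "\<And>i. i < m \<Longrightarrow> coeff T i = 0"
    unfolding m_def using LeastI[of "\<lambda>i. coeff T i \<noteq> 0", OF Tm] not_less_Least[of _ "\<lambda>i. coeff T i \<noteq> 0"]
    by blast+
  have "coeff T 0 = 0" using c by (simp add: T_def pcompose_coeff_0)
  then have "m \<ge> 1" using m(1) by (cases m) auto
  moreover have "weierstrass_degree m P'" using m by (simp add: weierstrass_degree_def P')
  ultimately show ?thesis using m(2) that unfolding P'_def T_def by blast
qed

text \<open>
  Newton's polygon method, by induction on the Weierstrass degree \<open>m\<close>. For \<open>m \<ge> 2\<close>, first
  kill the coefficient of \<open>x\<^sup>m\<^sup>-\<^sup>1\<close> by shifting \<open>x\<close> by a root of the \<open>(m - 1)\<close>-st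
  derivative, which has Weierstrass degree 1. If \<open>0\<close> is not a root yet, let \<open>a / b\<close> be the
  least slope of the Newton polygon, substitute \<open>X\<^sup>b\<close> for \<open>X\<close> and \<open>X\<^sup>a x\<close> for \<open>x\<close>, and
  divide by \<open>X\<^sup>a\<^sup>m\<close>. The reduction \<open>R0\<close> of the result has degree \<open>m\<close>, no term of degree
  \<open>m - 1\<close> and some lower term, so it has no root of multiplicity \<open>m\<close>, and moving any of its
  roots to the origin lowers the Weierstrass degree.
\<close>

lemma weierstrass_degree_root:
  "weierstrass_degree m P \<Longrightarrow> m \<ge> 1 \<Longrightarrow> \<exists>N>0. \<exists>s. s $ 0 = 0 \<and> poly (map_poly (dilate N) P) s = 0"
proof (induction m arbitrary: P rule: less_induct)
  case (less m P)
  interpret z: coeff_hom "\<lambda>F :: complex fps. F $ 0" by (rule coeff_hom_nth0)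
  define D where "D = (pderiv ^^ (m - 1)) P"
  have [simp]: "(pochhammer x k :: complex fps) $ 0 = pochhammer (x $ 0) k" for x k
    by (induction k) (auto simp: pochhammer_Suc)
  have poch: "pochhammer (of_nat (Suc j) :: complex) k \<noteq> 0" for j k
    by (simp add: pochhammer_eq_0_iff del: of_nat_Suc) (metis of_nat_eq_0_iff of_nat_add add_eq_0_iff_both_eq_0 Suc_neq_Zero eq_neg_iff_add_eq_0)
  have poch1: "pochhammer 1 k \<noteq> (0 :: complex)" for k using poch[of 0 k] by simp
  have poch1': "pochhammer 1 k \<noteq> (0 :: complex fps)" for k
    using poch1[of k] by (metis \<open>\<And>x k. pochhammer x k $ 0 = pochhammer (x $ 0) k\<close> fps_one_nth fps_zero_nth)
  have "weierstrass_degree 1 D"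
    using less.prems poch[of 1 "m - 1"] unfolding weierstrass_degree_def D_def coeff_higher_pderiv by (auto simp: algebra_simps)
  from weierstrass_degree_1_root[OF this] obtain s where s: "s $ 0 = 0" "poly D s = 0" by blast
  define Q where "Q = pcompose P [:s, 1:]"
  have "pochhammer 1 (m - 1) * coeff Q (m - 1) = 0"
    unfolding Q_def coeff_pcompose_shift using s(2) D_def by simp
  then have Qm1: "coeff Q (m - 1) = 0" using poch1' by simp
  have "map_poly (\<lambda>F. F $ 0) Q = map_poly (\<lambda>F. F $ 0) P"
    unfolding Q_def z.map_poly_pcompose using s by (simp add: map_poly_pCons)
  then have QP: "coeff Q i $ 0 = coeff P i $ 0" for i by (metis coeff_map_poly fps_zero_nth)
  have wQ: "\<And>i. i < m \<Longrightarrow> coeff Q i $ 0 = 0" "coeff Q m $ 0 \<noteq> 0"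
    using less.prems by (auto simp: QP weierstrass_degree_def)
  show ?case
  proof (cases "coeff Q 0 = 0")
    case True
    then have "poly P s = 0" by (simp add: Q_def pcompose_coeff_0)
    moreover have "dilate 1 = id" by (auto simp: dilate_1)
    ultimately have "poly (map_poly (dilate 1) P) s = 0" by simp
    then show ?thesis using s by (intro exI[of _ "1::nat"]) auto
  next
    case False
    \<comment> \<open>The points of the Newton polygon to the left of m, and the one of least slope.\<close>
    define J where "J = {j. j < m \<and> coeff Q j \<noteq> 0}"
    define ord where "ord j = subdegree (coeff Q j)" for j
    have J: "finite J" "J \<noteq> {}" using False less.prems by (auto simp: J_def intro!: exI[of _ 0])
    define slope where "slope j = real (ord j) / real (m - j)" for j
    obtain j0 where j0: "j0 \<in> J" "\<And>j. j \<in> J \<Longrightarrow> slope j0 \<le> slope j"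
      using ex_is_arg_min_if_finite[OF J, of slope] by (auto simp: is_arg_min_def not_less)
    define a b where "a = ord j0" and "b = m - j0"
    have b: "b > 0" using j0(1) by (auto simp: b_def J_def)
    have a: "a > 0" unfolding a_def ord_def using j0(1) wQ(1)[of j0] by (auto simp: J_def subdegree_eq_0_iff intro!: Nat.gr0I)
    have slope: "a * (m - j) \<le> b * ord j" if "j \<in> J" for j
    proof -
      have "m - j > 0" using that by (auto simp: J_def)
      with j0(2)[OF that] b have "real a * real (m - j) \<le> real b * real (ord j)"
        by (simp add: slope_def a_def b_def field_simps del: of_nat_diff)
      then show ?thesis by (metis of_nat_le_iff of_nat_mult)
    qed
    interpret db: coeff_hom "dilate b" by (rule coeff_hom_dilate) fact
    define Q1 where "Q1 = map_poly (dilate b) Q"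
    have cQ1: "coeff Q1 j = dilate b (coeff Q j)" for j by (simp add: Q1_def coeff_map_poly)
    \<comment> \<open>Minimality of the slope makes the rescaled polynomial divisible by the stated power.\<close>
    have dvdQ1: "fps_X ^ (a * (m - j)) dvd coeff Q1 j" for j
    proof (cases "j \<in> J")
      case True
      have "fps_X ^ (a * (m - j)) dvd (fps_X ^ (b * ord j) :: complex fps)"
        using slope[OF True] by (rule le_imp_power_dvd)
      also have "\<dots> dvd dilate b (coeff Q j)"
        by (rule dilate_X_power_dvd[OF b]) (auto simp: fps_X_power_dvd_iff ord_def)
      finally show ?thesis by (simp add: cQ1)
    next
      case False
      then consider "coeff Q j = 0" | "m - j = 0" by (auto simp: J_def)
      then show ?thesis by cases (auto simp: cQ1)
    qed
    have dvd2: "fps_X ^ (a * m) dvd coeff Q1 j * fps_X ^ (a * j)" for j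
    proof -
      have "fps_X ^ (a * m) dvd (fps_X ^ (a * (m - j)) * fps_X ^ (a * j) :: complex fps)"
        unfolding power_add [symmetric] by (rule le_imp_power_dvd) (simp add: diff_mult_distrib2)
      also have "\<dots> dvd coeff Q1 j * fps_X ^ (a * j)"
        by (rule mult_dvd_mono[OF dvdQ1]) simp
      finally show ?thesis .
    qed
    define R where "R = map_poly (fps_shift (a * m)) (pcompose Q1 [:0, fps_X ^ a:])"
    have cR: "coeff R j = fps_shift (a * m) (coeff Q1 j * fps_X ^ (a * j))" for j
      by (simp add: R_def coeff_map_poly coeff_pcompose_linear power_mult mult.commute)
    have R: "smult (fps_X ^ (a * m)) R = pcompose Q1 [:0, fps_X ^ a:]"
    proof (rule poly_eqI)
      fix j
      have "fps_X ^ (a * m) * coeff R j = coeff Q1 j * fps_X ^ (a * j)"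
        unfolding cR using dvd2[of j] unfolding fps_X_power_dvd_iff
        by (intro fps_ext) (auto simp only: fps_X_power_mult_nth fps_shift_nth split: if_splits, auto)
      then show "coeff (smult (fps_X ^ (a * m)) R) j = coeff (pcompose Q1 [:0, fps_X ^ a:]) j"
        by (simp add: coeff_pcompose_linear power_mult mult.commute)
    qed
    have R_lt: "coeff R j $ 0 = coeff Q1 j $ (a * (m - j))" if "j \<le> m" for j
      unfolding cR using that by (auto simp: fps_X_power_mult_right_nth diff_mult_distrib2)
    have R_gt: "coeff R j $ 0 = 0" if "j > m" for j
      unfolding cR using that a by (auto simp: fps_X_power_mult_right_nth)
    have R_m: "coeff R m $ 0 \<noteq> 0" using wQ by (simp add: R_lt cQ1)
    have R_m1: "coeff R (m - 1) $ 0 = 0" by (simp add: R_lt cQ1 Qm1[unfolded One_nat_def])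
    have R_j0: "coeff R j0 $ 0 \<noteq> 0"
    proof -
      have "coeff R j0 $ 0 = dilate b (coeff Q j0) $ (b * a)"
        using j0(1) by (subst R_lt) (auto simp: J_def cQ1 b_def mult.commute)
      also have "\<dots> = coeff Q j0 $ a" by (rule dilate_nth_mult[OF b])
      finally show ?thesis using j0(1) by (simp add: a_def ord_def J_def)
    qed
    define R0 where "R0 = map_poly (\<lambda>F. F $ 0) R"
    have cR0: "coeff R0 j = coeff R j $ 0" for j by (simp add: R0_def coeff_map_poly)
    have dR0: "degree R0 = m"
      using R_m R_gt by (intro antisym degree_le le_degree) (auto simp: cR0)
    obtain c m' where m': "m' \<ge> 1" "weierstrass_degree m' (pcompose R [:fps_const c, 1:])"
      "\<And>i. i < m' \<Longrightarrow> coeff (pcompose R0 [:c, 1:]) i = 0"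
      using shift_to_root[of R] dR0 less.prems(2) unfolding R0_def by metis
    define R' where "R' = pcompose R [:fps_const c, 1:]"
    define T where "T = pcompose R0 [:c, 1:]"
    \<comment> \<open>Otherwise the sum of the m roots of R0, which is zero, would be m c,
      so that c = 0 and R0 would have no term of degree below m.\<close>
    have "m' < m"
    proof (rule ccontr)
      assume "\<not> m' < m"
      then have T0: "coeff T i = 0" if "i < m" for i using m'(3) that by (auto simp: T_def)
      have "(pderiv ^^ (m - 1)) R0 = [:0, pochhammer 2 (m - 1) * coeff R0 m:]"
      proof (rule poly_eqI)
        fix i
        show "coeff ((pderiv ^^ (m - 1)) R0) i = coeff [:0, pochhammer 2 (m - 1) * coeff R0 m:] i"
          using R_m1 R_gt less.prems unfolding coeff_higher_pderiv cR0
          by (cases i; cases "i - 1") (auto simp: add.commute)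
      qed
      then have "pochhammer 1 (m - 1) * coeff T (m - 1) = c * (pochhammer 2 (m - 1) * coeff R0 m)"
        unfolding T_def coeff_pcompose_shift by simp
      then have "c * (pochhammer 2 (m - 1) * coeff R0 m) = 0" using T0 less.prems by simp
      then have "c = 0" using poch[of 1 "m - 1"] R_m by (auto simp: cR0)
      then have "T = R0" by (simp add: T_def)
      then show False using T0[of j0] R_j0 j0(1) by (auto simp: cR0 J_def)
    qed
    from less.IH[OF \<open>m' < m\<close> m'(2)[folded R'_def] m'(1)] obtain N y where
      N: "N > 0" and y: "y $ 0 = 0" "poly (map_poly (dilate N) R') y = 0" by blast
    interpret dN: coeff_hom "dilate N" by (rule coeff_hom_dilate) fact
    interpret dbN: coeff_hom "dilate (b * N)" by (rule coeff_hom_dilate) (use b N in auto)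
    \<comment> \<open>Undoing the substitutions: the root of R gives the root w of Q1.\<close>
    define w where "w = fps_X ^ (N * a) * (fps_const c + y)"
    have "poly (map_poly (dilate N) R) (fps_const c + y) = 0"
      using y(2) unfolding R'_def dN.map_poly_pcompose by (simp add: map_poly_pCons poly_pcompose)
    then have "poly (map_poly (dilate N) (smult (fps_X ^ (a * m)) R)) (fps_const c + y) = 0"
      using dN.map_poly_mult'[of "[:fps_X ^ (a * m):]" R] by (simp add: map_poly_pCons)
    then have "poly (map_poly (dilate N) Q1) w = 0"
      unfolding R dN.map_poly_pcompose
      by (simp add: map_poly_pCons poly_pcompose dilate_X_power N w_def mult.commute)
    moreover have "map_poly (dilate N) Q1 = map_poly (dilate (b * N)) Q"
      unfolding Q1_def using b N by (subst map_poly_map_poly) (auto simp: o_def dilate_dil)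
    ultimately have "poly (map_poly (dilate (b * N)) P) (dilate (b * N) s + w) = 0"
      unfolding Q_def dbN.map_poly_pcompose by (simp add: map_poly_pCons poly_pcompose)
    moreover have "(dilate (b * N) s + w) $ 0 = 0"
      using s N a by (auto simp: w_def fps_X_power_mult_nth)
    moreover have "b * N > 0" using b N by simp
    ultimately show ?thesis by blast
  qed
qed

text \<open>
  Split off one root, which exists by \<open>weierstrass_degree_root\<close> after moving a root of the
  reduction to the origin, and continue with the quotient; the exponents multiply.
\<close>

lemma puiseux:
  fixes P :: "complex fps poly"
  assumes "degree P = n" "lead_coeff P = 1"
  shows "\<exists>N>0. \<exists>L. map_poly (dilate N) P = (\<Prod>i<n. [:- L i, 1:])"
  using assms
proof (induction n arbitrary: P)
  case 0
  then have "P = 1" by (metis degree_eq_zeroE lead_coeff_pCons(2) one_pCons)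
  then show ?case by (intro exI[of _ "1::nat"]) (auto simp: dilate_1)
next
  case (Suc n P)
  define P0 where "P0 = map_poly (\<lambda>F. F $ 0) P"
  have cP0: "coeff P0 i = coeff P i $ 0" for i by (simp add: P0_def coeff_map_poly)
  have "degree P0 = Suc n"
    using Suc.prems by (intro antisym degree_le le_degree) (auto simp: cP0 coeff_eq_0)
  then obtain c m where "m \<ge> 1" "weierstrass_degree m (pcompose P [:fps_const c, 1:])"
    using shift_to_root[of P] unfolding P0_def by (metis le_add1 plus_1_eq_Suc)
  then obtain N s where N: "N > 0" and s: "poly (map_poly (dilate N) (pcompose P [:fps_const c, 1:])) s = 0"
    using weierstrass_degree_root by blast
  interpret dN: coeff_hom "dilate N" by (rule coeff_hom_dilate) fact
  define r where "r = fps_const c + s"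
  define PN where "PN = map_poly (dilate N) P"
  have "poly PN r = 0"
    using s unfolding dN.map_poly_pcompose PN_def r_def
    by (simp add: map_poly_pCons poly_pcompose)
  then have "[:- r, 1:] dvd PN" by (simp add: poly_eq_0_iff_dvd)
  then obtain Q where Q: "PN = [:- r, 1:] * Q" ..
  have cPN: "coeff PN i = dilate N (coeff P i)" for i by (simp add: PN_def coeff_map_poly)
  have dPN: "degree PN = Suc n"
    using Suc.prems by (intro antisym degree_le le_degree) (auto simp: cPN coeff_eq_0)
  then have lPN: "lead_coeff PN = 1" using Suc.prems by (simp add: cPN)
  have "Q \<noteq> 0" using Q dPN by auto
  then have "degree Q = n" using dPN unfolding Q by (subst (asm) degree_mult_eq) auto
  moreover have "lead_coeff Q = 1" using lPN unfolding Q lead_coeff_mult by simp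
  ultimately obtain N' L where N': "N' > 0" and L: "map_poly (dilate N') Q = (\<Prod>i<n. [:- L i, 1:])"
    using Suc.IH by blast
  interpret dN': coeff_hom "dilate N'" by (rule coeff_hom_dilate) fact
  have "map_poly (dilate (N * N')) P = map_poly (dilate N') PN"
    unfolding PN_def using N N' by (subst map_poly_map_poly) (auto simp: o_def dilate_dil)
  also have "\<dots> = [:- dilate N' r, 1:] * (\<Prod>i<n. [:- L i, 1:])"
    unfolding Q dN'.map_poly_mult' L by (simp add: map_poly_pCons dN'.h_uminus)
  also have "\<dots> = (\<Prod>i<Suc n. [:- (L(n := dilate N' r)) i, 1:])"
    by (simp del: mult_pCons_left mult_pCons_right add: mult.commute)
  finally have "map_poly (dilate (N * N')) P = (\<Prod>i<Suc n. [:- (L(n := dilate N' r)) i, 1:])" .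
  moreover have "N * N' > 0" using N N' by simp
  ultimately show ?case by blast
qed

lemma puiseux_multiple:
  assumes "map_poly (dilate N) P = (\<Prod>i\<in>S. [:- L i, 1:])" "N > 0" "k > 0"
  shows "map_poly (dilate (N * k)) P = (\<Prod>i\<in>S. [:- dilate k (L i), 1:])"
proof -
  interpret dk: coeff_hom "dilate k" by (rule coeff_hom_dilate) fact
  have "map_poly (dilate (N * k)) P = map_poly (dilate k) (map_poly (dilate N) P)"
    using assms by (subst map_poly_map_poly) (auto simp: o_def dilate_dil)
  then show ?thesis by (simp add: assms dk.map_poly_prod_linear)
qed

section \<open>Smooth functions of one real variable\<close>

lemma has_vector_derivative_complex_iff:
  fixes f :: "real \<Rightarrow> complex"
  shows "(f has_vector_derivative d) (at t) \<longleftrightarrow>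
         ((\<lambda>s. (f s - f t) / of_real (s - t)) \<longlongrightarrow> d) (at t)"
proof -
  have "(f has_vector_derivative d) (at t) \<longleftrightarrow>
        ((\<lambda>s. norm (f s - f t - (s - t) *\<^sub>R d) / norm (s - t)) \<longlongrightarrow> 0) (at t)"
    unfolding has_vector_derivative_def has_derivative_iff_norm
    by (simp add: bounded_linear_scaleR_left)
  also have "\<dots> \<longleftrightarrow> ((\<lambda>s. norm ((f s - f t) / of_real (s - t) - d)) \<longlongrightarrow> 0) (at t)"
  proof (rule filterlim_cong[OF refl refl])
    have "norm (f s - f t - (s - t) *\<^sub>R d) / norm (s - t) = norm ((f s - f t) / of_real (s - t) - d)"
      if "s \<noteq> t" for s
    proof -
      have "(f s - f t) / of_real (s - t) - d = (f s - f t - (s - t) *\<^sub>R d) / of_real (s - t)"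
        using that by (simp add: scaleR_conv_of_real field_simps)
      then show ?thesis by (simp only: norm_divide norm_of_real real_norm_def)
    qed
    then show "\<forall>\<^sub>F s in at t. norm (f s - f t - (s - t) *\<^sub>R d) / norm (s - t) =
                 norm ((f s - f t) / of_real (s - t) - d)"
      by (auto simp: eventually_at_filter)
  qed
  also have "\<dots> \<longleftrightarrow> ((\<lambda>s. (f s - f t) / of_real (s - t)) \<longlongrightarrow> d) (at t)"
    by (simp only: tendsto_norm_zero_iff LIM_zero_iff)
  finally show ?thesis .
qed

text \<open>
  The recursion peels off the first derivative, so that closure properties are proved by induction
  on \<open>k\<close>: the derivative of a product, inverse or composite is built from functions that are
  already known to be of class \<open>C\<^sup>k\<close>.
\<close>

primrec Ck :: "nat \<Rightarrow> real set \<Rightarrow> (real \<Rightarrow> complex) \<Rightarrow> bool" where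
  "Ck 0 I f \<longleftrightarrow> True"
| "Ck (Suc k) I f \<longleftrightarrow> (\<exists>f'. (\<forall>t\<in>I. (f has_vector_derivative f' t) (at t)) \<and> Ck k I f')"

lemma Ck_SucI:
  "Ck k I f' \<Longrightarrow> (\<And>t. t \<in> I \<Longrightarrow> (f has_vector_derivative f' t) (at t)) \<Longrightarrow> Ck (Suc k) I f"
  by (simp only: Ck.simps) blast

lemma Ck_SucD: "Ck (Suc k) I f \<Longrightarrow> Ck k I f"
proof (induction k arbitrary: f)
  case (Suc k)
  then show ?case by (metis Ck.simps(2))
qed simp

lemma Ck_cong:
  assumes "open I" "\<And>t. t \<in> I \<Longrightarrow> f t = g t" "Ck k I f"
  shows "Ck k I g"
proof (cases k)
  case (Suc m)
  with assms(3) obtain f' where f': "\<forall>t\<in>I. (f has_vector_derivative f' t) (at t)" "Ck m I f'" by auto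
  have "\<forall>t\<in>I. (g has_vector_derivative f' t) (at t)"
    using f'(1) assms by (auto intro: has_vector_derivative_transform_within_open[of f _ _ I g])
  then show ?thesis using f'(2) Suc by auto
qed simp

lemma Ck_subset: "J \<subseteq> I \<Longrightarrow> Ck k I f \<Longrightarrow> Ck k J f"
proof (induction k arbitrary: f)
  case (Suc k)
  then show ?case by (metis Ck.simps(2) subsetD)
qed simp

lemma Ck_const: "Ck k I (\<lambda>t. c)"
proof (induction k arbitrary: c)
  case (Suc k)
  then show ?case by (auto intro!: exI[of _ "\<lambda>t. 0"])
qed simp

lemma Ck_of_real: "Ck k I of_real"
proof (cases k)
  case (Suc m)
  have "(of_real has_vector_derivative 1) (at t)" for t
    unfolding has_vector_derivative_def by (auto intro!: derivative_eq_intros simp: scaleR_conv_of_real)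
  then show ?thesis using Suc Ck_const[of m I 1] by (auto intro!: exI[of _ "\<lambda>t. 1"])
qed simp

lemma Ck_add: "Ck k I f \<Longrightarrow> Ck k I g \<Longrightarrow> Ck k I (\<lambda>t. f t + g t)"
proof (induction k arbitrary: f g)
  case (Suc k)
  then obtain f' g' where "\<forall>t\<in>I. (f has_vector_derivative f' t) (at t)" "Ck k I f'"
    "\<forall>t\<in>I. (g has_vector_derivative g' t) (at t)" "Ck k I g'" by auto
  then show ?case using Suc.IH[of f' g']
    by (auto intro!: exI[of _ "\<lambda>t. f' t + g' t"] has_vector_derivative_add)
qed simp

lemma Ck_mult: "Ck k I f \<Longrightarrow> Ck k I g \<Longrightarrow> Ck k I (\<lambda>t. f t * g t)"
proof (induction k arbitrary: f g)
  case (Suc k)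
  then obtain f' g' where d: "\<forall>t\<in>I. (f has_vector_derivative f' t) (at t)" "Ck k I f'"
    "\<forall>t\<in>I. (g has_vector_derivative g' t) (at t)" "Ck k I g'" by auto
  have "Ck k I (\<lambda>t. f t * g' t + f' t * g t)"
    by (intro Ck_add Suc.IH d) (use Suc.prems Ck_SucD in auto)
  then show ?case using d
    by (auto intro!: exI[of _ "\<lambda>t. f t * g' t + f' t * g t"] has_vector_derivative_mult)
qed simp

lemma Ck_uminus: "Ck k I f \<Longrightarrow> Ck k I (\<lambda>t. - f t)"
  using Ck_mult[OF Ck_const[of k I "-1"]] by simp

lemma Ck_diff: "Ck k I f \<Longrightarrow> Ck k I g \<Longrightarrow> Ck k I (\<lambda>t. f t - g t)"
  using Ck_add[OF _ Ck_uminus] by force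

lemma Ck_sum: "(\<And>a. a \<in> A \<Longrightarrow> Ck k I (f a)) \<Longrightarrow> Ck k I (\<lambda>t. \<Sum>a\<in>A. f a t)"
  by (induction A rule: infinite_finite_induct) (auto simp: Ck_const intro: Ck_add)

lemma Ck_power: "Ck k I f \<Longrightarrow> Ck k I (\<lambda>t. f t ^ n)"
  by (induction n) (auto simp: Ck_const intro: Ck_mult)

lemma Ck_inverse: "(\<And>t. t \<in> I \<Longrightarrow> f t \<noteq> 0) \<Longrightarrow> Ck k I f \<Longrightarrow> Ck k I (\<lambda>t. inverse (f t))"
proof (induction k)
  case (Suc k)
  then obtain f' where d: "\<forall>t\<in>I. (f has_vector_derivative f' t) (at t)" "Ck k I f'" by auto
  have "Ck k I (\<lambda>t. - (f' t * (inverse (f t) * inverse (f t))))"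
    by (intro Ck_uminus Ck_mult Suc.IH d) (use Suc.prems Ck_SucD in auto)
  moreover have "((\<lambda>t. inverse (f t)) has_vector_derivative - (f' t * (inverse (f t) * inverse (f t)))) (at t)"
    if "t \<in> I" for t
  proof -
    have "((inverse \<circ> f) has_vector_derivative f' t * (- (inverse (f t) * inverse (f t)))) (at t)"
      using d(1) that Suc.prems(1)[OF that]
      by (intro field_vector_diff_chain_at) (auto intro!: derivative_eq_intros simp: power2_eq_square divide_inverse)
    then show ?thesis by (simp add: o_def)
  qed
  ultimately show ?case by (rule Ck_SucI)
qed simp

lemma Ck_compose:
  assumes "\<And>t. t \<in> I \<Longrightarrow> \<phi> t \<in> J" "\<And>t. t \<in> I \<Longrightarrow> (\<phi> has_vector_derivative \<phi>' t) (at t)"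
    "\<And>k. Ck k I (\<lambda>t. of_real (\<phi>' t))"
  shows "Ck k J f \<Longrightarrow> Ck k I (\<lambda>t. f (\<phi> t))"
proof (induction k arbitrary: f)
  case (Suc k)
  then obtain f' where d: "\<forall>t\<in>J. (f has_vector_derivative f' t) (at t)" "Ck k J f'" by auto
  have "Ck k I (\<lambda>t. of_real (\<phi>' t) * f' (\<phi> t))"
    by (intro Ck_mult assms(3) Suc.IH d)
  moreover have "((\<lambda>t. f (\<phi> t)) has_vector_derivative of_real (\<phi>' t) * f' (\<phi> t)) (at t)" if "t \<in> I" for t
    using vector_diff_chain_at[OF assms(2)[OF that], of f] d(1) assms(1)[OF that]
    by (auto simp: o_def scaleR_conv_of_real)
  ultimately show ?case by (rule Ck_SucI)
qed simp

definition smooth :: "real set \<Rightarrow> (real \<Rightarrow> complex) \<Rightarrow> bool" where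
  "smooth I f \<longleftrightarrow> (\<forall>k. Ck k I f)"

abbreviation vderiv :: "(real \<Rightarrow> complex) \<Rightarrow> real \<Rightarrow> complex" where
  "vderiv f \<equiv> \<lambda>s. vector_derivative f (at s)"

lemma smooth_vderiv:
  assumes "open I" "smooth I f"
  shows "smooth I (vderiv f)" and "\<And>t. t \<in> I \<Longrightarrow> (f has_vector_derivative vderiv f t) (at t)"
proof -
  have d: "(f has_vector_derivative vderiv f t) (at t)" if "t \<in> I" for t
  proof -
    have "Ck 1 I f" using assms(2) by (simp add: smooth_def)
    with that show ?thesis by (auto simp: vector_derivative_at)
  qed
  then show "\<And>t. t \<in> I \<Longrightarrow> (f has_vector_derivative vderiv f t) (at t)" .
  show "smooth I (vderiv f)" unfolding smooth_def
  proof
    fix k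
    have "Ck (Suc k) I f" using assms(2) by (simp add: smooth_def)
    then obtain f' where f': "\<forall>t\<in>I. (f has_vector_derivative f' t) (at t)" "Ck k I f'" by auto
    have eq: "f' t = vderiv f t" if "t \<in> I" for t
      using vector_derivative_at[of f "f' t" t] f'(1) that by simp
    show "Ck k I (vderiv f)" by (rule Ck_cong[OF assms(1) _ f'(2)]) (rule eq)
  qed
qed

lemma smooth_iff_C_infinity_on:
  assumes "open I"
  shows "smooth I f \<longleftrightarrow> C_infinity_on I f"
proof
  assume s: "smooth I f"
  have "smooth I ((vderiv ^^ k) f)" for k
    by (induction k) (use s smooth_vderiv[OF assms] in auto)
  then show "C_infinity_on I f" unfolding C_infinity_on_def
    using smooth_vderiv(2)[OF assms] differentiableI_vector by blast
next
  have "C_infinity_on I f \<Longrightarrow> Ck k I f" for k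
  proof (induction k arbitrary: f)
    case (Suc k)
    have "C_infinity_on I (vderiv f)" unfolding C_infinity_on_def
    proof (intro allI ballI)
      fix m t assume "t \<in> I"
      then have "((vderiv ^^ Suc m) f) differentiable (at t)"
        using Suc.prems unfolding C_infinity_on_def by blast
      then show "((vderiv ^^ m) (vderiv f)) differentiable (at t)"
        by (simp only: funpow_Suc_right o_apply)
    qed
    moreover have "(f has_vector_derivative vderiv f t) (at t)" if "t \<in> I" for t
    proof -
      have "((vderiv ^^ 0) f) differentiable (at t)" using Suc.prems that unfolding C_infinity_on_def by blast
      then show ?thesis by (simp add: vector_derivative_works)
    qed
    ultimately show ?case using Suc.IH Ck_SucI by blast
  qed simp
  then show "C_infinity_on I f \<Longrightarrow> smooth I f" by (simp add: smooth_def)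
qed

lemma smooth_cont: "open I \<Longrightarrow> smooth I f \<Longrightarrow> t \<in> I \<Longrightarrow> isCont f t"
  using smooth_vderiv(2) has_vector_derivative_continuous by blast

lemma smooth_const: "smooth I (\<lambda>t. c)"
  and smooth_of_real: "smooth I of_real"
  and smooth_add: "smooth I f \<Longrightarrow> smooth I g \<Longrightarrow> smooth I (\<lambda>t. f t + g t)"
  and smooth_diff: "smooth I f \<Longrightarrow> smooth I g \<Longrightarrow> smooth I (\<lambda>t. f t - g t)"
  and smooth_mult: "smooth I f \<Longrightarrow> smooth I g \<Longrightarrow> smooth I (\<lambda>t. f t * g t)"
  and smooth_subset: "J \<subseteq> I \<Longrightarrow> smooth I f \<Longrightarrow> smooth J f"
  and smooth_cong: "open I \<Longrightarrow> (\<And>t. t \<in> I \<Longrightarrow> f t = g t) \<Longrightarrow> smooth I f \<Longrightarrow> smooth I g"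
  by (simp_all add: smooth_def Ck_const Ck_of_real Ck_add Ck_diff Ck_mult)
     (metis Ck_subset, metis Ck_cong)

lemma smooth_sum: "(\<And>a. a \<in> A \<Longrightarrow> smooth I (f a)) \<Longrightarrow> smooth I (\<lambda>t. \<Sum>a\<in>A. f a t)"
  by (simp add: smooth_def Ck_sum)

lemma smooth_power: "smooth I f \<Longrightarrow> smooth I (\<lambda>t. f t ^ n)"
  by (simp add: smooth_def Ck_power)

lemma smooth_poly: "smooth I (\<lambda>t. poly p (of_real t))"
  unfolding poly_altdef
  by (intro smooth_sum smooth_mult smooth_const smooth_power smooth_of_real[unfolded id_def])

lemma smooth_compose:
  assumes "smooth J f" "\<And>t. t \<in> I \<Longrightarrow> \<phi> t \<in> J" "\<And>t. t \<in> I \<Longrightarrow> (\<phi> has_vector_derivative \<phi>' t) (at t)"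
    "smooth I (\<lambda>t. of_real (\<phi>' t))"
  shows "smooth I (\<lambda>t. f (\<phi> t))"
  unfolding smooth_def
  by (intro allI Ck_compose[of I \<phi> J \<phi>']) (use assms in \<open>simp_all add: smooth_def\<close>)

text \<open>
  Implicit differentiation of a continuous simple root. With \<open>x = l t\<close>, the values at
  \<open>l s\<close> and at \<open>x\<close> of the polynomial at time \<open>s\<close> differ by \<open>(l s - x) R(s)\<close>, where \<open>R(s)\<close> tends to the
  derivative of the polynomial at \<open>x\<close>; so the difference quotient of \<open>l\<close> converges.
\<close>

lemma root_derivative:
  fixes c c' :: "nat \<Rightarrow> real \<Rightarrow> complex" and l :: "real \<Rightarrow> complex"
  assumes c: "\<And>j. j \<le> n \<Longrightarrow> (c j has_vector_derivative c' j t) (at t)"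
    and l: "isCont l t"
    and root: "eventually (\<lambda>s. (\<Sum>j\<le>n. c j s * l s ^ j) = 0) (nhds t)"
    and simple: "(\<Sum>j\<le>n. of_nat j * c j t * l t ^ (j - 1)) \<noteq> 0"
  shows "(l has_vector_derivative
     - (\<Sum>j\<le>n. c' j t * l t ^ j) * inverse (\<Sum>j\<le>n. of_nat j * c j t * l t ^ (j - 1))) (at t)"
proof -
  define x where "x = l t"
  define D where "D = (\<Sum>j\<le>n. of_nat j * c j t * x ^ (j - 1))"
  define R where "R s = (\<Sum>j\<le>n. c j s * (\<Sum>i<j. l s ^ i * x ^ (j - Suc i)))" for s
  define G where "G s = (\<Sum>j\<le>n. c j s * x ^ j)" for s
  have [tendsto_intros]: "(c j \<longlongrightarrow> c j t) (at t)" if "j \<le> n" for j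
    using has_vector_derivative_continuous[OF c[OF that]] by (simp add: continuous_at)
  have [tendsto_intros]: "(l \<longlongrightarrow> x) (at t)" using l by (simp add: isCont_def x_def)
  have "(R \<longlongrightarrow> (\<Sum>j\<le>n. c j t * (\<Sum>i<j. x ^ i * x ^ (j - Suc i)))) (at t)"
    unfolding R_def by (intro tendsto_intros) auto
  also have "(\<Sum>j\<le>n. c j t * (\<Sum>i<j. x ^ i * x ^ (j - Suc i))) = D"
    unfolding D_def
  proof (intro sum.cong refl)
    fix j
    have "(\<Sum>i<j. x ^ i * x ^ (j - Suc i)) = (\<Sum>i<j. x ^ (j - 1))"
      by (intro sum.cong refl) (simp add: power_add [symmetric])
    then show "c j t * (\<Sum>i<j. x ^ i * x ^ (j - Suc i)) = of_nat j * c j t * x ^ (j - 1)"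
      by simp
  qed
  finally have R: "(R \<longlongrightarrow> D) (at t)" .
  have D0: "D \<noteq> 0" using simple by (simp add: D_def x_def)
  have "(G has_vector_derivative (\<Sum>j\<le>n. c' j t * x ^ j)) (at t)"
    unfolding G_def by (intro has_vector_derivative_sum) (auto intro!: has_vector_derivative_mult_left c)
  then have G: "((\<lambda>s. (G s - G t) / of_real (s - t)) \<longlongrightarrow> (\<Sum>j\<le>n. c' j t * x ^ j)) (at t)"
    by (simp only: has_vector_derivative_complex_iff)
  have Gt: "G t = 0" using eventually_nhds_x_imp_x[OF root] by (simp add: G_def x_def)
  have key: "(\<Sum>j\<le>n. c j s * l s ^ j) = G s + (l s - x) * R s" for s
  proof -
    have p: "l s ^ j = x ^ j + (l s - x) * (\<Sum>i<j. l s ^ i * x ^ (j - Suc i))" for j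
      using power_diff_sumr2[of "l s" j x] by (simp add: mult.commute[of "x ^ _"] algebra_simps)
    have "c j s * l s ^ j = c j s * x ^ j + (l s - x) * (c j s * (\<Sum>i<j. l s ^ i * x ^ (j - Suc i)))" for j
      by (subst p) (simp only: ring_distribs mult.left_commute)
    then have "(\<Sum>j\<le>n. c j s * l s ^ j) =
        (\<Sum>j\<le>n. c j s * x ^ j + (l s - x) * (c j s * (\<Sum>i<j. l s ^ i * x ^ (j - Suc i))))"
      by (intro sum.cong refl)
    also have "\<dots> = G s + (l s - x) * R s"
      unfolding G_def R_def by (simp only: sum.distrib sum_distrib_left)
    finally show ?thesis .
  qed
  have "eventually (\<lambda>s. R s \<noteq> 0) (at t)" using R D0 by (rule tendsto_imp_eventually_ne)
  moreover have "eventually (\<lambda>s. (\<Sum>j\<le>n. c j s * l s ^ j) = 0) (at t)"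
    using root by (simp add: eventually_at_filter eventually_mono)
  moreover have "eventually (\<lambda>s. s \<noteq> t) (at t)" by (simp add: eventually_at_filter)
  ultimately have ev: "eventually (\<lambda>s. - ((G s - G t) / of_real (s - t)) * inverse (R s) = (l s - l t) / of_real (s - t)) (at t)"
  proof eventually_elim
    case (elim s)
    then have "(l s - x) * R s = - G s" using key[of s] by (simp add: add_eq_0_iff)
    then have "l s - l t = - G s * inverse (R s)" using elim by (simp add: x_def field_simps)
    then show ?case by (simp only: Gt divide_inverse) simp
  qed
  have "((\<lambda>s. - ((G s - G t) / of_real (s - t)) * inverse (R s)) \<longlongrightarrow> - (\<Sum>j\<le>n. c' j t * x ^ j) * inverse D) (at t)"
    by (intro tendsto_intros G R D0)
  then have "((\<lambda>s. (l s - l t) / of_real (s - t)) \<longlongrightarrow> - (\<Sum>j\<le>n. c' j t * x ^ j) * inverse D) (at t)"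
    by (rule Lim_transform_eventually) (rule ev)
  then show ?thesis by (simp add: has_vector_derivative_complex_iff D_def x_def)
qed

text \<open>
  Bootstrapping: the formula for \<open>l'\<close> expresses it by \<open>l\<close> and the coefficients, so \<open>l'\<close> is of
  class \<open>C\<^sup>k\<close> when \<open>l\<close> is.
\<close>

lemma smooth_simple_root:
  assumes I: "open I" and c: "\<And>j. j \<le> n \<Longrightarrow> smooth I (c j)"
    and l: "\<And>t. t \<in> I \<Longrightarrow> isCont l t"
    and root: "\<And>t. t \<in> I \<Longrightarrow> (\<Sum>j\<le>n. c j t * l t ^ j) = 0"
    and simple: "\<And>t. t \<in> I \<Longrightarrow> (\<Sum>j\<le>n. of_nat j * c j t * l t ^ (j - 1)) \<noteq> 0"
  shows "smooth I l"
proof -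
  have "Ck k I l" for k
  proof (induction k)
    case (Suc k)
    define l' where "l' t = - (\<Sum>j\<le>n. vderiv (c j) t * l t ^ j) * inverse (\<Sum>j\<le>n. of_nat j * c j t * l t ^ (j - 1))" for t
    have "(l has_vector_derivative l' t) (at t)" if "t \<in> I" for t
      unfolding l'_def
    proof (rule root_derivative)
      show "eventually (\<lambda>s. (\<Sum>j\<le>n. c j s * l s ^ j) = 0) (nhds t)"
        using eventually_nhds_in_open[OF I that] by eventually_elim (rule root)
    qed (use that smooth_vderiv(2)[OF I c] l simple in auto)
    moreover have "Ck k I l'" unfolding l'_def
      by (intro Ck_mult Ck_uminus Ck_inverse Ck_sum Ck_power Ck_const Suc simple)
         (use c smooth_vderiv(1)[OF I c] in \<open>auto simp: smooth_def\<close>)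
    ultimately show ?case by (rule Ck_SucI[rotated])
  qed simp
  then show ?thesis by (simp add: smooth_def)
qed

section \<open>Asymptotic expansions\<close>

abbreviation approximates :: "real filter \<Rightarrow> (real \<Rightarrow> complex) \<Rightarrow> complex poly \<Rightarrow> real \<Rightarrow> nat \<Rightarrow> bool" where
  "approximates l f p C K \<equiv>
     eventually (\<lambda>t. \<bar>t\<bar> \<le> 1 \<and> norm (f t - poly p (of_real t)) \<le> C * \<bar>t\<bar> ^ K) l"

text \<open>
  \<open>F\<close> is the asymptotic expansion of \<open>f\<close> along the filter \<open>l\<close>. The approximating polynomial only has
  to agree with \<open>F\<close> up to order \<open>K\<close>, which makes sums, products and composites of approximations
  approximations again. The condition \<open>\<bar>t\<bar> \<le> 1\<close> is what bounds polynomials and compares powers of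
  \<open>t\<close>.
\<close>

definition expands :: "real filter \<Rightarrow> (real \<Rightarrow> complex) \<Rightarrow> complex fps \<Rightarrow> bool" where
  "expands l f F \<longleftrightarrow> (\<forall>K. \<exists>p C. fps_X ^ K dvd fps_of_poly p - F \<and>
     approximates l f p C K)"

lemma expandsD:
  assumes "expands l f F"
  obtains p C where "fps_X ^ K dvd fps_of_poly p - F" "C \<ge> 0"
    "approximates l f p C K"
proof -
  from assms obtain p C where p: "fps_X ^ K dvd fps_of_poly p - F"
    "approximates l f p C K"
    unfolding expands_def by blast
  from p(2) have "approximates l f p \<bar>C\<bar> K"
  proof eventually_elim
    case (elim t)
    have "C * \<bar>t\<bar> ^ K \<le> \<bar>C\<bar> * \<bar>t\<bar> ^ K" by (intro mult_right_mono) auto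
    with elim show ?case by linarith
  qed
  with p(1) show ?thesis by (intro that[of p "\<bar>C\<bar>"]) auto
qed

lemma expands_mono: "expands l f F \<Longrightarrow> l' \<le> l \<Longrightarrow> expands l' f F"
  unfolding expands_def by (meson filter_leD)

lemma expands_cong:
  assumes "expands l f F" "eventually (\<lambda>t. f t = g t) l"
  shows "expands l g F"
  unfolding expands_def
proof
  fix K
  obtain p C where p: "fps_X ^ K dvd fps_of_poly p - F" "C \<ge> 0"
    "approximates l f p C K"
    using expandsD[OF assms(1)] .
  from p(3) assms(2) have "approximates l g p C K"
    by eventually_elim simp
  with p(1) show "\<exists>p C. fps_X ^ K dvd fps_of_poly p - F \<and>
     approximates l g p C K" by blast
qed

lemma expands_poly:
  assumes "eventually (\<lambda>t. \<bar>t\<bar> \<le> 1) l"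
  shows "expands l (\<lambda>t. poly p (of_real t)) (fps_of_poly p)"
  unfolding expands_def
proof
  fix K
  show "\<exists>q C. fps_X ^ K dvd fps_of_poly q - fps_of_poly p \<and>
     approximates l (\<lambda>t. poly p (of_real t)) q C K"
    by (intro exI[of _ p] exI[of _ 0]) (use assms in simp)
qed

lemma expands_add:
  assumes "expands l f F" "expands l g G"
  shows "expands l (\<lambda>t. f t + g t) (F + G)"
  unfolding expands_def
proof
  fix K
  obtain p C where p: "fps_X ^ K dvd fps_of_poly p - F" "C \<ge> 0"
    "approximates l f p C K"
    using expandsD[OF assms(1)] .
  obtain q D where q: "fps_X ^ K dvd fps_of_poly q - G" "D \<ge> 0"
    "approximates l g q D K"
    using expandsD[OF assms(2)] .
  have "fps_of_poly (p + q) - (F + G) = (fps_of_poly p - F) + (fps_of_poly q - G)"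
    by (simp add: fps_of_poly_add)
  with p q have "fps_X ^ K dvd fps_of_poly (p + q) - (F + G)" by (simp only: dvd_add)
  moreover from p(3) q(3)
  have "approximates l (\<lambda>t. f t + g t) (p + q) (C + D) K"
  proof eventually_elim
    case (elim t)
    have "f t + g t - poly (p + q) (of_real t) = (f t - poly p (of_real t)) + (g t - poly q (of_real t))"
      by simp
    also have "norm \<dots> \<le> C * \<bar>t\<bar> ^ K + D * \<bar>t\<bar> ^ K"
      using elim by (intro order.trans[OF norm_triangle_ineq] add_mono) auto
    finally show ?case using elim by (simp add: distrib_right)
  qed
  ultimately show "\<exists>p C. fps_X ^ K dvd fps_of_poly p - (F + G) \<and>
     approximates l (\<lambda>t. f t + g t) p C K" by blast
qed

lemma poly_bounded_unit:
  obtains B where "B \<ge> 0" "\<And>t. \<bar>t\<bar> \<le> 1 \<Longrightarrow> norm (poly p (of_real t :: complex)) \<le> B"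
proof -
  have "norm (poly p (of_real t :: complex)) \<le> (\<Sum>i\<le>degree p. norm (coeff p i))" if "\<bar>t\<bar> \<le> 1" for t
    unfolding poly_altdef
    by (intro sum_norm_le) (use that in \<open>auto simp: norm_mult norm_power intro!: mult_left_le power_le_one\<close>)
  then show ?thesis by (intro that[of "\<Sum>i\<le>degree p. norm (coeff p i)"]) (auto intro: sum_nonneg)
qed

lemma expands_bounded:
  assumes "expands l f F"
  obtains B where "B \<ge> 0" "eventually (\<lambda>t. norm (f t) \<le> B) l"
proof -
  obtain p C where p: "fps_X ^ 0 dvd fps_of_poly p - F" "C \<ge> 0"
    "approximates l f p C 0"
    using expandsD[OF assms(1)] .
  obtain B where B: "B \<ge> 0" "\<And>t. \<bar>t\<bar> \<le> 1 \<Longrightarrow> norm (poly p (of_real t :: complex)) \<le> B"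
    using poly_bounded_unit[of p] by blast
  from p(3) have "eventually (\<lambda>t. norm (f t) \<le> B + C) l"
  proof eventually_elim
    case (elim t)
    then show ?case using norm_triangle_sub[of "f t" "poly p (of_real t)"] B(2)[of t] by simp
  qed
  then show ?thesis using B p by (intro that[of "B + C"]) auto
qed

lemma expands_mult:
  assumes "expands l f F" "expands l g G"
  shows "expands l (\<lambda>t. f t * g t) (F * G)"
  unfolding expands_def
proof
  fix K
  obtain p C where p: "fps_X ^ K dvd fps_of_poly p - F" "C \<ge> 0"
    "approximates l f p C K"
    using expandsD[OF assms(1)] .
  obtain q D where q: "fps_X ^ K dvd fps_of_poly q - G" "D \<ge> 0"
    "approximates l g q D K"
    using expandsD[OF assms(2)] .
  obtain A where A: "A \<ge> 0" "eventually (\<lambda>t. norm (f t) \<le> A) l" using expands_bounded[OF assms(1)] .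
  obtain B where B: "B \<ge> 0" "\<And>t. \<bar>t\<bar> \<le> 1 \<Longrightarrow> norm (poly q (of_real t :: complex)) \<le> B"
    using poly_bounded_unit[of q] by blast
  have "fps_of_poly (p * q) - (F * G) = (fps_of_poly p - F) * fps_of_poly q + F * (fps_of_poly q - G)"
    by (simp add: fps_of_poly_mult algebra_simps)
  with p q have "fps_X ^ K dvd fps_of_poly (p * q) - (F * G)"
    by (simp only: dvd_add dvd_mult dvd_mult2)
  moreover from p(3) q(3) A(2)
  have "approximates l (\<lambda>t. f t * g t) (p * q) (C * B + A * D) K"
  proof eventually_elim
    case (elim t)
    have "f t * g t - poly (p * q) (of_real t) =
        (f t - poly p (of_real t)) * poly q (of_real t) + f t * (g t - poly q (of_real t))"
      by (simp add: algebra_simps)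
    also have "norm \<dots> \<le> (C * \<bar>t\<bar> ^ K) * B + A * (D * \<bar>t\<bar> ^ K)"
      using elim A B p q unfolding norm_mult [symmetric]
      by (intro order.trans[OF norm_triangle_ineq] add_mono)
         (auto simp: norm_mult intro!: mult_mono)
    finally show ?case using elim by (simp add: algebra_simps)
  qed
  ultimately show "\<exists>p C. fps_X ^ K dvd fps_of_poly p - (F * G) \<and>
     approximates l (\<lambda>t. f t * g t) p C K" by blast
qed

lemma expands_compose:
  assumes f: "expands l f F" and lim: "filterlim \<phi> l l'"
    and q: "coeff q 0 = 0" "\<And>t. of_real (\<phi> t) = poly q (of_real t)"
    and small: "eventually (\<lambda>t. \<bar>t\<bar> \<le> 1 \<and> \<bar>\<phi> t\<bar> \<le> \<bar>t\<bar>) l'"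
  shows "expands l' (\<lambda>t. f (\<phi> t)) (F oo fps_of_poly q)"
  unfolding expands_def
proof
  fix K
  obtain p C where p: "fps_X ^ K dvd fps_of_poly p - F" "C \<ge> 0"
    "approximates l f p C K"
    using expandsD[OF f] .
  define Q where "Q = fps_of_poly q"
  have Q0: "Q $ 0 = 0" using q(1) by (simp add: Q_def)
  interpret h: coeff_hom "\<lambda>F. F oo Q" by (rule coeff_hom_compose[OF Q0])
  from p(1) obtain H where H: "fps_of_poly p - F = fps_X ^ K * H" ..
  have "fps_of_poly (pcompose p q) - (F oo Q) = (fps_of_poly p - F) oo Q"
    using q(1) by (simp add: fps_of_poly_pcompose fps_compose_sub_distrib Q_def)
  also have "\<dots> = Q ^ K * (H oo Q)"
    unfolding H h.h_mult using Q0
    by (simp add: fps_compose_power [symmetric] fps_X_fps_compose_startby0)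
  finally have eq: "fps_of_poly (pcompose p q) - (F oo Q) = Q ^ K * (H oo Q)" .
  have "fps_X dvd Q" using fps_X_power_dvd_iff[of 1 Q] Q0 by simp
  then have "fps_X ^ K dvd Q ^ K" by (rule dvd_power_same)
  then have "fps_X ^ K dvd fps_of_poly (pcompose p q) - (F oo Q)" unfolding eq by (rule dvd_mult2)
  moreover have "approximates l' (\<lambda>t. f (\<phi> t)) (pcompose p q) C K"
    using small lim[unfolded filterlim_iff, rule_format, OF p(3)]
  proof eventually_elim
    case (elim t)
    have "norm (f (\<phi> t) - poly (pcompose p q) (of_real t)) \<le> C * \<bar>\<phi> t\<bar> ^ K"
      using elim by (simp add: poly_pcompose q(2))
    also have "\<dots> \<le> C * \<bar>t\<bar> ^ K" using elim p by (intro mult_left_mono power_mono) auto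
    finally show ?case using elim by simp
  qed
  ultimately show "\<exists>p C. fps_X ^ K dvd fps_of_poly p - (F oo fps_of_poly q) \<and>
     approximates l' (\<lambda>t. f (\<phi> t)) p C K"
    unfolding Q_def by blast
qed

definition taylor :: "(real \<Rightarrow> complex) \<Rightarrow> complex fps" where
  "taylor f = Abs_fps (\<lambda>k. (vderiv ^^ k) f 0 / fact k)"

lemma taylor_vderiv: "pderiv (truncate_fps (Suc K) (taylor f)) = truncate_fps K (taylor (vderiv f))"
proof (rule poly_eqI)
  fix i
  have "(vderiv ^^ Suc i) f = (vderiv ^^ i) (vderiv f)" by (simp only: funpow_Suc_right o_apply)
  then show "coeff (pderiv (truncate_fps (Suc K) (taylor f))) i = coeff (truncate_fps K (taylor (vderiv f))) i"
    by (simp add: coeff_pderiv coeff_truncate_fps taylor_def fact_Suc del: funpow.simps of_nat_Suc)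
qed

text \<open>
  Induction on \<open>K\<close>: by the mean value inequality the estimate for the derivative of \<open>f\<close> gains one
  power of \<open>t\<close>.
\<close>

lemma taylor_remainder:
  assumes I: "open I" "0 \<in> I"
  shows "smooth I f \<Longrightarrow> \<exists>C\<ge>0. eventually (\<lambda>t. norm (f t - poly (truncate_fps K (taylor f)) (of_real t)) \<le> C * \<bar>t\<bar> ^ K) (nhds 0)"
proof (induction K arbitrary: f)
  case 0
  have "isCont f 0" using smooth_cont[OF I(1) 0 I(2)] .
  then have "(f \<longlongrightarrow> f 0) (nhds 0)" by (simp add: tendsto_nhds_iff isCont_def)
  then have "eventually (\<lambda>t. dist (f t) (f 0) < 1) (nhds 0)" by (rule tendstoD) simp
  then have "eventually (\<lambda>t. norm (f t - poly (truncate_fps 0 (taylor f)) (of_real t)) \<le> (norm (f 0) + 1) * \<bar>t\<bar> ^ 0) (nhds 0)"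
  proof eventually_elim
    case (elim t)
    then show ?case using norm_triangle_sub[of "f t" "f 0"] by (simp add: dist_norm)
  qed
  then show ?case by (intro exI[of _ "norm (f 0) + 1"]) simp
next
  case (Suc K f)
  define p where "p = truncate_fps (Suc K) (taylor f)"
  have p': "pderiv p = truncate_fps K (taylor (vderiv f))" by (simp only: p_def taylor_vderiv)
  obtain C where C: "C \<ge> 0"
    "eventually (\<lambda>t. norm (vderiv f t - poly (pderiv p) (of_real t)) \<le> C * \<bar>t\<bar> ^ K) (nhds 0)"
    using Suc.IH[OF smooth_vderiv(1)[OF I(1) Suc.prems]] unfolding p' by blast
  from eventually_conj[OF C(2) eventually_nhds_in_open[OF I]]
  obtain d where d: "d > 0" "\<And>t. \<bar>t\<bar> < d \<Longrightarrow> norm (vderiv f t - poly (pderiv p) (of_real t)) \<le> C * \<bar>t\<bar> ^ K \<and> t \<in> I"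
    unfolding eventually_nhds_metric by (auto simp: dist_real_def)
  have f0: "f 0 = poly p 0"
    by (simp add: p_def poly_0_coeff_0 coeff_truncate_fps taylor_def)
  have "norm (f t - poly p (of_real t)) \<le> C * \<bar>t\<bar> ^ Suc K" if t: "\<bar>t\<bar> < d" for t
  proof -
    define g where "g s = f s - poly p (of_real s)" for s
    define g' where "g' s = vderiv f s - poly (pderiv p) (of_real s)" for s
    have der: "(g has_vector_derivative g' s) (at s)" if "\<bar>s\<bar> < d" for s
      unfolding g_def g'_def using d(2)[OF that] smooth_vderiv(2)[OF I(1) Suc.prems, of s]
      by (intro has_vector_derivative_diff has_vector_derivative_real_field poly_DERIV) auto
    have "norm (g t - g 0) \<le> (C * \<bar>t\<bar> ^ K) * norm (t - 0)"
    proof (rule differentiable_bound[of "{- \<bar>t\<bar> .. \<bar>t\<bar>}"])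
      fix s assume s: "s \<in> {- \<bar>t\<bar> .. \<bar>t\<bar>}"
      then have "\<bar>s\<bar> < d" using t by auto
      from has_vector_derivative_at_within[OF der[OF this]]
      show "(g has_derivative (\<lambda>x. x *\<^sub>R g' s)) (at s within {- \<bar>t\<bar> .. \<bar>t\<bar>})"
        by (simp add: has_vector_derivative_def)
      have "onorm (\<lambda>x. x *\<^sub>R g' s) = norm (g' s)"
        using onorm_scaleR_left[of "\<lambda>x::real. x" "g' s"] by (simp add: onorm_id)
      also have "\<dots> \<le> C * \<bar>s\<bar> ^ K" using d(2)[OF \<open>\<bar>s\<bar> < d\<close>] by (simp add: g'_def)
      also have "\<dots> \<le> C * \<bar>t\<bar> ^ K" using s C by (intro mult_left_mono power_mono) auto
      finally show "onorm (\<lambda>x. x *\<^sub>R g' s) \<le> C * \<bar>t\<bar> ^ K" .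
    qed auto
    then show ?thesis by (simp add: g_def f0 mult_ac)
  qed
  then have "eventually (\<lambda>t. norm (f t - poly p (of_real t)) \<le> C * \<bar>t\<bar> ^ Suc K) (nhds 0)"
    unfolding eventually_nhds_metric using d(1) by (auto simp: dist_real_def)
  then show ?case using C(1) unfolding p_def by blast
qed

lemma expands_taylor:
  assumes "open I" "0 \<in> I" "smooth I f"
  shows "expands (nhds 0) f (taylor f)"
  unfolding expands_def
proof
  fix K
  obtain C where C: "eventually (\<lambda>t. norm (f t - poly (truncate_fps K (taylor f)) (of_real t)) \<le> C * \<bar>t\<bar> ^ K) (nhds 0)"
    using taylor_remainder[OF assms] by blast
  have "eventually (\<lambda>t::real. \<bar>t\<bar> \<le> 1) (nhds 0)"
    unfolding eventually_nhds_metric by (auto simp: dist_real_def intro!: exI[of _ 1])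
  from eventually_conj[OF this C]
  show "\<exists>p C. fps_X ^ K dvd fps_of_poly p - taylor f \<and>
     approximates (nhds 0) f p C K"
    by (intro exI[of _ "truncate_fps K (taylor f)"] exI[of _ C]) (simp add: fps_X_power_dvd_iff)
qed

section \<open>Germs of definable functions at zero from the right\<close>

text \<open>
  For every rational \<open>q\<close>, the complement of the boundary of the open set where \<open>f < q\<close> is open and
  dense, and \<open>f\<close> is continuous at each point that lies in all of these complements. Such a point
  exists by Baire's theorem.
\<close>

lemma usc_continuity_point:
  fixes f :: "real \<Rightarrow> real"
  assumes ab: "a < b" and usc: "\<And>t c. a < t \<Longrightarrow> t < b \<Longrightarrow> f t < c \<Longrightarrow> eventually (\<lambda>s. f s < c) (nhds t)"
  shows "\<exists>t. a < t \<and> t < b \<and> isCont f t"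
proof -
  define U where "U q = {t. a < t \<and> t < b \<and> f t < q}" for q
  define G where "G q = U q \<union> ({a<..<b} - closure (U q))" for q
  have oU: "open (U q)" for q
  proof -
    have ev: "eventually (\<lambda>s. s \<in> U q) (nhds t)" if "t \<in> U q" for t
    proof -
      have "eventually (\<lambda>s. s \<in> {a<..<b}) (nhds t)"
        using that by (intro eventually_nhds_in_open) (auto simp: U_def)
      moreover have "eventually (\<lambda>s. f s < q) (nhds t)" using that by (intro usc) (auto simp: U_def)
      ultimately show ?thesis by eventually_elim (auto simp: U_def)
    qed
    have "\<exists>T. open T \<and> t \<in> T \<and> T \<subseteq> U q" if "t \<in> U q" for t
    proof -
      from that obtain S where "open S" "t \<in> S" "\<forall>s\<in>S. s \<in> U q"
        using ev[of t] unfolding eventually_nhds by auto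
      then show "\<exists>T. open T \<and> t \<in> T \<and> T \<subseteq> U q" by (intro exI[of _ S]) auto
    qed
    then show ?thesis by (subst open_subopen) blast
  qed
  have oG: "open (G q)" for q
    unfolding G_def by (intro open_Un oU open_Diff) auto
  have dense: "{a..b} \<subseteq> closure (G q)" for q
  proof -
    have "{a<..<b} \<subseteq> closure (G q)"
    proof
      fix x assume x: "x \<in> {a<..<b}"
      show "x \<in> closure (G q)"
      proof (cases "x \<in> closure (U q)")
        case True
        then show ?thesis unfolding G_def closure_Un by simp
      next
        case False
        with x have "x \<in> G q" by (simp add: G_def)
        then show ?thesis using closure_subset[of "G q"] by auto
      qed
    qed
    then have "closure {a<..<b} \<subseteq> closure (G q)" by (intro closure_minimal) auto
    then show ?thesis using ab by simp
  qed
  have Gsub: "G q \<subseteq> {a<..<b}" for q by (auto simp: G_def U_def)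
  have "{a..b} \<subseteq> closure (\<Inter>(G ` \<rat>))"
  proof (rule Baire)
    show "countable (G ` \<rat>)" by (intro countable_image countable_rat)
    show "openin (top_of_set {a..b}) T \<and> {a..b} \<subseteq> closure T" if "T \<in> G ` \<rat>" for T
    proof -
      from that obtain q where T: "T = G q" by blast
      have "T = {a..b} \<inter> T" using Gsub[of q] T by auto
      then have "openin (top_of_set {a..b}) T" using oG[of q] T openin_open_Int by metis
      then show ?thesis using dense T by simp
    qed
  qed auto
  moreover have "{a..b} \<noteq> {}" using ab by simp
  ultimately have "\<Inter>(G ` \<rat>) \<noteq> {}" by (metis closure_empty subset_empty)
  then obtain t where t: "\<And>q. q \<in> \<rat> \<Longrightarrow> t \<in> G q" by blast
  have tab: "a < t" "t < b" using subsetD[OF Gsub[of 0] t[of 0]] by auto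
  have "(f \<longlongrightarrow> f t) (nhds t)"
  proof (rule order_tendstoI)
    fix c assume "f t < c"
    then show "eventually (\<lambda>s. f s < c) (nhds t)" using usc tab by blast
  next
    fix c assume "c < f t"
    then obtain q where q: "q \<in> \<rat>" "c < q" "q < f t" using Rats_dense_in_real by blast
    have "t \<in> {a<..<b} - closure (U q)" using t[OF q(1)] q(3) by (auto simp: G_def U_def)
    then have "eventually (\<lambda>s. s \<in> {a<..<b} - closure (U q)) (nhds t)"
      by (intro eventually_nhds_in_open open_Diff) auto
    then show "eventually (\<lambda>s. c < f s) (nhds t)"
    proof eventually_elim
      case (elim s)
      then have "s \<notin> U q" using closure_subset by blast
      then show ?case using elim q by (auto simp: U_def)
    qed
  qed
  then have "isCont f t" by (simp add: isCont_def tendsto_nhds_iff)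
  then show ?thesis using tab by blast
qed

context o_minimal_structure
begin

lemma definable_fun_uminus: "definable_fun f \<Longrightarrow> definable_fun (\<lambda>e. - f e)"
  using definable_fun_diff[OF definable_fun_const[of 0]] by simp

lemma definable_fun_power: "definable_fun f \<Longrightarrow> definable_fun (\<lambda>e. f e ^ n)"
proof (induction n)
  case 0
  show ?case using definable_fun_const[of 1] by simp
next
  case (Suc n)
  then show ?case using definable_fun_mult[of f "\<lambda>e. f e ^ n"] by simp
qed

lemmas definable_intros = definable_and definable_or definable_imp definable_not definable_less definable_le definable_eq
  definable_fun_add definable_fun_diff definable_fun_mult definable_fun_abs definable_fun_power definable_fun_uminus definable_fun_var definable_fun_const

lemma definable_fun_graph:
  assumes "definable (\<lambda>e. G (e 0) (e 1))" "\<And>t y. G t y \<longleftrightarrow> y = F t"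
  shows "definable_fun (\<lambda>e. F (e 0))"
proof -
  have "definable (\<lambda>e. e 1 = F (e 0))" using assms by simp
  from definable_rename[OF this, of "\<lambda>i. if i = 0 then 1 else 0"]
  have "definable (\<lambda>e. e 0 = F (e 1))" by simp
  then show ?thesis using definable_fun_op2[of "\<lambda>x y. F x" "\<lambda>e. e 0" "\<lambda>e. e 0"] definable_fun_var by simp
qed

text \<open>
  The \<open>\<epsilon>\<close>-\<open>\<delta>\<close> definition of the derivative is a first-order formula.
\<close>

lemma definable_fun_derivative:
  assumes R: "definable_fun (\<lambda>e. R (e 0))"
    and d: "\<And>t. 0 < t \<Longrightarrow> t < \<epsilon> \<Longrightarrow> (R has_real_derivative R' t) (at t)"
    and out: "\<And>t. \<not> (0 < t \<and> t < \<epsilon>) \<Longrightarrow> R' t = 0"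
  shows "definable_fun (\<lambda>e. R' (e 0))"
proof -
  define Q where "Q t y \<longleftrightarrow> (\<forall>\<eta>. 0 < \<eta> \<longrightarrow> (\<exists>\<delta>. 0 < \<delta> \<and>
     (\<forall>s. \<bar>s - t\<bar> < \<delta> \<longrightarrow> \<bar>R s - R t - y * (s - t)\<bar> \<le> \<eta> * \<bar>s - t\<bar>)))" for t y
  have Q: "Q t y \<longleftrightarrow> (R has_real_derivative y) (at t)" for t y
    unfolding Q_def has_field_derivative_def has_derivative_at_alt
    by (simp add: bounded_linear_mult_right mult.commute)
  note R' = definable_fun_comp[OF R]
  have dQ: "definable (\<lambda>e. Q (e 0) (e 1))"
    unfolding Q_def
    by (rule definable_all[where k = 2], rule definable_imp, (intro definable_intros)[1],
        rule definable_ex[where k = 3], rule definable_and, (intro definable_intros)[1],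
        rule definable_all[where k = 4], intro definable_intros R') auto
  show ?thesis
  proof (rule definable_fun_graph)
    show "definable (\<lambda>e. ((0 < e 0 \<and> e 0 < \<epsilon>) \<and> Q (e 0) (e 1)) \<or> (\<not> (0 < e 0 \<and> e 0 < \<epsilon>) \<and> e 1 = 0))"
      by (intro definable_intros dQ)
    show "((0 < t \<and> t < \<epsilon>) \<and> Q t y) \<or> (\<not> (0 < t \<and> t < \<epsilon>) \<and> y = 0) \<longleftrightarrow> y = R' t" for t y
      using d[of t] out[of t] DERIV_unique[of R y t "R' t"] unfolding Q by (cases "0 < t \<and> t < \<epsilon>") auto
  qed
qed

text \<open>
  The set of continuity points is definable, and upper semicontinuity gives continuity points
  arbitrarily close to \<open>0\<close>.
\<close>

lemma definable_usc_isCont_germ: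
  assumes R: "definable_fun (\<lambda>e. R (e 0))"
    and "\<epsilon> > 0" and usc: "\<And>t c. 0 < t \<Longrightarrow> t < \<epsilon> \<Longrightarrow> R t < c \<Longrightarrow> eventually (\<lambda>s. R s < c) (nhds t)"
  shows "eventually (\<lambda>t. isCont R t) (at_right 0)"
proof -
  define Q where "Q t \<longleftrightarrow> (\<forall>\<eta>. 0 < \<eta> \<longrightarrow> (\<exists>\<delta>. 0 < \<delta> \<and>
     (\<forall>s. \<bar>s - t\<bar> < \<delta> \<longrightarrow> \<bar>R s - R t\<bar> < \<eta>)))" for t
  have Q: "Q t \<longleftrightarrow> isCont R t" for t
    unfolding Q_def continuous_at_eps_delta by (simp add: dist_real_def)
  note R' = definable_fun_comp[OF R]
  have dQ: "definable (\<lambda>e. Q (e 0))"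
    unfolding Q_def
    by (rule definable_all[where k = 2], rule definable_imp, (intro definable_intros)[1],
        rule definable_ex[where k = 3], rule definable_and, (intro definable_intros)[1],
        rule definable_all[where k = 4], intro definable_intros R') auto
  from definable_germ_dichotomy[OF this, of 0] show ?thesis
  proof
    assume "eventually (\<lambda>t. \<not> Q t) (at_right 0)"
    then obtain b where b: "b > 0" "\<And>t. 0 < t \<Longrightarrow> t < b \<Longrightarrow> \<not> isCont R t"
      unfolding Q eventually_at_right_field by blast
    have "\<exists>t. 0 < t \<and> t < min b \<epsilon> \<and> isCont R t"
      by (rule usc_continuity_point) (use b \<open>\<epsilon> > 0\<close> usc in auto)
    then show ?thesis using b by auto
  qed (simp add: Q)
qed

text \<open>
  This is where flat functions are controlled. If \<open>h = g'\<close> is not bounded by \<open>t\<^sup>K\<close> near \<open>0\<close>, then by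
  o-minimality it exceeds \<open>t\<^sup>K\<close> in absolute value with a constant sign, and integration gives
  \<open>\<bar>g(t)\<bar> \<ge> t\<^sup>K\<^sup>+\<^sup>1 / (K + 1)\<close>, contrary to the bound on \<open>g\<close>.
\<close>

lemma derivative_small:
  fixes g h :: "real \<Rightarrow> real"
  assumes h: "definable_fun (\<lambda>e. h (e 0))"
    and d: "eventually (\<lambda>t. (g has_real_derivative h t) (at t)) (at_right 0)"
    and small: "eventually (\<lambda>t. \<bar>g t\<bar> \<le> C * t ^ (K + 2)) (at_right 0)"
  shows "eventually (\<lambda>t. \<bar>h t\<bar> \<le> t ^ K) (at_right 0)"
proof (rule ccontr)
  assume "\<not> ?thesis"
  moreover have "definable (\<lambda>e. \<bar>h (e 0)\<bar> \<le> e 0 ^ K)" by (intro definable_intros h)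
  ultimately have big: "eventually (\<lambda>t. \<not> \<bar>h t\<bar> \<le> t ^ K) (at_right 0)"
    using definable_germ_dichotomy[of "\<lambda>t. \<bar>h t\<bar> \<le> t ^ K" 0] by blast
  have False if s: "eventually (\<lambda>t. s * h t > 0) (at_right 0)" "\<bar>s\<bar> = 1" for s :: real
  proof -
    from big s(1) d small eventually_at_right_less[of "0::real"]
    have "eventually (\<lambda>t. t ^ K < s * h t \<and> (g has_real_derivative h t) (at t) \<and>
            \<bar>g t\<bar> \<le> C * t ^ (K + 2)) (at_right 0)"
    proof eventually_elim
      case (elim t)
      have "\<bar>s * h t\<bar> = \<bar>h t\<bar>" using s(2) by (simp add: abs_mult)
      then show ?case using elim by linarith
    qed
    then obtain b where b: "b > 0" "\<And>t. 0 < t \<Longrightarrow> t < b \<Longrightarrow> t ^ K < s * h t"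
      "\<And>t. 0 < t \<Longrightarrow> t < b \<Longrightarrow> (g has_real_derivative h t) (at t)"
      "\<And>t. 0 < t \<Longrightarrow> t < b \<Longrightarrow> \<bar>g t\<bar> \<le> C * t ^ (K + 2)"
      unfolding eventually_at_right_field by blast
    define \<phi> where "\<phi> t = s * g t - t ^ Suc K / real (Suc K)" for t
    have \<phi>': "(\<phi> has_real_derivative (s * h t - t ^ K)) (at t)" if "0 < t" "t < b" for t
    proof -
      have "((\<lambda>t. t ^ Suc K / real (Suc K)) has_real_derivative t ^ K) (at t)"
        using DERIV_cdivide[OF DERIV_pow[of "Suc K" t], of "real (Suc K)"] by (simp del: of_nat_Suc)
      from DERIV_diff[OF DERIV_cmult[OF b(3)[OF that], of s] this]
      show ?thesis by (simp only: \<phi>_def[abs_def])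
    qed
    have mono: "\<phi> u \<le> \<phi> t" if "0 < u" "u < t" "t < b" for u t
    proof (rule DERIV_nonneg_imp_nondecreasing[of u t \<phi>])
      show "\<exists>y. (\<phi> has_real_derivative y) (at x) \<and> 0 \<le> y" if "u \<le> x" "x \<le> t" for x
        using \<phi>'[of x] b(2)[of x] that \<open>0 < u\<close> \<open>t < b\<close> by (intro exI conjI) auto
    qed (use that in auto)
    have "(g \<longlongrightarrow> 0) (at_right 0)"
    proof (rule Lim_null_comparison)
      show "eventually (\<lambda>t. norm (g t) \<le> C * t ^ (K + 2)) (at_right 0)" using small by simp
      have "((\<lambda>t. C * t ^ (K + 2)) \<longlongrightarrow> C * 0 ^ (K + 2)) (at_right 0)" by (intro tendsto_intros)
      then show "((\<lambda>t. C * t ^ (K + 2)) \<longlongrightarrow> 0) (at_right 0)" by simp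
    qed
    then have "(\<phi> \<longlongrightarrow> s * 0 - 0 ^ Suc K / real (Suc K)) (at_right 0)"
      unfolding \<phi>_def by (intro tendsto_intros) auto
    then have lim: "(\<phi> \<longlongrightarrow> 0) (at_right 0)" by simp
    have pos: "0 \<le> \<phi> t" if "0 < t" "t < b" for t
    proof (rule tendsto_upperbound[OF lim])
      show "eventually (\<lambda>u. \<phi> u \<le> \<phi> t) (at_right 0)"
        unfolding eventually_at_right_field using that mono by blast
    qed auto
    have le: "1 / real (Suc K) \<le> C * t" if "0 < t" "t < b" for t
    proof -
      have "s * g t \<le> \<bar>g t\<bar>" using s(2) abs_ge_self[of "s * g t"] by (simp add: abs_mult)
      then have "t ^ Suc K / real (Suc K) \<le> C * t ^ (K + 2)"
        using pos[OF that] b(4)[OF that] by (simp add: \<phi>_def)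
      then have "t ^ Suc K * (1 / real (Suc K)) \<le> t ^ Suc K * (C * t)" by (simp add: mult_ac)
      then show ?thesis using that by (subst (asm) mult_le_cancel_left_pos) auto
    qed
    have "((\<lambda>t. C * t) \<longlongrightarrow> C * 0) (at_right (0::real))" by (intro tendsto_intros)
    then have "((\<lambda>t. C * t) \<longlongrightarrow> 0) (at_right (0::real))" by simp
    then have "1 / real (Suc K) \<le> 0"
    proof (rule tendsto_lowerbound)
      show "eventually (\<lambda>t. 1 / real (Suc K) \<le> C * t) (at_right 0)"
        unfolding eventually_at_right_field using le b(1) by blast
    qed auto
    then show False by (simp add: field_simps)
  qed
  note sgn = this
  have "definable (\<lambda>e. 0 < h (e 0))" by (intro definable_intros h)
  from definable_germ_dichotomy[OF this, of 0] show False
  proof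
    assume "eventually (\<lambda>t. 0 < h t) (at_right 0)"
    then show False using sgn[of 1] by simp
  next
    assume "eventually (\<lambda>t. \<not> 0 < h t) (at_right 0)"
    with big eventually_at_right_less[of "0::real"] have "eventually (\<lambda>t. - 1 * h t > 0) (at_right 0)"
    proof eventually_elim
      case (elim t)
      then have "0 \<le> t ^ K" by simp
      with elim show ?case by linarith
    qed
    then show False using sgn[of "-1"] by simp
  qed
qed

definition definable_cfun :: "((nat \<Rightarrow> real) \<Rightarrow> complex) \<Rightarrow> bool" where
  "definable_cfun f \<longleftrightarrow> definable_fun (\<lambda>e. Re (f e)) \<and> definable_fun (\<lambda>e. Im (f e))"

lemma definable_cfun_const: "definable_cfun (\<lambda>e. c)"
  by (simp add: definable_cfun_def definable_fun_const)

lemma definable_cfun_of_real: "definable_fun f \<Longrightarrow> definable_cfun (\<lambda>e. of_real (f e))"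
  by (simp add: definable_cfun_def definable_fun_const)

lemma definable_cfun_Complex: "definable_fun f \<Longrightarrow> definable_fun g \<Longrightarrow> definable_cfun (\<lambda>e. Complex (f e) (g e))"
  by (simp add: definable_cfun_def)

lemma definable_cfun_add: "definable_cfun f \<Longrightarrow> definable_cfun g \<Longrightarrow> definable_cfun (\<lambda>e. f e + g e)"
  by (simp add: definable_cfun_def definable_fun_add)

lemma definable_cfun_mult: "definable_cfun f \<Longrightarrow> definable_cfun g \<Longrightarrow> definable_cfun (\<lambda>e. f e * g e)"
  by (simp add: definable_cfun_def definable_fun_add definable_fun_mult definable_fun_diff)

lemma definable_cfun_power: "definable_cfun f \<Longrightarrow> definable_cfun (\<lambda>e. f e ^ n)"
proof (induction n)
  case 0
  show ?case using definable_cfun_const[of 1] by simp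
next
  case (Suc n)
  then show ?case using definable_cfun_mult[of f "\<lambda>e. f e ^ n"] by simp
qed

lemma definable_cfun_sum: "(\<And>a. a \<in> A \<Longrightarrow> definable_cfun (f a)) \<Longrightarrow> definable_cfun (\<lambda>e. \<Sum>a\<in>A. f a e)"
  by (induction A rule: infinite_finite_induct) (auto simp: definable_cfun_const intro!: definable_cfun_add)

lemma definable_cfun_comp:
  assumes "definable_cfun (\<lambda>e. g (e 0))" "definable_fun f"
  shows "definable_cfun (\<lambda>e. g (f e))"
  using assms definable_fun_comp[of "\<lambda>t. Re (g t)" f] definable_fun_comp[of "\<lambda>t. Im (g t)" f] by (simp add: definable_cfun_def)

text \<open>
  Functions definable in the above sense are total, so a function that matters only near \<open>0\<close> from
  the right is replaced by a total one with the same germ.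
\<close>

definition germ_definable :: "(real \<Rightarrow> complex) \<Rightarrow> bool" where
  "germ_definable f \<longleftrightarrow> (\<exists>g. definable_cfun (\<lambda>e. g (e 0)) \<and> eventually (\<lambda>t. f t = g t) (at_right 0))"

lemma germ_definable_cong:
  assumes "germ_definable f" "eventually (\<lambda>t. f t = g t) (at_right 0)"
  shows "germ_definable g"
proof -
  from assms(1) obtain h where h: "definable_cfun (\<lambda>e. h (e 0))" "eventually (\<lambda>t. f t = h t) (at_right 0)"
    unfolding germ_definable_def by blast
  from h(2) assms(2) have "eventually (\<lambda>t. g t = h t) (at_right 0)" by eventually_elim simp
  with h(1) show ?thesis unfolding germ_definable_def by blast
qed

lemma germ_definable_const: "germ_definable (\<lambda>t. c)"
  unfolding germ_definable_def by (intro exI[of _ "\<lambda>t. c"]) (simp add: definable_cfun_const)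

lemma germ_definable_of_real: "germ_definable of_real"
  unfolding germ_definable_def using definable_cfun_of_real[OF definable_fun_var[of 0]] by (intro exI[of _ of_real]) simp

lemma germ_definable_op2:
  assumes "\<And>f g. definable_cfun f \<Longrightarrow> definable_cfun g \<Longrightarrow> definable_cfun (\<lambda>e. h (f e) (g e))" "germ_definable f" "germ_definable g"
  shows "germ_definable (\<lambda>t. h (f t) (g t))"
proof -
  from assms obtain f' g' where *: "definable_cfun (\<lambda>e. f' (e 0))" "definable_cfun (\<lambda>e. g' (e 0))"
    "\<forall>\<^sub>F t in at_right 0. f t = f' t" "\<forall>\<^sub>F t in at_right 0. g t = g' t" unfolding germ_definable_def by blast
  from *(3,4) have "\<forall>\<^sub>F t in at_right 0. h (f t) (g t) = h (f' t) (g' t)" by eventually_elim simp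
  with assms(1)[OF *(1,2)] show ?thesis
    unfolding germ_definable_def by (intro exI[of _ "\<lambda>t. h (f' t) (g' t)"] conjI)
qed

lemma germ_definable_add: "germ_definable f \<Longrightarrow> germ_definable g \<Longrightarrow> germ_definable (\<lambda>t. f t + g t)"
  by (rule germ_definable_op2[OF definable_cfun_add])

lemma germ_definable_mult: "germ_definable f \<Longrightarrow> germ_definable g \<Longrightarrow> germ_definable (\<lambda>t. f t * g t)"
  by (rule germ_definable_op2[OF definable_cfun_mult])

lemma germ_definable_diff: "germ_definable f \<Longrightarrow> germ_definable g \<Longrightarrow> germ_definable (\<lambda>t. f t - g t)"
  using germ_definable_add[of f "\<lambda>t. (-1) * g t"] germ_definable_mult[OF germ_definable_const[of "-1"], of g] by simp

lemma germ_definable_sum: "(\<And>a. a \<in> A \<Longrightarrow> germ_definable (f a)) \<Longrightarrow> germ_definable (\<lambda>t. \<Sum>a\<in>A. f a t)"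
  by (induction A rule: infinite_finite_induct) (auto simp: germ_definable_const intro!: germ_definable_add)

lemma germ_definable_power: "germ_definable f \<Longrightarrow> germ_definable (\<lambda>t. f t ^ n)"
proof (induction n)
  case 0
  show ?case using germ_definable_const[of 1] by simp
next
  case (Suc n)
  then show ?case using germ_definable_mult[of f "\<lambda>t. f t ^ n"] by simp
qed

lemma germ_definable_poly: "germ_definable (\<lambda>t. poly p (of_real t))"
  unfolding poly_altdef by (intro germ_definable_sum germ_definable_mult germ_definable_const germ_definable_power germ_definable_of_real)

lemma germ_definable_norm_le_dichotomy:
  assumes "germ_definable f" "germ_definable g"
  shows "eventually (\<lambda>t. norm (f t) \<le> norm (g t)) (at_right 0) \<or>
         eventually (\<lambda>t. norm (g t) < norm (f t)) (at_right 0)"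
proof -
  from assms obtain f' g' where *: "definable_cfun (\<lambda>e. f' (e 0))" "definable_cfun (\<lambda>e. g' (e 0))"
    "\<forall>\<^sub>F t in at_right 0. f t = f' t" "\<forall>\<^sub>F t in at_right 0. g t = g' t" unfolding germ_definable_def by blast
  define S where "S z = Re z ^ 2 + Im z ^ 2" for z
  have S: "norm z \<le> norm w \<longleftrightarrow> S z \<le> S w" for z w by (simp add: cmod_def S_def)
  have "definable (\<lambda>e. S (f' (e 0)) \<le> S (g' (e 0)))"
    unfolding S_def using *(1,2) by (intro definable_intros) (auto simp: definable_cfun_def)
  then consider "eventually (\<lambda>t. S (f' t) \<le> S (g' t)) (at_right 0)"
    | "eventually (\<lambda>t. \<not> S (f' t) \<le> S (g' t)) (at_right 0)"
    using definable_germ_dichotomy[of "\<lambda>t. S (f' t) \<le> S (g' t)" 0] by blast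
  then show ?thesis
  proof cases
    case 1
    with *(3,4) have "eventually (\<lambda>t. norm (f t) \<le> norm (g t)) (at_right 0)"
      by eventually_elim (simp add: S)
    then show ?thesis ..
  next
    case 2
    with *(3,4) have "eventually (\<lambda>t. norm (g t) < norm (f t)) (at_right 0)"
      by eventually_elim (metis S not_le)
    then show ?thesis ..
  qed
qed

lemma germ_definable_zero_dichotomy:
  assumes "germ_definable f"
  shows "eventually (\<lambda>t. f t = 0) (at_right 0) \<or> eventually (\<lambda>t. f t \<noteq> 0) (at_right 0)"
  using germ_definable_norm_le_dichotomy[OF assms germ_definable_const[of 0]] by simp

lemma germ_definable_vd:
  assumes f: "germ_definable f" and s: "smooth {0<..<\<epsilon>} f" "\<epsilon> > 0"
  shows "germ_definable (vderiv f)"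
proof -
  from f obtain g where g: "definable_cfun (\<lambda>e. g (e 0))" "\<forall>\<^sub>F t in at_right 0. f t = g t"
    unfolding germ_definable_def by blast
  from g(2) obtain d where d: "d > 0" "\<And>t. 0 < t \<Longrightarrow> t < d \<Longrightarrow> f t = g t"
    unfolding eventually_at_right_field by blast
  define b where "b = min d \<epsilon>"
  have b: "b > 0" using d s by (simp add: b_def)
  define h where "h t = (if 0 < t \<and> t < b then vderiv f t else 0)" for t
  have der: "(g has_vector_derivative h t) (at t)" if "0 < t" "t < b" for t
  proof (rule has_vector_derivative_transform_within_open[of f _ _ "{0<..<b}"])
    show "(f has_vector_derivative h t) (at t)"
      using smooth_vderiv(2)[OF _ s(1), of t] that by (simp add: h_def b_def)
  qed (use that d in \<open>auto simp: b_def\<close>)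
  have "definable_fun (\<lambda>e. c (h (e 0)))" if c: "bounded_linear c" "definable_fun (\<lambda>e. c (g (e 0)))" for c
  proof (rule definable_fun_derivative[OF c(2)])
    show "((\<lambda>t. c (g t)) has_real_derivative c (h t)) (at t)" if "0 < t" "t < b" for t
      using bounded_linear.has_vector_derivative[OF c(1) der[OF that]]
      by (simp add: has_real_derivative_iff_has_vector_derivative)
    show "c (h t) = 0" if "\<not> (0 < t \<and> t < b)" for t
      using that linear_0[OF bounded_linear.linear[OF c(1)]] by (auto simp: h_def)
  qed
  from this[OF bounded_linear_Re] this[OF bounded_linear_Im] g(1) have "definable_cfun (\<lambda>e. h (e 0))"
    by (simp add: definable_cfun_def)
  moreover have "\<forall>\<^sub>F t in at_right 0. vderiv f t = h t"
    unfolding eventually_at_right_field using b by (auto simp: h_def)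
  ultimately show ?thesis unfolding germ_definable_def by blast
qed

lemma derivative_small_complex:
  assumes f: "germ_definable f" and s: "smooth {0<..<\<epsilon>} f" "\<epsilon> > 0"
    and small: "eventually (\<lambda>t. norm (f t) \<le> C * t ^ (K + 2)) (at_right 0)"
  shows "eventually (\<lambda>t. norm (vderiv f t) \<le> 2 * t ^ K) (at_right 0)"
proof -
  from germ_definable_vd[OF f s] obtain h where h: "definable_cfun (\<lambda>e. h (e 0))" "\<forall>\<^sub>F t in at_right 0. vderiv f t = h t"
    unfolding germ_definable_def by blast
  have "eventually (\<lambda>t::real. t \<in> {0<..<\<epsilon>}) (at_right 0)"
    using s(2) by (auto simp: eventually_at_right_field)
  with h(2) have der: "eventually (\<lambda>t. (f has_vector_derivative h t) (at t)) (at_right 0)"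
  proof eventually_elim
    case (elim t)
    then show ?case using smooth_vderiv(2)[OF _ s(1), of t] by simp
  qed
  have part: "eventually (\<lambda>t. \<bar>c (h t)\<bar> \<le> t ^ K) (at_right 0)"
    if c: "bounded_linear c" "\<And>z. \<bar>c z\<bar> \<le> norm z" "definable_fun (\<lambda>e. c (h (e 0)))" for c
  proof (rule derivative_small[OF c(3)])
    show "eventually (\<lambda>t. ((\<lambda>t. c (f t)) has_real_derivative c (h t)) (at t)) (at_right 0)"
      using der
    proof eventually_elim
      case (elim t)
      show ?case using bounded_linear.has_vector_derivative[OF c(1) elim]
        by (simp add: has_real_derivative_iff_has_vector_derivative)
    qed
    show "eventually (\<lambda>t. \<bar>c (f t)\<bar> \<le> C * t ^ (K + 2)) (at_right 0)"
      using small by eventually_elim (meson c(2) order_trans)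
  qed
  have "definable_fun (\<lambda>e. Re (h (e 0)))" "definable_fun (\<lambda>e. Im (h (e 0)))" using h(1) by (simp_all add: definable_cfun_def)
  from part[OF bounded_linear_Re abs_Re_le_cmod this(1)] part[OF bounded_linear_Im abs_Im_le_cmod this(2)]
  show ?thesis using h(2)
  proof eventually_elim
    case (elim t)
    then show ?case using cmod_le[of "h t"] by simp
  qed
qed

text \<open>
  The coefficients and roots on one side of \<open>0\<close> live in this class: it is closed under ring operations
  and differentiation, and the expansion records the limits at \<open>0\<close> of all derivatives.
\<close>

definition regular :: "(real \<Rightarrow> complex) \<Rightarrow> complex fps \<Rightarrow> bool" where
  "regular f F \<longleftrightarrow> germ_definable f \<and> (\<exists>\<epsilon>>0. smooth {0<..<\<epsilon>} f) \<and> expands (at_right 0) f F"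

lemma regular_op2:
  assumes "\<And>I f g. smooth I f \<Longrightarrow> smooth I g \<Longrightarrow> smooth I (\<lambda>t. h (f t) (g t))"
    "\<And>f g. germ_definable f \<Longrightarrow> germ_definable g \<Longrightarrow> germ_definable (\<lambda>t. h (f t) (g t))"
    "\<And>l f g F G. expands l f F \<Longrightarrow> expands l g G \<Longrightarrow> expands l (\<lambda>t. h (f t) (g t)) (H F G)"
    "regular f F" "regular g G"
  shows "regular (\<lambda>t. h (f t) (g t)) (H F G)"
proof -
  from assms(4,5) obtain d e where "d > 0" "smooth {0<..<d} f" "e > 0" "smooth {0<..<e} g"
    unfolding regular_def by blast
  then have "smooth {0<..<min d e} (\<lambda>t. h (f t) (g t))" "min d e > 0"
    by (auto intro!: assms(1) intro: smooth_subset[of _ "{0<..<d}"] smooth_subset[of _ "{0<..<e}"])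
  then show ?thesis using assms(2-5) unfolding regular_def by blast
qed

lemma regular_add: "regular f F \<Longrightarrow> regular g G \<Longrightarrow> regular (\<lambda>t. f t + g t) (F + G)"
  by (rule regular_op2[OF smooth_add germ_definable_add expands_add])

lemma regular_mult: "regular f F \<Longrightarrow> regular g G \<Longrightarrow> regular (\<lambda>t. f t * g t) (F * G)"
  by (rule regular_op2[OF smooth_mult germ_definable_mult expands_mult])

lemma small_at_right: "eventually (\<lambda>t::real. \<bar>t\<bar> \<le> 1) (at_right 0)"
  unfolding eventually_at_right_field by (auto intro!: exI[of _ 1])

lemma regular_poly: "regular (\<lambda>t. poly p (of_real t)) (fps_of_poly p)"
  unfolding regular_def
  by (auto intro!: germ_definable_poly smooth_poly expands_poly small_at_right exI[of _ "1::real"])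

lemma regular_const: "regular (\<lambda>t. c) (fps_const c)"
  using regular_poly[of "[:c:]"] by (simp add: fps_of_poly_const)

text \<open>
  In general the derivative of a remainder need not be small; for definable functions it is, by
  \<open>derivative_small\<close>.
\<close>

lemma regular_deriv:
  assumes "regular f F"
  shows "regular (vderiv f) (fps_deriv F)"
proof -
  from assms obtain \<epsilon> where e: "\<epsilon> > 0" "smooth {0<..<\<epsilon>} f" and f: "germ_definable f" "expands (at_right 0) f F"
    unfolding regular_def by blast
  have "expands (at_right 0) (vderiv f) (fps_deriv F)"
    unfolding expands_def
  proof
    fix K
    obtain p C where p: "fps_X ^ (K + 2) dvd fps_of_poly p - F"
      "approximates (at_right 0) f p C (K + 2)"
      using f(2) unfolding expands_def by blast
    have "eventually (\<lambda>t. norm (f t - poly p (of_real t)) \<le> C * t ^ (K + 2)) (at_right 0)"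
      using p(2) eventually_at_right_less[of "0::real"] by eventually_elim simp
    then have "eventually (\<lambda>t. norm (vderiv (\<lambda>t. f t - poly p (of_real t)) t) \<le> 2 * t ^ K) (at_right 0)"
      using e f by (intro derivative_small_complex[of _ \<epsilon>]) (auto intro!: germ_definable_diff germ_definable_poly smooth_diff smooth_poly)
    moreover have "eventually (\<lambda>t::real. t \<in> {0<..<\<epsilon>}) (at_right 0)"
      using e(1) by (auto simp: eventually_at_right_field)
    ultimately have "approximates (at_right 0) (vderiv f) (pderiv p) 2 K"
      using small_at_right
    proof eventually_elim
      case (elim t)
      have "((\<lambda>t. f t - poly p (of_real t)) has_vector_derivative vderiv f t - poly (pderiv p) (of_real t)) (at t)"
        using elim smooth_vderiv(2)[OF _ e(2), of t]
        by (intro has_vector_derivative_diff has_vector_derivative_real_field poly_DERIV) auto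
      then show ?case using elim by (simp add: vector_derivative_at)
    qed
    moreover have "fps_X ^ K dvd fps_of_poly (pderiv p) - fps_deriv F"
    proof -
      have "fps_of_poly (pderiv p) - fps_deriv F = fps_deriv (fps_of_poly p - F)"
        by (simp add: fps_of_poly_pderiv)
      then show ?thesis using p(1) unfolding fps_X_power_dvd_iff by simp
    qed
    ultimately show "\<exists>p C. fps_X ^ K dvd fps_of_poly p - fps_deriv F \<and>
      approximates (at_right 0) (vderiv f) p C K" by blast
  qed
  moreover have "germ_definable (vderiv f)" by (rule germ_definable_vd[OF f(1) e(2,1)])
  moreover have "smooth {0<..<\<epsilon>} (vderiv f)" by (rule smooth_vderiv(1)[OF _ e(2)]) simp
  ultimately show ?thesis unfolding regular_def using e(1) by (intro conjI exI[of _ \<epsilon>])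
qed

end

section \<open>A smooth definable root on one side\<close>

lemma poly_sum_upto: "degree p \<le> n \<Longrightarrow> poly p x = (\<Sum>j\<le>n. coeff p j * x ^ j)"
  for p :: "'a::comm_semiring_1 poly"
  unfolding poly_altdef by (intro sum.mono_neutral_left) (auto simp: coeff_eq_0)

lemma poly_pderiv_sum_upto:
  fixes p :: "'a::idom poly"
  assumes "degree p \<le> n"
  shows "poly (pderiv p) x = (\<Sum>j\<le>n. of_nat j * coeff p j * x ^ (j - 1))"
proof -
  have "p = (\<Sum>j\<le>n. monom (coeff p j) j)"
    using poly_as_sum_of_monoms'[OF assms] by simp
  then have "pderiv p = (\<Sum>j\<le>n. monom (of_nat j * coeff p j) (j - 1))"
    using higher_pderiv_sum[of 1 "\<lambda>j. monom (coeff p j) j" "{..n}"] by (simp add: pderiv_monom)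
  then show ?thesis by (simp add: poly_sum poly_monom)
qed

lemma monic_root_bound:
  fixes z :: complex
  assumes "degree p = n" "lead_coeff p = 1" "poly p z = 0" "n \<ge> 1"
  shows "norm z \<le> 1 + (\<Sum>j<n. norm (coeff p j))"
proof (cases "norm z \<le> 1")
  case True
  then show ?thesis using sum_nonneg[of "{..<n}" "\<lambda>j. norm (coeff p j)"] by simp
next
  case False
  then have z: "norm z > 1" by simp
  have "0 = (\<Sum>j\<le>n. coeff p j * z ^ j)" using assms poly_sum_upto[of p n z] by simp
  also have "\<dots> = (\<Sum>j<n. coeff p j * z ^ j) + z ^ n"
    using assms by (simp add: lessThan_Suc_atMost[symmetric])
  finally have "z ^ n = - (\<Sum>j<n. coeff p j * z ^ j)" by (simp add: eq_neg_iff_add_eq_0 add.commute)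
  then have "norm z ^ n = norm (\<Sum>j<n. coeff p j * z ^ j)" by (metis norm_minus_cancel norm_power)
  also have "\<dots> \<le> (\<Sum>j<n. norm (coeff p j) * norm z ^ (n - 1))"
  proof (rule sum_norm_le)
    fix j assume "j \<in> {..<n}"
    then have "norm z ^ j \<le> norm z ^ (n - 1)" using z by (intro power_increasing) auto
    then show "norm (coeff p j * z ^ j) \<le> norm (coeff p j) * norm z ^ (n - 1)"
      by (simp add: norm_mult norm_power mult_left_mono)
  qed
  also have "\<dots> = norm z ^ (n - 1) * (\<Sum>j<n. norm (coeff p j))"
    by (simp add: sum_distrib_right mult.commute sum_distrib_left)
  finally have "norm z ^ (n - 1) * norm z \<le> norm z ^ (n - 1) * (\<Sum>j<n. norm (coeff p j))"
    using assms(4) by (cases n) (simp_all add: mult.commute)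
  moreover have "norm z ^ (n - 1) > 0" using z by (intro zero_less_power) linarith
  ultimately have "norm z \<le> (\<Sum>j<n. norm (coeff p j))" by (simp only: mult_le_cancel_left_pos)
  then show ?thesis by simp
qed

text \<open>
  The roots stay bounded because the coefficients do, so a subsequence converges, and the set of all
  \<open>(t, z)\<close> with \<open>q t\<close> vanishing at \<open>z\<close> is closed where the coefficients are continuous.
\<close>

lemma roots_limit:
  fixes q :: "real \<Rightarrow> complex poly"
  assumes monic: "\<And>t. degree (q t) = n" "\<And>t. lead_coeff (q t) = 1" "n \<ge> 1"
    and cont: "\<And>j. isCont (\<lambda>t. coeff (q t) j) t"
    and s: "s \<longlonglongrightarrow> t" and z: "\<And>k. poly (q (s k)) (z k) = 0"
  shows "\<exists>w r. strict_mono (r :: nat \<Rightarrow> nat) \<and> (z \<circ> r) \<longlonglongrightarrow> w \<and> poly (q t) w = 0"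
proof -
  have co: "(\<lambda>k. coeff (q (s k)) j) \<longlonglongrightarrow> coeff (q t) j" for j
    using isCont_tendsto_compose[OF cont s] .
  have "(\<lambda>k. 1 + (\<Sum>j<n. norm (coeff (q (s k)) j))) \<longlonglongrightarrow> 1 + (\<Sum>j<n. norm (coeff (q t) j))"
    by (intro tendsto_intros co)
  then have "Bseq (\<lambda>k. 1 + (\<Sum>j<n. norm (coeff (q (s k)) j)))"
    by (intro convergent_imp_Bseq) (auto simp: convergent_def)
  then obtain B where B: "\<And>k. norm (1 + (\<Sum>j<n. norm (coeff (q (s k)) j))) \<le> B"
    unfolding Bseq_def by blast
  have zB: "norm (z k) \<le> B" for k
  proof -
    have "norm (z k) \<le> 1 + (\<Sum>j<n. norm (coeff (q (s k)) j))"
      by (rule monic_root_bound[OF monic(1,2) z monic(3)])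
    then show ?thesis using B[of k] by simp
  qed
  then have "bounded (range z)" by (auto simp: bounded_iff)
  then obtain w r where wr: "strict_mono (r :: nat \<Rightarrow> nat)" "(z \<circ> r) \<longlonglongrightarrow> w"
    using bounded_imp_convergent_subsequence by blast
  have "(\<lambda>k. \<Sum>j\<le>n. coeff (q (s (r k))) j * (z \<circ> r) k ^ j) \<longlonglongrightarrow> (\<Sum>j\<le>n. coeff (q t) j * w ^ j)"
    using LIMSEQ_subseq_LIMSEQ[OF co wr(1)] by (intro tendsto_intros wr(2)) (simp add: o_def)
  moreover have "(\<Sum>j\<le>n. coeff (q (s (r k))) j * (z \<circ> r) k ^ j) = 0" for k
    using z[of "r k"] monic(1)[of "s (r k)"] poly_sum_upto[of "q (s (r k))" n "z (r k)"] by simp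
  ultimately have "(\<lambda>k::nat. 0) \<longlonglongrightarrow> (\<Sum>j\<le>n. coeff (q t) j * w ^ j)" by simp
  then have "(\<Sum>j\<le>n. coeff (q t) j * w ^ j) = 0" by (metis LIMSEQ_unique tendsto_const)
  then have "poly (q t) w = 0" using monic(1)[of t] poly_sum_upto[of "q t" n w] by simp
  then show ?thesis using wr by blast
qed

lemma eventually_nhds_seqI:
  fixes t :: real
  assumes "\<And>s. s \<longlonglongrightarrow> t \<Longrightarrow> (\<And>k. \<not> P (s k)) \<Longrightarrow> False"
  shows "eventually P (nhds t)"
proof (rule ccontr)
  assume "\<not> ?thesis"
  then have "\<exists>s. \<bar>s - t\<bar> < inverse (real (Suc k)) \<and> \<not> P s" for k
    unfolding eventually_nhds_metric dist_real_def
    by (metis inverse_positive_iff_positive of_nat_0_less_iff zero_less_Suc)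
  then obtain s where s: "\<And>k. \<bar>s k - t\<bar> < inverse (real (Suc k))" "\<And>k. \<not> P (s k)" by metis
  have "(\<lambda>k. s k - t) \<longlonglongrightarrow> 0"
    by (rule Lim_null_comparison[OF _ LIMSEQ_inverse_real_of_nat])
       (use s(1) in \<open>auto intro!: always_eventually less_imp_le\<close>)
  then have "s \<longlonglongrightarrow> t" by (simp add: LIM_zero_iff)
  then show False using assms s(2) by blast
qed

lemma smooth_uniform:
  assumes "finite J" "\<And>j. j \<in> J \<Longrightarrow> \<exists>\<epsilon>>0. smooth {0<..<\<epsilon>} (f j)"
  shows "\<exists>\<epsilon>>0. \<forall>j\<in>J. smooth {0<..<\<epsilon>} (f j)"
  using assms
proof (induction J rule: finite_induct)
  case empty
  show ?case by (intro exI[of _ 1]) auto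
next
  case (insert j J)
  then obtain d e where "d > 0" "\<forall>j\<in>J. smooth {0<..<d} (f j)" "e > 0" "smooth {0<..<e} (f j)" by blast
  then show ?case
    by (intro exI[of _ "min d e"])
       (auto intro: smooth_subset[of _ "{0<..<d}"] smooth_subset[of _ "{0<..<e}"])
qed

context o_minimal_structure
begin

lemma definable_czero:
  assumes "definable_cfun f"
  shows "definable (\<lambda>e. f e = 0)"
  using assms unfolding complex_eq_iff definable_cfun_def by (intro definable_and definable_eq) (auto intro: definable_fun_const)

text \<open>
  The root with the largest real part and, among these, the largest imaginary part is singled out
  by a first-order formula, so it is a definable function of \<open>t\<close>.
\<close>

lemma max_root_definable:
  fixes c :: "nat \<Rightarrow> real \<Rightarrow> complex"
  assumes c: "\<And>j. definable_cfun (\<lambda>e. c j (e 0))"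
    and q: "\<And>t x. poly (q t) x = (\<Sum>j\<le>n. c j t * x ^ j)"
    and deg: "\<And>t. degree (q t) \<ge> 1"
  obtains R I where "definable_fun (\<lambda>e. R (e 0))" "definable_fun (\<lambda>e. I (e 0))"
    "\<And>t. poly (q t) (Complex (R t) (I t)) = 0"
    "\<And>t z. poly (q t) z = 0 \<Longrightarrow> Re z < R t \<or> Re z = R t \<and> Im z \<le> I t"
proof -
  define L where "L t x y \<longleftrightarrow> poly (q t) (Complex x y) = 0 \<and>
     (\<forall>x'. \<forall>y'. poly (q t) (Complex x' y') = 0 \<longrightarrow> x' < x \<or> x' = x \<and> y' \<le> y)" for t x y
  have dq: "definable (\<lambda>e. poly (q (e 0)) (Complex (e i) (e j)) = 0)" for i j
    unfolding q by (intro definable_czero definable_cfun_sum definable_cfun_mult definable_cfun_power c definable_cfun_Complex definable_fun_var)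
  have dL: "definable (\<lambda>e. L (e 0) (e 1) (e 2))"
    unfolding L_def
    by (rule definable_and, rule dq, rule definable_all[where k = 3], rule definable_all[where k = 4],
        rule definable_imp, rule dq, intro definable_intros) auto
  have ex: "\<exists>x y. L t x y" for t
  proof -
    define Z where "Z = {z. poly (q t) z = 0}"
    have "q t \<noteq> 0" using deg[of t] by auto
    then have fin: "finite Z" unfolding Z_def by (rule poly_roots_finite)
    have "degree (q t) > 0" using deg[of t] by simp
    then obtain z0 where "z0 \<in> Z" unfolding Z_def using alg_closed_imp_poly_has_root by blast
    define x where "x = Max (Re ` Z)"
    have "x \<in> Re ` Z" unfolding x_def using fin \<open>z0 \<in> Z\<close> by (intro Max_in) auto
    then obtain z1 where z1: "z1 \<in> Z" "Re z1 = x" by blast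
    define Y where "Y = Im ` {z \<in> Z. Re z = x}"
    have fY: "finite Y" "Y \<noteq> {}" unfolding Y_def using fin z1 by auto
    define y where "y = Max Y"
    have "y \<in> Y" unfolding y_def using fY by (rule Max_in)
    then have "Complex x y \<in> Z" by (auto simp: Y_def complex_eq_iff)
    moreover have "x' < x \<or> x' = x \<and> y' \<le> y" if "poly (q t) (Complex x' y') = 0" for x' y'
    proof -
      have z: "Complex x' y' \<in> Z" using that by (simp add: Z_def)
      then have "x' \<le> x" unfolding x_def using fin by (metis Max_ge complex.sel(1) finite_imageI imageI)
      moreover have "y' \<le> y" if "x' = x"
        unfolding y_def using fY z that by (intro Max_ge) (auto simp: Y_def intro!: image_eqI[of _ _ "Complex x' y'"])
      ultimately show ?thesis by auto
    qed
    ultimately have "L t x y" by (simp add: L_def Z_def)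
    then show ?thesis by blast
  qed
  then obtain R I where RI: "\<And>t. L t (R t) (I t)" by metis
  have uniq: "x = R t \<and> y = I t" if "L t x y" for t x y
  proof -
    from RI[of t] that have "R t < x \<or> R t = x \<and> I t \<le> y" "x < R t \<or> x = R t \<and> y \<le> I t"
      unfolding L_def by blast+
    then show ?thesis by auto
  qed
  show ?thesis
  proof (rule that[of R I])
    show "definable_fun (\<lambda>e. R (e 0))"
    proof (rule definable_fun_graph)
      show "definable (\<lambda>e. \<exists>y. L (e 0) (e 1) y)" by (rule definable_ex[where k = 2], rule dL) simp
      show "(\<exists>y. L t x y) \<longleftrightarrow> x = R t" for t x using RI uniq by blast
    qed
    show "definable_fun (\<lambda>e. I (e 0))"
    proof (rule definable_fun_graph)
      have "definable (\<lambda>e. L (e 0) (e 2) (e 1))"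
        using definable_rename[OF dL, of "\<lambda>i. if i = 1 then 2 else if i = 2 then 1 else i"] by simp
      then show "definable (\<lambda>e. \<exists>x. L (e 0) x (e 1))" by (rule definable_ex[where k = 2]) simp
      show "(\<exists>x. L t x y) \<longleftrightarrow> y = I t" for t y using RI uniq by blast
    qed
    show "poly (q t) (Complex (R t) (I t)) = 0" for t using RI[of t] by (simp add: L_def)
    show "Re z < R t \<or> Re z = R t \<and> Im z \<le> I t" if "poly (q t) z = 0" for t z
    proof -
      have "poly (q t) (Complex (Re z) (Im z)) = 0" using that by simp
      then show ?thesis using RI[of t] unfolding L_def by blast
    qed
  qed
qed

text \<open>
  Take the lexicographically largest root \<open>l\<close>. Its real part is upper semicontinuous because limits of
  roots are roots; hence it is continuous near \<open>0\<close>, and then the same argument applies to its imaginary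
  part. By o-minimality the multiplicity of the root \<open>l t\<close> is constant for small \<open>t\<close>, say \<open>k\<close>, so
  \<open>l\<close> is a continuous simple root of the \<open>(k - 1)\<close>-st derivative of the polynomial, hence smooth.
\<close>

lemma smooth_root_exists:
  fixes p :: "real \<Rightarrow> complex poly"
  assumes monic: "\<And>t. degree (p t) = n" "\<And>t. lead_coeff (p t) = 1" "n \<ge> 1"
    and germ_definable: "\<And>j. germ_definable (\<lambda>t. coeff (p t) j)"
    and sm: "\<And>j. \<exists>\<epsilon>>0. smooth {0<..<\<epsilon>} (\<lambda>t. coeff (p t) j)"
  obtains l \<epsilon> where "\<epsilon> > 0" "germ_definable l" "smooth {0<..<\<epsilon>} l" "\<And>t. 0 < t \<Longrightarrow> t < \<epsilon> \<Longrightarrow> poly (p t) (l t) = 0"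
proof -
  have "\<forall>j. \<exists>g. definable_cfun (\<lambda>e. g (e 0)) \<and> eventually (\<lambda>t. coeff (p t) j = g t) (at_right 0)"
    using germ_definable unfolding germ_definable_def by blast
  then obtain C where C: "\<And>j. definable_cfun (\<lambda>e. C j (e 0))"
    "\<And>j. eventually (\<lambda>t. coeff (p t) j = C j t) (at_right 0)" by metis
  define c where "c j = (if j < n then C j else if j = n then (\<lambda>t. 1) else (\<lambda>t. 0))" for j
  have cc: "definable_cfun (\<lambda>e. c j (e 0))" for j by (simp add: c_def C definable_cfun_const)
  define q where "q t = (\<Sum>j\<le>n. monom (c j t) j)" for t
  have cq: "coeff (q t) j = c j t" for t j
    by (auto simp: q_def coeff_sum c_def)
  have dq: "degree (q t) = n" for t
    by (intro antisym degree_le le_degree) (auto simp: cq c_def)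
  have lq: "lead_coeff (q t) = 1" for t by (simp add: dq cq c_def)
  have pq: "poly (q t) x = (\<Sum>j\<le>n. c j t * x ^ j)" for t x
    using poly_sum_upto[of "q t" n x] by (simp add: dq cq)
  have "eventually (\<lambda>t. \<forall>j\<in>{..<n}. coeff (p t) j = C j t) (at_right 0)"
    by (intro eventually_ball_finite) (auto simp: C)
  then have "eventually (\<lambda>t. p t = q t) (at_right 0)"
  proof eventually_elim
    case (elim t)
    show ?case
    proof (rule poly_eqI)
      fix j
      show "coeff (p t) j = coeff (q t) j"
        using elim monic(1)[of t] monic(2)[of t] by (auto simp: cq c_def coeff_eq_0)
    qed
  qed
  then obtain e0 where e0: "e0 > 0" "\<And>t. 0 < t \<Longrightarrow> t < e0 \<Longrightarrow> p t = q t"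
    unfolding eventually_at_right_field by blast
  obtain e1 where e1: "e1 > 0" "\<And>j. j \<le> n \<Longrightarrow> smooth {0<..<e1} (\<lambda>t. coeff (p t) j)"
    using smooth_uniform[of "{..n}" "\<lambda>j t. coeff (p t) j"] sm by auto
  define e where "e = min e0 e1"
  have e: "e > 0" using e0 e1 by (simp add: e_def)
  have smc: "smooth {0<..<e} (\<lambda>t. coeff (q t) j)" for j
  proof (cases "j \<le> n")
    case True
    show ?thesis
    proof (rule smooth_cong)
      show "smooth {0<..<e} (\<lambda>t. coeff (p t) j)"
        using e1(2)[OF True] by (rule smooth_subset[rotated]) (auto simp: e_def)
    qed (auto simp: e_def e0)
  next
    case False
    then show ?thesis by (simp add: cq c_def smooth_const)
  qed
  have contq: "isCont (\<lambda>t. coeff (q t) j) t" if "0 < t" "t < e" for j t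
    using smooth_cont[OF _ smc] that by simp
  obtain R I where R: "definable_fun (\<lambda>e. R (e 0))" and I: "definable_fun (\<lambda>e. I (e 0))"
    and root: "\<And>t. poly (q t) (Complex (R t) (I t)) = 0"
    and max: "\<And>t z. poly (q t) z = 0 \<Longrightarrow> Re z < R t \<or> Re z = R t \<and> Im z \<le> I t"
    using max_root_definable[of c q n, OF cc pq] dq monic(3) by (metis order_refl)
  define l where "l t = Complex (R t) (I t)" for t
  have "eventually (\<lambda>t. isCont R t) (at_right 0)"
  proof (rule definable_usc_isCont_germ[OF R e])
    fix t r assume t: "0 < t" "t < e" "R t < r"
    show "eventually (\<lambda>s. R s < r) (nhds t)"
    proof (rule eventually_nhds_seqI)
      fix s assume s: "s \<longlonglongrightarrow> t" "\<And>k. \<not> R (s k) < r"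
      from roots_limit[OF dq lq monic(3) contq[OF t(1,2)] s(1), of "\<lambda>k. l (s k)"]
      obtain w m where w: "strict_mono (m :: nat \<Rightarrow> nat)" "((\<lambda>k. l (s k)) \<circ> m) \<longlonglongrightarrow> w" "poly (q t) w = 0"
        using root by (auto simp: l_def)
      have "r \<le> Re w"
        by (rule LIMSEQ_le_const[OF tendsto_Re[OF w(2)]]) (use s(2) in \<open>auto simp: l_def not_less\<close>)
      then show False using max[OF w(3)] t(3) by auto
    qed
  qed
  then obtain e2 where e2: "e2 > 0" "\<And>t. 0 < t \<Longrightarrow> t < e2 \<Longrightarrow> isCont R t"
    unfolding eventually_at_right_field by blast
  have "min e e2 > 0" using e e2 by simp
  \<comment> \<open>Where R is continuous, a limit of the chosen roots has real part R t.\<close>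
  have "eventually (\<lambda>t. isCont I t) (at_right 0)"
  proof (rule definable_usc_isCont_germ[OF I \<open>min e e2 > 0\<close>])
    fix t r assume t: "0 < t" "t < min e e2" "I t < r"
    then have t': "t < e" "t < e2" by auto
    show "eventually (\<lambda>s. I s < r) (nhds t)"
    proof (rule eventually_nhds_seqI)
      fix s assume s: "s \<longlonglongrightarrow> t" "\<And>k. \<not> I (s k) < r"
      from roots_limit[OF dq lq monic(3) contq[OF t(1) t'(1)] s(1), of "\<lambda>k. l (s k)"]
      obtain w m where w: "strict_mono (m :: nat \<Rightarrow> nat)" "((\<lambda>k. l (s k)) \<circ> m) \<longlonglongrightarrow> w" "poly (q t) w = 0"
        using root by (auto simp: l_def)
      have "r \<le> Im w"
        by (rule LIMSEQ_le_const[OF tendsto_Im[OF w(2)]]) (use s(2) in \<open>auto simp: l_def not_less\<close>)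
      moreover have "(\<lambda>k. R (s (m k))) \<longlonglongrightarrow> Re w"
        using tendsto_Re[OF w(2)] by (simp add: l_def o_def)
      moreover have "(\<lambda>k. R (s (m k))) \<longlonglongrightarrow> R t"
        using isCont_tendsto_compose[OF e2(2)[OF t(1) t'(2)] LIMSEQ_subseq_LIMSEQ[OF s(1) w(1)]]
        by (simp add: o_def)
      ultimately have "r \<le> Im w" "Re w = R t" using LIMSEQ_unique by blast+
      then show False using max[OF w(3)] t(3) by auto
    qed
  qed
  then obtain e3 where e3: "e3 > 0" "\<And>t. 0 < t \<Longrightarrow> t < e3 \<Longrightarrow> isCont I t"
    unfolding eventually_at_right_field by blast
  have cl: "definable_cfun (\<lambda>e. l (e 0))" using R I by (simp add: l_def definable_cfun_def)
  then have gl: "germ_definable l" unfolding germ_definable_def by (intro exI[of _ l]) simp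
  \<comment> \<open>V k vanishes along the root for k below the multiplicity; the germ dichotomy makes the
    multiplicity constant.\<close>
  define V where "V k t = poly ((pderiv ^^ k) (q t)) (l t)" for k t
  have dk: "degree ((pderiv ^^ k) (q t)) \<le> n" for k t by (simp add: degree_higher_pderiv dq)
  have "germ_definable (\<lambda>t. c j t)" for j unfolding germ_definable_def using cc by (intro exI[of _ "c j"]) simp
  then have gV: "germ_definable (V k)" for k
    unfolding V_def[abs_def] poly_sum_upto[OF dk] coeff_higher_pderiv cq
    by (intro germ_definable_sum germ_definable_mult germ_definable_const germ_definable_power gl)
  have "V n t = fact n" for t
  proof -
    have "degree ((pderiv ^^ n) (q t)) = 0" by (simp add: degree_higher_pderiv dq)
    then have "V n t = coeff ((pderiv ^^ n) (q t)) 0"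
      unfolding V_def by (metis degree_eq_zeroE poly_pCons poly_0 mult_zero_right add_0_right coeff_pCons_0)
    then show ?thesis
      by (simp add: coeff_higher_pderiv cq c_def pochhammer_fact)
  qed
  then have Vn: "\<not> eventually (\<lambda>t. V n t = 0) (at_right 0)" by simp
  define k where "k = (LEAST k. \<not> eventually (\<lambda>t. V k t = 0) (at_right 0))"
  have k: "\<not> eventually (\<lambda>t. V k t = 0) (at_right 0)"
    unfolding k_def using Vn by (rule LeastI)
  have "V 0 t = 0" for t by (simp add: V_def l_def root)
  then have "eventually (\<lambda>t. V 0 t = 0) (at_right 0)" by (intro always_eventually allI)
  with k have "k \<noteq> 0" by metis
  then obtain k' where k': "k = Suc k'" by (cases k) auto
  have Vk': "eventually (\<lambda>t. V k' t = 0) (at_right 0)"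
    using not_less_Least[of k' "\<lambda>k. \<not> eventually (\<lambda>t. V k t = 0) (at_right 0)"] k' unfolding k_def by auto
  have "eventually (\<lambda>t. V k t \<noteq> 0) (at_right 0)" using germ_definable_zero_dichotomy[OF gV[of k]] k by blast
  from eventually_conj[OF Vk' this]
  obtain e4 where e4: "e4 > 0" "\<And>t. 0 < t \<Longrightarrow> t < e4 \<Longrightarrow> V k' t = 0 \<and> V k t \<noteq> 0"
    unfolding eventually_at_right_field by blast
  define d where "d = min e (min e2 (min e3 e4))"
  have d: "d > 0" using e e2 e3 e4 by (simp add: d_def)
  have "smooth {0<..<d} l"
  proof (rule smooth_simple_root[of _ n "\<lambda>j t. coeff ((pderiv ^^ k') (q t)) j"])
    show "smooth {0<..<d} (\<lambda>t. coeff ((pderiv ^^ k') (q t)) j)" for j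
      unfolding coeff_higher_pderiv
      by (intro smooth_mult smooth_const smooth_subset[OF _ smc]) (auto simp: d_def)
    show "isCont l t" if "t \<in> {0<..<d}" for t
    proof -
      have "isCont R t" "isCont I t" using that e2 e3 by (auto simp: d_def)
      then have "isCont (\<lambda>t. of_real (R t) + \<i> * of_real (I t)) t" by (intro continuous_intros)
      then show ?thesis by (simp add: l_def[abs_def] Complex_eq)
    qed
    show "(\<Sum>j\<le>n. coeff ((pderiv ^^ k') (q t)) j * l t ^ j) = 0" if "t \<in> {0<..<d}" for t
      using e4(2)[of t] that by (simp add: V_def poly_sum_upto[OF dk] d_def)
    show "(\<Sum>j\<le>n. of_nat j * coeff ((pderiv ^^ k') (q t)) j * l t ^ (j - 1)) \<noteq> 0" if "t \<in> {0<..<d}" for t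
      using e4(2)[of t] that by (simp add: V_def k' poly_pderiv_sum_upto[OF dk] d_def)
  qed auto
  moreover have "poly (p t) (l t) = 0" if "0 < t" "t < d" for t
    using e0(2)[of t] that root[of t] by (simp add: d_def e_def l_def)
  ultimately show ?thesis using that d gl by blast
qed

end

section \<open>Splitting into roots with prescribed expansions\<close>

lemma small_poly:
  assumes "fps_X ^ m dvd fps_of_poly r"
  obtains B where "B \<ge> 0" "\<And>t. \<bar>t\<bar> \<le> 1 \<Longrightarrow> norm (poly r (of_real t :: complex)) \<le> B * \<bar>t\<bar> ^ m"
proof -
  have "r = monom 1 m * poly_shift m r"
    using assms unfolding fps_X_power_dvd_iff
    by (intro poly_eqI) (auto simp: coeff_monom_mult coeff_poly_shift)
  then have r: "poly r x = x ^ m * poly (poly_shift m r) x" for x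
    by (metis mult_1 poly_monom poly_mult)
  obtain B where B: "B \<ge> 0" "\<And>t. \<bar>t\<bar> \<le> 1 \<Longrightarrow> norm (poly (poly_shift m r) (of_real t :: complex)) \<le> B"
    using poly_bounded_unit[of "poly_shift m r"] by blast
  have "norm (poly r (of_real t :: complex)) \<le> B * \<bar>t\<bar> ^ m" if "\<bar>t\<bar> \<le> 1" for t
    using mult_right_mono[OF B(2)[OF that], of "\<bar>t\<bar> ^ m"]
    by (simp add: r norm_mult norm_power mult.commute)
  with B(1) show ?thesis using that by blast
qed

lemma expands_remainder:
  assumes "expands l f F" "fps_X ^ K dvd fps_of_poly p - F"
  obtains C where "C \<ge> 0" "approximates l f p C K"
proof -
  obtain q C where q: "fps_X ^ K dvd fps_of_poly q - F" "C \<ge> 0"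
    "approximates l f q C K"
    using expandsD[OF assms(1)] .
  have "fps_X ^ K dvd fps_of_poly (q - p)"
    using dvd_diff[OF q(1) assms(2)] by (simp add: fps_of_poly_diff)
  then obtain B where B: "B \<ge> 0" "\<And>t. \<bar>t\<bar> \<le> 1 \<Longrightarrow> norm (poly (q - p) (of_real t :: complex)) \<le> B * \<bar>t\<bar> ^ K"
    using small_poly by blast
  have "approximates l f p (C + B) K"
    using q(3)
  proof eventually_elim
    case (elim t)
    have "f t - poly p (of_real t) = (f t - poly q (of_real t)) + poly (q - p) (of_real t)" by simp
    also have "norm \<dots> \<le> C * \<bar>t\<bar> ^ K + B * \<bar>t\<bar> ^ K"
      using elim B(2)[of t] by (intro order.trans[OF norm_triangle_ineq] add_mono) auto
    finally show ?case using elim by (simp add: distrib_right)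
  qed
  then show ?thesis using that[of "C + B"] B(1) q(2) by simp
qed

lemma prod_cong_dvd:
  fixes c :: "'a::comm_ring_1"
  assumes "\<And>i. i \<in> S \<Longrightarrow> c dvd f i - g i"
  shows "c dvd (\<Prod>i\<in>S. f i) - (\<Prod>i\<in>S. g i)"
  using assms
proof (induction S rule: infinite_finite_induct)
  case (insert x S)
  have "(\<Prod>i\<in>insert x S. f i) - (\<Prod>i\<in>insert x S. g i) =
      (f x - g x) * (\<Prod>i\<in>S. f i) + g x * ((\<Prod>i\<in>S. f i) - (\<Prod>i\<in>S. g i))"
    using insert.hyps by (simp add: algebra_simps)
  also have "c dvd \<dots>" using insert by (intro dvd_add dvd_mult dvd_mult2) auto
  finally show ?case .
qed auto

lemma coeff_hom_fps_of_poly: "coeff_hom (fps_of_poly :: complex poly \<Rightarrow> complex fps)"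
  by standard (simp_all add: fps_of_poly_add fps_of_poly_mult)

lemma coeff_hom_eval: "coeff_hom (\<lambda>p :: complex poly. poly p x)"
  by standard simp_all

lemma degree_prod_linear:
  "finite S \<Longrightarrow> degree (\<Prod>i\<in>S. [:- L i, 1 :: 'a::idom:]) = card S"
  by (subst degree_prod_eq_sum_degree) auto

text \<open>
  The polynomial with the approximate roots \<open>\<pi> i\<close> has coefficients within \<open>O(t\<^sup>n\<^sup>K)\<close> of those of
  \<open>p\<close>, where \<open>n\<close> is the degree. At the bounded root \<open>l t\<close> of \<open>p t\<close> its value, the product of the
  distances to the \<open>\<pi> i\<close>, is therefore \<open>O(t\<^sup>n\<^sup>K)\<close>, and one of the \<open>n\<close> factors must be \<open>O(t\<^sup>K)\<close>.
\<close>

lemma root_near_expansion: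
  fixes p :: "real \<Rightarrow> complex poly"
  assumes monic: "\<And>t. degree (p t) = card S" "\<And>t. lead_coeff (p t) = 1" "card S \<ge> 1"
    and P: "\<And>j. expands (at_right 0) (\<lambda>t. coeff (p t) j) (coeff (\<Prod>i\<in>S. [:- L i, 1:]) j)"
    and root: "eventually (\<lambda>t. poly (p t) (l t) = 0) (at_right 0)"
    and \<pi>: "\<And>i. i \<in> S \<Longrightarrow> fps_X ^ (card S * K) dvd fps_of_poly (\<pi> i) - L i"
  shows "\<exists>C\<ge>0. eventually (\<lambda>t. \<exists>i\<in>S. norm (l t - poly (\<pi> i) (of_real t)) \<le> C * t ^ K) (at_right 0)"
proof -
  define n where "n = card S"
  have fin: "finite S" using monic(3) by (metis card.infinite not_one_le_zero)
  interpret f: coeff_hom "fps_of_poly :: complex poly \<Rightarrow> complex fps" by (rule coeff_hom_fps_of_poly)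
  define D where "D = (\<Prod>i\<in>S. [:- \<pi> i, 1:])"
  have degD: "degree D = n" unfolding D_def n_def by (rule degree_prod_linear[OF fin])
  have dv: "fps_X ^ (n * K) dvd fps_of_poly (coeff D j) - coeff (\<Prod>i\<in>S. [:- L i, 1:]) j" for j
  proof -
    have "[:fps_X ^ (n * K):] dvd (\<Prod>i\<in>S. [:- fps_of_poly (\<pi> i), 1:]) - (\<Prod>i\<in>S. [:- L i, 1:])"
    proof (rule prod_cong_dvd)
      fix i assume "i \<in> S"
      then have "fps_X ^ (n * K) dvd L i - fps_of_poly (\<pi> i)"
        using \<pi>[of i] by (simp add: n_def dvd_diff_commute)
      then show "[:fps_X ^ (n * K):] dvd [:- fps_of_poly (\<pi> i), 1:] - [:- L i, 1:]"
        by (simp add: const_poly_dvd_const_poly_iff)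
    qed
    then have "fps_X ^ (n * K) dvd coeff ((\<Prod>i\<in>S. [:- fps_of_poly (\<pi> i), 1:]) - (\<Prod>i\<in>S. [:- L i, 1:])) j"
      unfolding const_poly_dvd_iff by blast
    moreover have "coeff (\<Prod>i\<in>S. [:- fps_of_poly (\<pi> i), 1:]) j = fps_of_poly (coeff D j)"
      unfolding D_def f.map_poly_prod_linear[symmetric] by (simp add: coeff_map_poly)
    ultimately show ?thesis by simp
  qed
  have "\<forall>j. \<exists>C. C \<ge> 0 \<and> approximates (at_right 0) (\<lambda>t. coeff (p t) j) (coeff D j) C (n * K)"
    by (rule allI, rule expands_remainder[OF P dv]) (rule exI, rule conjI)
  from choice[OF this] obtain C where C: "\<And>j. C j \<ge> 0" "\<And>j. approximates (at_right 0) (\<lambda>t. coeff (p t) j) (coeff D j) (C j) (n * K)"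
    by blast
  have "\<forall>j. \<exists>B. B \<ge> 0 \<and> eventually (\<lambda>t. norm (coeff (p t) j) \<le> B) (at_right 0)"
    by (rule allI, rule expands_bounded[OF P]) (rule exI, rule conjI)
  from choice[OF this] obtain B where B: "\<And>j. B j \<ge> 0"
    "\<And>j. eventually (\<lambda>t. norm (coeff (p t) j) \<le> B j) (at_right 0)" by blast
  define A where "A = 1 + (\<Sum>j<n. B j)"
  have A: "A \<ge> 0" using B(1) by (auto simp: A_def intro!: add_nonneg_nonneg sum_nonneg)
  define c where "c = (\<Sum>j\<le>n. C j * A ^ j)"
  define c' where "c' = max 1 c"
  have "eventually (\<lambda>t. \<forall>j\<in>{..n}. norm (coeff (p t) j) \<le> B j) (at_right 0)"
    by (intro eventually_ball_finite) (auto simp: B)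
  moreover have "eventually (\<lambda>t. \<forall>j\<in>{..n}. \<bar>t\<bar> \<le> 1 \<and>
      norm (coeff (p t) j - poly (coeff D j) (of_real t)) \<le> C j * \<bar>t\<bar> ^ (n * K)) (at_right 0)"
    by (intro eventually_ball_finite ballI C) auto
  ultimately have "eventually (\<lambda>t. \<exists>i\<in>S. norm (l t - poly (\<pi> i) (of_real t)) \<le> c' * t ^ K) (at_right 0)"
    using root eventually_at_right_less[of "0::real"]
  proof eventually_elim
    case (elim t)
    interpret ev: coeff_hom "\<lambda>p. poly p (complex_of_real t)" by (rule coeff_hom_eval)
    have "norm (l t) \<le> 1 + (\<Sum>j<n. norm (coeff (p t) j))"
      using monic_root_bound[of "p t" n "l t"] monic elim by (simp add: n_def)
    also have "\<dots> \<le> A" unfolding A_def using elim by (intro add_mono sum_mono) auto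
    finally have lA: "norm (l t) \<le> A" .
    have "(\<Prod>i\<in>S. l t - poly (\<pi> i) (of_real t)) = poly (\<Prod>i\<in>S. [:- poly (\<pi> i) (of_real t), 1:]) (l t)"
      by (simp add: poly_prod)
    also have "\<dots> = (\<Sum>j\<le>n. coeff (\<Prod>i\<in>S. [:- poly (\<pi> i) (of_real t), 1:]) j * l t ^ j)"
      by (rule poly_sum_upto) (simp add: degree_prod_linear fin n_def)
    also have "\<dots> = (\<Sum>j\<le>n. poly (coeff D j) (of_real t) * l t ^ j)"
      unfolding ev.map_poly_prod_linear[symmetric] D_def[symmetric] by (simp add: coeff_map_poly)
    also have "\<dots> = (\<Sum>j\<le>n. poly (coeff D j) (of_real t) * l t ^ j) - (\<Sum>j\<le>n. coeff (p t) j * l t ^ j)"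
      using elim poly_sum_upto[of "p t" n "l t"] monic by (simp add: n_def)
    also have "\<dots> = (\<Sum>j\<le>n. (poly (coeff D j) (of_real t) - coeff (p t) j) * l t ^ j)"
      by (simp add: sum_subtractf algebra_simps)
    also have "norm \<dots> \<le> (\<Sum>j\<le>n. C j * A ^ j * t ^ (n * K))"
    proof (rule sum_norm_le)
      fix j assume "j \<in> {..n}"
      then have "norm (poly (coeff D j) (of_real t) - coeff (p t) j) \<le> C j * t ^ (n * K)"
        using elim by (auto simp: norm_minus_commute)
      moreover have "norm (l t) ^ j \<le> A ^ j" using lA by (intro power_mono) auto
      ultimately have "norm (poly (coeff D j) (of_real t) - coeff (p t) j) * norm (l t) ^ j \<le> (C j * t ^ (n * K)) * A ^ j"
        using C(1)[of j] elim by (intro mult_mono) auto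
      then show "norm ((poly (coeff D j) (of_real t) - coeff (p t) j) * l t ^ j) \<le> C j * A ^ j * t ^ (n * K)"
        by (simp add: norm_mult norm_power mult_ac)
    qed
    also have "\<dots> = c * t ^ (n * K)" by (simp add: c_def sum_distrib_right)
    finally have le: "norm (\<Prod>i\<in>S. l t - poly (\<pi> i) (of_real t)) \<le> c * t ^ (n * K)" .
    show ?case
    proof (rule ccontr)
      assume "\<not> ?case"
      then have gt: "\<And>i. i \<in> S \<Longrightarrow> c' * t ^ K < norm (l t - poly (\<pi> i) (of_real t))" by (auto simp: not_le)
      have c': "c' \<ge> 1" "c' \<ge> c" by (auto simp: c'_def)
      have "c * t ^ (n * K) \<le> c' * t ^ (n * K)" using elim c' by (intro mult_right_mono) auto
      also have "\<dots> \<le> c' ^ n * t ^ (n * K)"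
        using elim c' monic(3) power_increasing[of 1 n c'] by (intro mult_right_mono) (auto simp: n_def)
      also have "\<dots> = (\<Prod>i\<in>S. c' * t ^ K)"
        by (simp add: n_def power_mult_distrib power_mult[symmetric] mult.commute)
      also have "\<dots> < (\<Prod>i\<in>S. norm (l t - poly (\<pi> i) (of_real t)))"
      proof -
        have pos: "0 < c' * t ^ K" using c' elim by simp
        obtain i0 where "i0 \<in> S" using monic(3) by fastforce
        then show ?thesis
          using pos gt fin by (intro prod_mono_strict[of i0]) (fastforce intro: less_imp_le less_trans)+
      qed
      also have "\<dots> = norm (\<Prod>i\<in>S. l t - poly (\<pi> i) (of_real t))" by (simp add: prod_norm)
      finally show False using le by simp
    qed
  qed
  then show ?thesis by (intro exI[of _ c'] conjI) (auto simp: c'_def)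
qed

context o_minimal_structure
begin

text \<open>
  For every \<open>K\<close> the index of the approximate root close to \<open>l t\<close> can be chosen independently of \<open>t\<close> by
  o-minimality, and some index occurs for infinitely many \<open>K\<close>; the corresponding formal root is the
  expansion of \<open>l\<close>.
\<close>

lemma root_expansion:
  fixes p :: "real \<Rightarrow> complex poly"
  assumes monic: "\<And>t. degree (p t) = card S" "\<And>t. lead_coeff (p t) = 1" "card S \<ge> 1"
    and P: "\<And>j. expands (at_right 0) (\<lambda>t. coeff (p t) j) (coeff (\<Prod>i\<in>S. [:- L i, 1:]) j)"
    and root: "eventually (\<lambda>t. poly (p t) (l t) = 0) (at_right 0)"
    and l: "germ_definable l"
  shows "\<exists>i\<in>S. expands (at_right 0) l (L i)"
proof -
  have fin: "finite S" using monic(3) by (metis card.infinite not_one_le_zero)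
  define \<pi> where "\<pi> K i = truncate_fps (card S * K) (L i)" for K i
  have \<pi>: "fps_X ^ (card S * K) dvd fps_of_poly (\<pi> K i) - L i" for K i
    unfolding fps_X_power_dvd_iff by (simp add: \<pi>_def)
  have "\<exists>i. i \<in> S \<and> (\<exists>C. eventually (\<lambda>t. norm (l t - poly (\<pi> K i) (of_real t)) \<le> C * t ^ K) (at_right 0))" for K
  proof (rule ccontr)
    assume neg: "\<not> ?thesis"
    obtain C where C: "C \<ge> 0"
      "eventually (\<lambda>t. \<exists>i\<in>S. norm (l t - poly (\<pi> K i) (of_real t)) \<le> C * t ^ K) (at_right 0)"
      using root_near_expansion[OF monic P root \<pi>, of K] by blast
    have nC: "norm (of_real C * of_real t ^ K :: complex) = C * t ^ K" if "t > 0" for t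
      using C(1) that by (simp add: norm_mult norm_power)
    have "eventually (\<lambda>t. C * t ^ K < norm (l t - poly (\<pi> K i) (of_real t))) (at_right 0)" if "i \<in> S" for i
    proof -
      have "germ_definable (\<lambda>t. l t - poly (\<pi> K i) (of_real t))" "germ_definable (\<lambda>t. of_real C * of_real t ^ K)"
        by (intro germ_definable_diff germ_definable_poly l germ_definable_mult germ_definable_const germ_definable_power germ_definable_of_real)+
      from germ_definable_norm_le_dichotomy[OF this] show ?thesis
      proof
        assume "eventually (\<lambda>t. norm (l t - poly (\<pi> K i) (of_real t)) \<le> norm (of_real C * of_real t ^ K :: complex)) (at_right 0)"
        with eventually_at_right_less[of "0::real"]
        have "eventually (\<lambda>t. norm (l t - poly (\<pi> K i) (of_real t)) \<le> C * t ^ K) (at_right 0)"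
          by eventually_elim (simp only: nC)
        then show ?thesis using neg that by blast
      next
        assume "eventually (\<lambda>t. norm (of_real C * of_real t ^ K :: complex) < norm (l t - poly (\<pi> K i) (of_real t))) (at_right 0)"
        with eventually_at_right_less[of "0::real"] show ?thesis
          by eventually_elim (simp only: nC)
      qed
    qed
    then have "eventually (\<lambda>t. \<forall>i\<in>S. C * t ^ K < norm (l t - poly (\<pi> K i) (of_real t))) (at_right 0)"
      using fin by (intro eventually_ball_finite) auto
    from eventually_conj[OF this C(2)] have "eventually (\<lambda>t::real. False) (at_right 0)"
      by (rule eventually_mono) force
    then show False by simp
  qed
  then obtain i where i: "\<And>K. i K \<in> S"
    "\<And>K. \<exists>C. eventually (\<lambda>t. norm (l t - poly (\<pi> K (i K)) (of_real t)) \<le> C * t ^ K) (at_right 0)" by metis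
  have "finite (range i)" by (rule finite_subset[OF _ fin]) (use i in auto)
  then obtain K0 where "infinite {K. i K = i K0}"
    using pigeonhole_infinite[of "UNIV :: nat set" i] by auto
  then have unb: "\<exists>K'\<ge>K. i K' = i K0" for K
    unfolding infinite_nat_iff_unbounded_le by auto
  have "expands (at_right 0) l (L (i K0))"
    unfolding expands_def
  proof
    fix K
    obtain K' where K': "K' \<ge> K" "i K' = i K0" using unb by blast
    obtain C where C: "eventually (\<lambda>t. norm (l t - poly (\<pi> K' (i K0)) (of_real t)) \<le> C * t ^ K') (at_right 0)"
      using i(2)[of K'] K' by auto
    have "K' \<le> card S * K'" using monic(3) by (cases "card S") auto
    then have "fps_X ^ K dvd (fps_X ^ (card S * K') :: complex fps)"
      using K'(1) by (intro le_imp_power_dvd) (rule order.trans)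
    then have "fps_X ^ K dvd fps_of_poly (\<pi> K' (i K0)) - L (i K0)" using \<pi> dvd_trans by blast
    moreover have "approximates (at_right 0) l (\<pi> K' (i K0)) \<bar>C\<bar> K"
      using C small_at_right eventually_at_right_less[of "0::real"]
    proof eventually_elim
      case (elim t)
      have "C * t ^ K' \<le> \<bar>C\<bar> * t ^ K"
        using elim K'(1) by (intro mult_mono power_decreasing) auto
      then show ?case using elim by simp
    qed
    ultimately show "\<exists>p C. fps_X ^ K dvd fps_of_poly p - L (i K0) \<and>
       approximates (at_right 0) l p C K" by blast
  qed
  then show ?thesis using i(1) by blast
qed

text \<open>
  Divide by the linear factor of one smooth root and by the linear factor of its expansion. The
  quotients are computed by the same recursion on coefficients, so the coefficients of the one
  expand to those of the other, and induction on the degree applies.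
\<close>

lemma regular_roots:
  fixes p :: "real \<Rightarrow> complex poly"
  assumes "finite S" "\<And>t. degree (p t) = card S" "\<And>t. lead_coeff (p t) = 1"
    and "\<And>j. regular (\<lambda>t. coeff (p t) j) (coeff (\<Prod>i\<in>S. [:- L i, 1:]) j)"
  shows "\<exists>l. (\<forall>i\<in>S. regular (l i) (L i)) \<and> eventually (\<lambda>t. p t = (\<Prod>i\<in>S. [:- l i t, 1:])) (at_right 0)"
  using assms
proof (induction "card S" arbitrary: S p)
  case 0
  then have S: "S = {}" by simp
  have "p t = 1" for t using 0(3)[of t] 0(4)[of t] S by (metis card.empty degree_eq_zeroE lead_coeff_pCons(2) one_pCons)
  then show ?case by (simp add: S)
next
  case (Suc n S p)
  have card1: "card S \<ge> 1" using Suc.hyps(2) by simp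
  obtain l0 \<epsilon> where l0: "\<epsilon> > 0" "germ_definable l0" "smooth {0<..<\<epsilon>} l0" "\<And>t. 0 < t \<Longrightarrow> t < \<epsilon> \<Longrightarrow> poly (p t) (l0 t) = 0"
  proof (rule smooth_root_exists[of p "card S"])
    show "germ_definable (\<lambda>t. coeff (p t) j)" "\<exists>\<epsilon>>0. smooth {0<..<\<epsilon>} (\<lambda>t. coeff (p t) j)" for j
      using Suc.prems(4)[of j] by (auto simp: regular_def)
  qed (use Suc.prems card1 in auto)
  have root: "eventually (\<lambda>t. poly (p t) (l0 t) = 0) (at_right 0)"
    unfolding eventually_at_right_field using l0 by blast
  have "\<exists>i\<in>S. expands (at_right 0) l0 (L i)"
  proof (rule root_expansion[OF _ _ card1 _ root l0(2)])
    show "expands (at_right 0) (\<lambda>t. coeff (p t) j) (coeff (\<Prod>i\<in>S. [:- L i, 1:]) j)" for j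
      using Suc.prems(4)[of j] by (simp add: regular_def)
  qed (use Suc.prems in auto)
  then obtain i where i: "i \<in> S" "expands (at_right 0) l0 (L i)" by blast
  have reg: "regular l0 (L i)" using l0 i by (auto simp: regular_def)
  define S' where "S' = S - {i}"
  have S': "finite S'" "card S' = n" "i \<notin> S'" "S = insert i S'"
    using Suc.prems(1) Suc.hyps(2) i by (auto simp: S'_def)
  define q where "q t = synthetic_div (p t) (l0 t)" for t
  define Q where "Q = (\<Prod>i\<in>S'. [:- L i, 1:])"
  have pq: "p t = [:- l0 t, 1:] * q t + [:poly (p t) (l0 t):]" for t
    unfolding q_def by (rule synthetic_div_correct'[symmetric])
  have dq: "degree (q t) = n" for t
    unfolding q_def degree_synthetic_div using Suc.prems(2)[of t] Suc.hyps(2) by simp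
  have cp: "coeff (q t) j = coeff (p t) (Suc j) + l0 t * coeff (q t) (Suc j)" for t j
    by (subst pq[of t]) simp
  have lq: "lead_coeff (q t) = 1" for t
  proof -
    have "coeff (q t) (Suc n) = 0" by (simp add: coeff_eq_0 dq)
    then show ?thesis
      using cp[of t n] Suc.prems(2,3)[of t] Suc.hyps(2) by (simp add: dq)
  qed
  have PQ: "(\<Prod>i\<in>S. [:- L i, 1:]) = [:- L i, 1:] * Q"
    unfolding Q_def S'(4) using S' by (subst prod.insert) auto
  have cP: "coeff Q j = coeff (\<Prod>i\<in>S. [:- L i, 1:]) (Suc j) + L i * coeff Q (Suc j)" for j
    unfolding PQ by simp
  have dQ: "degree Q = n" unfolding Q_def using degree_prod_linear[OF S'(1)] S'(2) by simp
  note assmp = Suc.prems(4)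
  have regq: "regular (\<lambda>t. coeff (q t) j) (coeff Q j)" for j
  proof -
    have "j + k > n \<Longrightarrow> regular (\<lambda>t. coeff (q t) j) (coeff Q j)" for k
    proof (induction k arbitrary: j)
      case 0
      then show ?case using regular_const[of 0] by (simp add: coeff_eq_0 dq dQ)
    next
      case (Suc k)
      have "regular (\<lambda>t. coeff (q t) (Suc j)) (coeff Q (Suc j))" using Suc.prems by (intro Suc.IH) simp
      from regular_add[OF assmp[of "Suc j"] regular_mult[OF reg this]]
      show ?case by (simp only: cp[symmetric] cP[symmetric])
    qed
    from this[of "Suc n"] show ?thesis by simp
  qed
  have "\<exists>l. (\<forall>i\<in>S'. regular (l i) (L i)) \<and> eventually (\<lambda>t. q t = (\<Prod>i\<in>S'. [:- l i t, 1:])) (at_right 0)"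
    by (rule Suc.hyps(1)) (use S' dq lq regq in \<open>auto simp: Q_def\<close>)
  then obtain l where l: "\<forall>i\<in>S'. regular (l i) (L i)"
    "eventually (\<lambda>t. q t = (\<Prod>i\<in>S'. [:- l i t, 1:])) (at_right 0)" by blast
  have "eventually (\<lambda>t. p t = (\<Prod>j\<in>S. [:- (l(i := l0)) j t, 1:])) (at_right 0)"
    using l(2) root
  proof eventually_elim
    case (elim t)
    have "p t = [:- l0 t, 1:] * q t" using pq[of t] elim by simp
    also have "q t = (\<Prod>j\<in>S'. [:- (l(i := l0)) j t, 1:])"
      unfolding elim using S'(3) by (intro prod.cong) auto
    finally show ?case unfolding S'(4) using S' by (subst prod.insert) auto
  qed
  moreover have "\<forall>j\<in>S. regular ((l(i := l0)) j) (L j)" using l(1) reg S'(4) by auto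
  ultimately show ?case by blast
qed

section \<open>Gluing the two sides\<close>

lemma definable_of_M:
  assumes "S \<in> M 3"
  shows "definable (\<lambda>e. [e 0, e 1, e 2] \<in> S)"
proof -
  have S: "S \<subseteq> Rn 3" using subset_Rn[OF _ assms] by simp
  have "{x \<in> Rn 3. [x ! 0, x ! 1, x ! 2] \<in> S} = S"
  proof -
    have "[x ! 0, x ! 1, x ! 2] = x" if "length x = 3" for x :: "real list"
      using that by (auto simp: list_eq_iff_nth_eq less_Suc_eq numeral_3_eq_3 numeral_2_eq_2)
    then show ?thesis using S by auto
  qed
  then show ?thesis
    unfolding definable_def using assms by (intro exI[of _ 3]) auto
qed

lemma M_of_definable:
  assumes "definable (\<lambda>e. Q (e 0) (e 1) (e 2))"
  shows "{[x, y, z] | x y z. Q x y z} \<in> M 3"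
proof -
  from definable_common[OF assms] obtain n0 where n0: "n0 \<ge> 1"
    "\<forall>n\<ge>n0. {x \<in> Rn n. Q (x ! 0) (x ! 1) (x ! 2)} \<in> M n" by blast
  define n where "n = max n0 3"
  have n: "n \<ge> 3" "{x \<in> Rn n. Q (x ! 0) (x ! 1) (x ! 2)} \<in> M n" using n0 by (auto simp: n_def)
  have "{y \<in> Rn 3. \<exists>x\<in>{x \<in> Rn n. Q (x ! 0) (x ! 1) (x ! 2)}. \<forall>(i, j)\<in>{(0, 0), (1, 1), (2, 2)}. x ! i = y ! j} \<in> M 3"
    using n by (intro relational_image_in_M) auto
  also have "{y \<in> Rn 3. \<exists>x\<in>{x \<in> Rn n. Q (x ! 0) (x ! 1) (x ! 2)}. \<forall>(i, j)\<in>{(0, 0), (1, 1), (2, 2)}. x ! i = y ! j} =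
      {[x, y, z] | x y z. Q x y z}" (is "?A = ?B")
  proof (intro equalityI subsetI)
    fix y assume "y \<in> ?A"
    then have "length y = 3" "Q (y ! 0) (y ! 1) (y ! 2)" by auto
    moreover from this(1) have "y = [y ! 0, y ! 1, y ! 2]"
      by (auto simp: list_eq_iff_nth_eq less_Suc_eq numeral_3_eq_3 numeral_2_eq_2)
    ultimately show "y \<in> ?B" by blast
  next
    fix y assume "y \<in> ?B"
    then obtain a b c where y: "y = [a, b, c]" "Q a b c" by blast
    have "[a, b, c] @ replicate (n - 3) 0 \<in> {x \<in> Rn n. Q (x ! 0) (x ! 1) (x ! 2)}"
      using y n(1) by (simp add: numeral_2_eq_2)
    then show "y \<in> ?A" using y by (auto simp: numeral_2_eq_2 intro!: exI[of _ "[a, b, c] @ replicate (n - 3) 0"])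
  qed
  finally show ?thesis .
qed

lemma definable_total:
  assumes "definable_complex_on M I f"
  shows "definable_cfun (\<lambda>e. if e 0 \<in> I then f (e 0) else 0)" and "definable (\<lambda>e. e 0 \<in> I)"
proof -
  define S where "S = {x @ [Re (f (hd x)), Im (f (hd x))] | x. x \<in> (\<lambda>t. [t]) ` I}"
  have "S \<in> M 3" using assms by (simp add: definable_complex_on_def definable_map_def S_def numeral_3_eq_3)
  from definable_of_M[OF this] have "definable (\<lambda>e. [e 0, e 1, e 2] \<in> S)" .
  moreover have "[x, y, z] \<in> S \<longleftrightarrow> x \<in> I \<and> y = Re (f x) \<and> z = Im (f x)" for x y z
    by (auto simp: S_def)
  ultimately have D: "definable (\<lambda>e. e 0 \<in> I \<and> e 1 = Re (f (e 0)) \<and> e 2 = Im (f (e 0)))"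
    by (simp only:)
  have "definable (\<lambda>e. \<exists>y. \<exists>z. e 0 \<in> I \<and> y = Re (f (e 0)) \<and> z = Im (f (e 0)))"
    by (rule definable_ex[where k = 1], rule definable_ex[where k = 2], rule D) auto
  then show DI: "definable (\<lambda>e. e 0 \<in> I)" by simp
  have "definable (\<lambda>e. \<exists>z. e 0 \<in> I \<and> e 1 = Re (f (e 0)) \<and> z = Im (f (e 0)))"
    by (rule definable_ex[where k = 2], rule D) auto
  then have DR: "definable (\<lambda>e. e 0 \<in> I \<and> e 1 = Re (f (e 0)))" by simp
  have "definable (\<lambda>e. e 0 \<in> I \<and> e 2 = Re (f (e 0)) \<and> e 1 = Im (f (e 0)))"
    using definable_rename[OF D, of "\<lambda>i. if i = 1 then 2 else if i = 2 then 1 else i"] by simp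
  then have "definable (\<lambda>e. \<exists>y. e 0 \<in> I \<and> y = Re (f (e 0)) \<and> e 1 = Im (f (e 0)))"
    by (rule definable_ex[where k = 2]) auto
  then have DM: "definable (\<lambda>e. e 0 \<in> I \<and> e 1 = Im (f (e 0)))" by simp
  have g: "definable_fun (\<lambda>e. if e 0 \<in> I then h (e 0) else 0)" if "definable (\<lambda>e. e 0 \<in> I \<and> e 1 = h (e 0))" for h
  proof (rule definable_fun_graph)
    show "definable (\<lambda>e. (e 0 \<in> I \<and> e 1 = h (e 0)) \<or> (\<not> e 0 \<in> I \<and> e 1 = 0))"
      by (rule definable_or, rule that, rule definable_and, rule definable_not, rule DI) (intro definable_intros)
  qed auto
  show "definable_cfun (\<lambda>e. if e 0 \<in> I then f (e 0) else 0)"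
    unfolding definable_cfun_def using g[OF DR] g[OF DM] by (simp add: if_distrib[of Re] if_distrib[of Im] cong: if_cong)
qed

lemma definable_from_total:
  assumes g: "definable_cfun (\<lambda>e. g (e 0))" and J: "definable (\<lambda>e. e 0 \<in> J)"
  shows "definable_complex_on M J g"
proof -
  have "definable (\<lambda>e. e 0 \<in> J \<and> e 1 = Re (g (e 0)) \<and> e 2 = Im (g (e 0)))"
    by (intro definable_and J definable_eq definable_fun_var) (use g in \<open>auto simp: definable_cfun_def\<close>)
  from M_of_definable[OF this]
  have "{[t, y, z] | t y z. t \<in> J \<and> y = Re (g t) \<and> z = Im (g t)} \<in> M 3" .
  also have "{[t, y, z] | t y z. t \<in> J \<and> y = Re (g t) \<and> z = Im (g t)} =
     {x @ [Re (g (hd x)), Im (g (hd x))] | x. x \<in> (\<lambda>t. [t]) ` J}" by auto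
  finally show ?thesis
    unfolding definable_complex_on_def definable_map_def by (auto simp: numeral_3_eq_3)
qed

lemma regular_cong:
  assumes "regular f F" "eventually (\<lambda>t. f t = g t) (at_right 0)"
  shows "regular g F"
proof -
  from assms(1) obtain d where d: "d > 0" "smooth {0<..<d} f" by (auto simp: regular_def)
  from assms(2) obtain e where e: "e > 0" "\<And>t. 0 < t \<Longrightarrow> t < e \<Longrightarrow> f t = g t"
    unfolding eventually_at_right_field by blast
  have "smooth {0<..<min d e} f" by (rule smooth_subset[OF _ d(2)]) auto
  then have "smooth {0<..<min d e} g" by (rule smooth_cong[rotated 2]) (use e in auto)
  moreover have "min d e > 0" using d e by simp
  ultimately show ?thesis
    using assms germ_definable_cong[OF _ assms(2)] expands_cong[OF _ assms(2)] unfolding regular_def by blast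
qed

lemma regular_total:
  assumes "regular f F"
  obtains g where "definable_cfun (\<lambda>e. g (e 0))" "regular g F" "eventually (\<lambda>t. f t = g t) (at_right 0)"
proof -
  obtain g where "definable_cfun (\<lambda>e. g (e 0))" "eventually (\<lambda>t. f t = g t) (at_right 0)"
    using assms unfolding regular_def germ_definable_def by blast
  then show ?thesis using that regular_cong[OF assms] by blast
qed

lemma regular_uminus: "regular f F \<Longrightarrow> regular (\<lambda>t. - f t) (- F)"
  using regular_mult[OF regular_const[of "-1"]] by (simp add: fps_const_neg[symmetric] del: fps_const_neg)

text \<open>
  Expansion to order 2 on both sides.
\<close>

lemma glue_derivative_0:
  assumes r: "expands (at_right 0) h G" and l: "expands (at_right 0) (\<lambda>t. h (- t)) (G oo - fps_X)"
    and h0: "h 0 = G $ 0"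
  shows "(h has_vector_derivative G $ 1) (at 0)"
proof -
  have "fps_X ^ 2 dvd fps_of_poly [:G $ 0, G $ 1:] - G"
    unfolding fps_X_power_dvd_iff by (auto simp: numeral_2_eq_2 less_Suc_eq)
  from expands_remainder[OF r this] obtain C where C: "C \<ge> 0"
    "approximates (at_right 0) h [:G $ 0, G $ 1:] C 2" .
  have "fps_X ^ 2 dvd fps_of_poly [:G $ 0, - G $ 1:] - (G oo - fps_X)"
    unfolding fps_X_power_dvd_iff by (auto simp: numeral_2_eq_2 less_Suc_eq fps_compose_uminus')
  from expands_remainder[OF l this] obtain D where D: "D \<ge> 0"
    "approximates (at_right 0) (\<lambda>t. h (- t)) [:G $ 0, - G $ 1:] D 2" .
  from eventually_conj[OF C(2) D(2)] obtain d where d: "d > 0"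
    "\<And>t. 0 < t \<Longrightarrow> t < d \<Longrightarrow> norm (h t - poly [:G $ 0, G $ 1:] (of_real t)) \<le> C * \<bar>t\<bar> ^ 2"
    "\<And>t. 0 < t \<Longrightarrow> t < d \<Longrightarrow> norm (h (- t) - poly [:G $ 0, - G $ 1:] (of_real t)) \<le> D * \<bar>t\<bar> ^ 2"
    unfolding eventually_at_right_field by blast
  have b: "norm (h t - h 0 - of_real t * G $ 1) \<le> (C + D) * \<bar>t\<bar> ^ 2" if "\<bar>t\<bar> < d" "t \<noteq> 0" for t
  proof (cases "t > 0")
    case True
    then have "norm (h t - h 0 - of_real t * G $ 1) \<le> C * \<bar>t\<bar> ^ 2"
      using d(2)[of t] that by (simp add: h0 algebra_simps)
    then show ?thesis using D(1) by (simp add: distrib_right add_increasing2)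
  next
    case False
    then have "norm (h t - h 0 - of_real t * G $ 1) \<le> D * \<bar>t\<bar> ^ 2"
      using d(3)[of "- t"] that by (simp add: h0 algebra_simps)
    then show ?thesis using C(1) by (simp add: distrib_right add_increasing)
  qed
  have "((\<lambda>t. (h t - h 0) / of_real (t - 0) - G $ 1) \<longlongrightarrow> 0) (at 0)"
  proof (rule Lim_null_comparison)
    have "((\<lambda>t::real. (C + D) * \<bar>t\<bar>) \<longlongrightarrow> (C + D) * \<bar>0\<bar>) (at 0)" by (intro tendsto_intros)
    then show "((\<lambda>t::real. (C + D) * \<bar>t\<bar>) \<longlongrightarrow> 0) (at 0)" by simp
    have "norm ((h t - h 0) / of_real (t - 0) - G $ 1) \<le> (C + D) * \<bar>t\<bar>" if "\<bar>t\<bar> < d" "t \<noteq> 0" for t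
    proof -
      have "(h t - h 0) / of_real (t - 0) - G $ 1 = (h t - h 0 - of_real t * G $ 1) / of_real t"
        using that by (simp add: field_simps)
      then have "norm ((h t - h 0) / of_real (t - 0) - G $ 1) = norm (h t - h 0 - of_real t * G $ 1) / \<bar>t\<bar>"
        by (simp only: norm_divide norm_of_real)
      also have "\<dots> \<le> (C + D) * \<bar>t\<bar> ^ 2 / \<bar>t\<bar>" using b[OF that] by (intro divide_right_mono) auto
      also have "\<bar>t\<bar> ^ 2 / \<bar>t\<bar> = \<bar>t\<bar>"
        using that by (cases "t > 0") (auto simp: power2_eq_square)
      then have "(C + D) * \<bar>t\<bar> ^ 2 / \<bar>t\<bar> = (C + D) * \<bar>t\<bar>"
        by (simp only: times_divide_eq_right[symmetric])
      finally show ?thesis .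
    qed
    then show "eventually (\<lambda>t. norm ((h t - h 0) / of_real (t - 0) - G $ 1) \<le> (C + D) * \<bar>t\<bar>) (at 0)"
      unfolding eventually_at using d(1) by (auto simp: dist_real_def)
  qed
  then show ?thesis unfolding has_vector_derivative_complex_iff by (simp add: LIM_zero_iff)
qed

text \<open>
  The derivative of \<open>h\<close> satisfies the same assumptions, with the derivative of \<open>G\<close>, because expansions
  of regular functions may be differentiated on each side. The two one-sided expansions correspond to
  the same series \<open>G\<close>: the left one is written in the variable \<open>-t\<close>.
\<close>

lemma glue_Ck:
  assumes "\<epsilon> > 0" "smooth {0<..<\<epsilon>} h" "smooth {-\<epsilon><..<0} h" "regular h G"
    "regular (\<lambda>t. h (- t)) (G oo - fps_X)" "h 0 = G $ 0"
  shows "Ck k {-\<epsilon><..<\<epsilon>} h"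
  using assms(2-)
proof (induction k arbitrary: h G)
  case (Suc k h G)
  define h' where "h' t = (if t = 0 then G $ 1 else vderiv h t)" for t
  have vdr: "(h has_vector_derivative vderiv h t) (at t)" if "t \<in> {0<..<\<epsilon>}" for t
    using smooth_vderiv(2)[OF _ Suc.prems(1) that] by simp
  have vdl: "(h has_vector_derivative vderiv h t) (at t)" if "t \<in> {-\<epsilon><..<0}" for t
    using smooth_vderiv(2)[OF _ Suc.prems(2) that] by simp
  have evpos: "eventually (\<lambda>t. t \<in> {0<..<\<epsilon>}) (at_right 0)"
    using assms(1) by (auto simp: eventually_at_right_field)
  have "Ck k {-\<epsilon><..<\<epsilon>} h'"
  proof (rule Suc.IH)
    show "smooth {0<..<\<epsilon>} h'"
      by (rule smooth_cong[OF _ _ smooth_vderiv(1)[OF _ Suc.prems(1)]]) (auto simp: h'_def)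
    show "smooth {-\<epsilon><..<0} h'"
      by (rule smooth_cong[OF _ _ smooth_vderiv(1)[OF _ Suc.prems(2)]]) (auto simp: h'_def)
    show "regular h' (fps_deriv G)"
    proof (rule regular_cong[OF regular_deriv[OF Suc.prems(3)]])
      show "eventually (\<lambda>t. vderiv h t = h' t) (at_right 0)"
        using evpos by eventually_elim (simp add: h'_def)
    qed
    have "regular (\<lambda>t. - vderiv (\<lambda>t. h (- t)) t) (- fps_deriv (G oo - fps_X))"
      by (intro regular_uminus regular_deriv Suc.prems)
    moreover have "- fps_deriv (G oo - fps_X) = fps_deriv G oo - fps_X"
      by (simp add: fps_eq_iff fps_compose_uminus')
    moreover have "eventually (\<lambda>t. - vderiv (\<lambda>t. h (- t)) t = h' (- t)) (at_right 0)"
      using evpos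
    proof eventually_elim
      case (elim t)
      have "(h has_vector_derivative vderiv h (- t)) (at (- t))" using elim by (intro vdl) auto
      moreover have "(uminus has_vector_derivative (- 1 :: real)) (at t)"
        by (auto intro!: derivative_eq_intros simp: has_vector_derivative_def)
      ultimately have "((h \<circ> uminus) has_vector_derivative (-1) *\<^sub>R vderiv h (- t)) (at t)"
        by (intro vector_diff_chain_at)
      then have "vderiv (\<lambda>t. h (- t)) t = - vderiv h (- t)"
        by (simp add: o_def vector_derivative_at)
      then show ?case using elim by (simp add: h'_def)
    qed
    ultimately show "regular (\<lambda>t. h' (- t)) (fps_deriv G oo - fps_X)" using regular_cong by metis
    show "h' 0 = fps_deriv G $ 0" by (simp add: h'_def)
  qed
  moreover have "(h has_vector_derivative h' t) (at t)" if "t \<in> {-\<epsilon><..<\<epsilon>}" for t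
  proof -
    consider "0 < t" | "t < 0" | "t = 0" by linarith
    then show ?thesis
    proof cases
      case 3
      have "(h has_vector_derivative G $ 1) (at 0)"
        using Suc.prems by (intro glue_derivative_0) (auto simp: regular_def)
      then show ?thesis using 3 by (simp add: h'_def)
    qed (use vdr vdl that in \<open>auto simp: h'_def\<close>)
  qed
  ultimately show ?case by (rule Ck_SucI)
qed simp

end

text \<open>
  The polynomial of the theorem over an arbitrary ring, so that its coefficients can be functions at a
  point or formal power series.
\<close>

definition monic_poly :: "nat \<Rightarrow> (nat \<Rightarrow> 'a) \<Rightarrow> 'a::comm_ring_1 poly" where
  "monic_poly n c = monom 1 n + (\<Sum>j=1..n. monom ((-1) ^ j * c j) (n - j))"

lemma curve_poly_eq: "curve_poly n a t = monic_poly n (\<lambda>j. a j t)"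
  by (simp add: curve_poly_def monic_poly_def)

lemma coeff_monic_poly:
  "coeff (monic_poly n c) i = (if i < n then (-1) ^ (n - i) * c (n - i) else if i = n then 1 else 0)"
proof -
  have "coeff (\<Sum>j=1..n. monom ((-1) ^ j * c j) (n - j)) i =
      (\<Sum>j=1..n. if j = n - i \<and> i < n then (-1) ^ j * c j else 0)"
    unfolding coeff_sum by (intro sum.cong) auto
  also have "\<dots> = (if i < n then (-1) ^ (n - i) * c (n - i) else 0)"
    by (cases "i < n") (simp_all add: sum.delta)
  finally show ?thesis by (auto simp: monic_poly_def)
qed

lemma degree_monic_poly: "degree (monic_poly n c) = n"
  by (intro antisym degree_le le_degree) (auto simp: coeff_monic_poly)

lemma lead_coeff_monic_poly: "lead_coeff (monic_poly n c) = 1"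
  by (simp add: degree_monic_poly coeff_monic_poly)

lemma map_poly_monic_poly:
  assumes "coeff_hom h"
  shows "map_poly h (monic_poly n c) = monic_poly n (\<lambda>j. h (c j))"
proof -
  interpret coeff_hom h by fact
  have "h ((-1) ^ k) = (-1) ^ k" for k by (induction k) (auto simp: h_uminus)
  then show ?thesis
    by (intro poly_eqI) (simp add: coeff_map_poly coeff_monic_poly h_mult)
qed

lemma monic_poly_cong: "(\<And>j. j \<in> {1..n} \<Longrightarrow> c j = c' j) \<Longrightarrow> monic_poly n c = monic_poly n c'"
  unfolding monic_poly_def by (intro arg_cong2[where f = "(+)"] refl sum.cong) auto

abbreviation scaled_X :: "real \<Rightarrow> complex fps" where
  "scaled_X c \<equiv> fps_const (of_real c) * fps_X"

lemma fps_of_poly_scaled_X: "fps_of_poly [:0, of_real c:] = scaled_X c"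
  by (simp add: fps_of_poly_pCons fps_of_poly_const)

lemma coeff_hom_scaled_X: "coeff_hom (\<lambda>F. F oo scaled_X c)"
  by (rule coeff_hom_compose) simp

lemma scaled_X_1: "F oo scaled_X 1 = F" and scaled_X_minus_1: "F oo scaled_X (-1) = F oo - fps_X"
  by (simp_all add: fps_const_neg[symmetric] del: fps_const_neg)

lemma nhds_0_small: "eventually (\<lambda>t::real. \<bar>t\<bar> \<le> 1) (nhds 0)"
  unfolding eventually_nhds_metric by (auto simp: dist_real_def intro!: exI[of _ 1])

lemma expands_scale:
  assumes "expands (nhds 0) f F" "\<bar>c\<bar> \<le> 1"
  shows "expands (nhds 0) (\<lambda>t. f (c * t)) (F oo scaled_X c)"
proof -
  have "((\<lambda>t. c * t) \<longlongrightarrow> c * 0) (nhds 0)" by (intro tendsto_intros filterlim_ident)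
  then have lim: "filterlim (\<lambda>t. c * t) (nhds 0) (nhds 0)" by simp
  show ?thesis
    unfolding fps_of_poly_scaled_X[symmetric]
  proof (rule expands_compose[OF assms(1) lim])
    show "eventually (\<lambda>t. \<bar>t\<bar> \<le> 1 \<and> \<bar>c * t\<bar> \<le> \<bar>t\<bar>) (nhds 0)"
      using nhds_0_small assms(2) by (auto simp: abs_mult mult_left_le_one_le)
  qed auto
qed

lemma expands_power:
  assumes "expands (nhds 0) f F" "N > 0"
  shows "expands (nhds 0) (\<lambda>t. f (t ^ N)) (dilate N F)"
proof -
  have "((\<lambda>t::real. t ^ N) \<longlongrightarrow> 0 ^ N) (nhds 0)" by (intro tendsto_intros filterlim_ident)
  then have lim: "filterlim (\<lambda>t::real. t ^ N) (nhds 0) (nhds 0)" by (simp only: zero_power[OF assms(2)])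
  have "expands (nhds 0) (\<lambda>t. f (t ^ N)) (F oo fps_of_poly (monom 1 N))"
  proof (rule expands_compose[OF assms(1) lim])
    show "eventually (\<lambda>t. \<bar>t\<bar> \<le> 1 \<and> \<bar>t ^ N\<bar> \<le> \<bar>t\<bar>) (nhds (0::real))"
      using nhds_0_small
    proof eventually_elim
      case (elim t)
      then show ?case using assms(2) power_decreasing[of 1 N "\<bar>t\<bar>"] by (simp add: power_abs)
    qed
  qed (use assms in \<open>auto simp: poly_monom\<close>)
  then show ?thesis by (simp add: dilate_def fps_of_poly_monom')
qed

context o_minimal_structure
begin

lemma definable_cfun_if: "definable \<phi> \<Longrightarrow> definable_cfun f \<Longrightarrow> definable_cfun g \<Longrightarrow> definable_cfun (\<lambda>e. if \<phi> e then f e else g e)"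
  unfolding definable_cfun_def by (auto simp: if_distrib[of Re] if_distrib[of Im] intro: definable_fun_if cong: if_cong)

lemma regular_substitution:
  assumes b: "definable_cfun (\<lambda>e. b (e 0))" "smooth {-d<..<d} b" "d > 0" "expands (nhds 0) b B"
    and s: "s \<in> {1, -1}" "\<sigma> \<in> {1, -1}" "N > 0"
  shows "regular (\<lambda>t. b (\<sigma> * (s * t) ^ N)) (dilate N (B oo scaled_X \<sigma>) oo scaled_X s)"
proof -
  have "definable_cfun (\<lambda>e. b (\<sigma> * (s * e 0) ^ N))"
    by (rule definable_cfun_comp[OF b(1)]) (intro definable_intros)
  then have "germ_definable (\<lambda>t. b (\<sigma> * (s * t) ^ N))"
    unfolding germ_definable_def by (intro exI[of _ "\<lambda>t. b (\<sigma> * (s * t) ^ N)"]) simp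
  moreover have "smooth {0<..<min d 1} (\<lambda>t. b (\<sigma> * (s * t) ^ N))"
  proof (rule smooth_compose[OF b(2), where \<phi>' = "\<lambda>t. \<sigma> * (real N * (s * t) ^ (N - 1) * s)"])
    fix t assume t: "t \<in> {0<..<min d 1}"
    have "\<bar>\<sigma> * (s * t) ^ N\<bar> = t ^ N" using s t by (auto simp: abs_mult power_abs)
    also have "\<dots> \<le> t" using t s(3) power_decreasing[of 1 N t] by simp
    finally show "\<sigma> * (s * t) ^ N \<in> {-d<..<d}" using t by (auto simp: abs_if split: if_splits)
    show "((\<lambda>t. \<sigma> * (s * t) ^ N) has_vector_derivative \<sigma> * (real N * (s * t) ^ (N - 1) * s)) (at t)"
      unfolding has_real_derivative_iff_has_vector_derivative[symmetric]
      by (auto intro!: derivative_eq_intros)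
  next
    have "smooth {0<..<min d 1} (\<lambda>t. of_real \<sigma> * (of_nat N * (of_real s * of_real t) ^ (N - 1) * of_real s))"
      by (intro smooth_mult smooth_const smooth_power smooth_of_real)
    then show "smooth {0<..<min d 1} (\<lambda>t. of_real (\<sigma> * (real N * (s * t) ^ (N - 1) * s)))" by simp
  qed
  moreover have "expands (at_right 0) (\<lambda>t. b (\<sigma> * (s * t) ^ N)) (dilate N (B oo scaled_X \<sigma>) oo scaled_X s)"
  proof (rule expands_mono)
    show "expands (nhds 0) (\<lambda>t. b (\<sigma> * (s * t) ^ N)) (dilate N (B oo scaled_X \<sigma>) oo scaled_X s)"
      by (rule expands_scale[OF expands_power[OF expands_scale[OF b(4)]]]) (use s in auto)
    show "at_right 0 \<le> nhds (0::real)" by (simp add: at_within_def)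
  qed
  ultimately show ?thesis unfolding regular_def using b(3) by (intro conjI exI[of _ "min d 1"]) auto
qed

text \<open>
  The sign \<open>s\<close> selects the side: the parameter \<open>t > 0\<close> stands for the point \<open>s t\<close>, and the formal
  roots are evaluated at \<open>s X\<close>.
\<close>

lemma one_sided_roots:
  assumes b: "\<And>j. j \<in> {1..n} \<Longrightarrow> definable_cfun (\<lambda>e. b j (e 0))" "\<And>j. j \<in> {1..n} \<Longrightarrow> smooth {-d<..<d} (b j)"
      "d > 0" "\<And>j. j \<in> {1..n} \<Longrightarrow> expands (nhds 0) (b j) (B j)"
    and s: "s \<in> {1, -1}" "\<sigma> \<in> {1, -1}" "N > 0"
    and L: "monic_poly n (\<lambda>j. dilate N (B j oo scaled_X \<sigma>)) = (\<Prod>i<n. [:- L i, 1:])"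
  shows "\<exists>g. (\<forall>i<n. definable_cfun (\<lambda>e. g i (e 0)) \<and> regular (g i) (L i oo scaled_X s)) \<and>
           eventually (\<lambda>t. monic_poly n (\<lambda>j. b j (\<sigma> * (s * t) ^ N)) = (\<Prod>i<n. [:- g i t, 1:])) (at_right 0)"
proof -
  define p where "p t = monic_poly n (\<lambda>j. b j (\<sigma> * (s * t) ^ N))" for t
  interpret h: coeff_hom "\<lambda>F. F oo scaled_X s" by (rule coeff_hom_scaled_X)
  have P: "(\<Prod>i<n. [:- (L i oo scaled_X s), 1:]) = monic_poly n (\<lambda>j. dilate N (B j oo scaled_X \<sigma>) oo scaled_X s)"
    unfolding h.map_poly_prod_linear[symmetric] L[symmetric] by (rule map_poly_monic_poly[OF coeff_hom_scaled_X])
  have reg: "regular (\<lambda>t. coeff (p t) i) (coeff (\<Prod>i<n. [:- (L i oo scaled_X s), 1:]) i)" for i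
  proof -
    consider "i < n" | "i = n" | "i > n" by linarith
    then show ?thesis
    proof cases
      case 1
      then have "regular (\<lambda>t. b (n - i) (\<sigma> * (s * t) ^ N)) (dilate N (B (n - i) oo scaled_X \<sigma>) oo scaled_X s)"
        using b s by (intro regular_substitution[of _ d]) auto
      from regular_mult[OF regular_const[of "(-1) ^ (n - i)"] this] 1 show ?thesis
        unfolding P p_def coeff_monic_poly
        by (simp add: fps_const_power[symmetric] fps_const_neg[symmetric] del: fps_const_power fps_const_neg)
    next
      case 2
      then show ?thesis using regular_const[of 1] by (simp add: P p_def coeff_monic_poly)
    next
      case 3
      then show ?thesis using regular_const[of 0] by (simp add: P p_def coeff_monic_poly)
    qed
  qed
  have "\<exists>l. (\<forall>i\<in>{..<n}. regular (l i) (L i oo scaled_X s)) \<and> eventually (\<lambda>t. p t = (\<Prod>i<n. [:- l i t, 1:])) (at_right 0)"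
    by (rule regular_roots) (use reg in \<open>auto simp: p_def degree_monic_poly coeff_monic_poly\<close>)
  then obtain l where l: "\<forall>i\<in>{..<n}. regular (l i) (L i oo scaled_X s)"
    "eventually (\<lambda>t. p t = (\<Prod>i<n. [:- l i t, 1:])) (at_right 0)" by blast
  have "\<forall>i. \<exists>g. i < n \<longrightarrow> definable_cfun (\<lambda>e. g (e 0)) \<and> regular g (L i oo scaled_X s) \<and> eventually (\<lambda>t. l i t = g t) (at_right 0)"
  proof
    fix i
    show "\<exists>g. i < n \<longrightarrow> definable_cfun (\<lambda>e. g (e 0)) \<and> regular g (L i oo scaled_X s) \<and> eventually (\<lambda>t. l i t = g t) (at_right 0)"
    proof (cases "i < n")
      case True
      then have "regular (l i) (L i oo scaled_X s)" using l by simp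
      then show ?thesis by (rule regular_total) blast
    qed auto
  qed
  from choice[OF this] obtain g where g: "\<And>i. i < n \<Longrightarrow> definable_cfun (\<lambda>e. g i (e 0))"
    "\<And>i. i < n \<Longrightarrow> regular (g i) (L i oo scaled_X s)"
    "\<And>i. i < n \<Longrightarrow> eventually (\<lambda>t. l i t = g i t) (at_right 0)" by blast
  have "eventually (\<lambda>t. \<forall>i\<in>{..<n}. l i t = g i t) (at_right 0)"
    by (intro eventually_ball_finite) (auto simp: g)
  with l(2) have "eventually (\<lambda>t. p t = (\<Prod>i<n. [:- g i t, 1:])) (at_right 0)"
    by eventually_elim (auto intro!: prod.cong)
  with g(1,2) show ?thesis unfolding p_def by blast
qed

text \<open>
  The roots on both sides are indexed by the same formal roots \<open>L i\<close>, which tells which right germ to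
  glue to which left germ. At \<open>0\<close> itself the factorization is the constant term of the formal one.
\<close>

lemma two_sided_roots:
  assumes b: "\<And>j. j \<in> {1..n} \<Longrightarrow> definable_cfun (\<lambda>e. b j (e 0))" "\<And>j. j \<in> {1..n} \<Longrightarrow> smooth {-d<..<d} (b j)"
      "d > 0" "\<And>j. j \<in> {1..n} \<Longrightarrow> expands (nhds 0) (b j) (B j)"
    and B0: "\<And>j. j \<in> {1..n} \<Longrightarrow> B j $ 0 = b j 0"
    and s: "\<sigma> \<in> {1, -1}" "N > 0"
    and L: "monic_poly n (\<lambda>j. dilate N (B j oo scaled_X \<sigma>)) = (\<Prod>i<n. [:- L i, 1:])"
  shows "\<exists>\<epsilon>>0. \<exists>h. (\<forall>i<n. definable_cfun (\<lambda>e. h i (e 0)) \<and> smooth {-\<epsilon><..<\<epsilon>} (h i)) \<and>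
           (\<forall>t\<in>{-\<epsilon><..<\<epsilon>}. monic_poly n (\<lambda>j. b j (\<sigma> * t ^ N)) = (\<Prod>i<n. [:- h i t, 1:]))"
proof -
  from one_sided_roots[OF b _ s L, of 1] obtain g1 where
    g1: "\<And>i. i < n \<Longrightarrow> definable_cfun (\<lambda>e. g1 i (e 0))" "\<And>i. i < n \<Longrightarrow> regular (g1 i) (L i)"
      "eventually (\<lambda>t. monic_poly n (\<lambda>j. b j (\<sigma> * t ^ N)) = (\<Prod>i<n. [:- g1 i t, 1:])) (at_right 0)"
    unfolding scaled_X_1 by auto
  from one_sided_roots[OF b _ s L, of "-1"] obtain g2 where
    g2: "\<And>i. i < n \<Longrightarrow> definable_cfun (\<lambda>e. g2 i (e 0))" "\<And>i. i < n \<Longrightarrow> regular (g2 i) (L i oo - fps_X)"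
      "eventually (\<lambda>t. monic_poly n (\<lambda>j. b j (\<sigma> * (- t) ^ N)) = (\<Prod>i<n. [:- g2 i t, 1:])) (at_right 0)"
    unfolding scaled_X_minus_1 by auto
  obtain e1 where e1: "e1 > 0" "\<forall>i\<in>{..<n}. smooth {0<..<e1} (g1 i)"
    using smooth_uniform[of "{..<n}" g1] g1(2) by (auto simp: regular_def)
  obtain e2 where e2: "e2 > 0" "\<forall>i\<in>{..<n}. smooth {0<..<e2} (g2 i)"
    using smooth_uniform[of "{..<n}" g2] g2(2) by (auto simp: regular_def)
  from eventually_conj[OF g1(3) g2(3)] obtain e3 where e3: "e3 > 0"
    "\<And>t. 0 < t \<Longrightarrow> t < e3 \<Longrightarrow> monic_poly n (\<lambda>j. b j (\<sigma> * t ^ N)) = (\<Prod>i<n. [:- g1 i t, 1:])"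
    "\<And>t. 0 < t \<Longrightarrow> t < e3 \<Longrightarrow> monic_poly n (\<lambda>j. b j (\<sigma> * (- t) ^ N)) = (\<Prod>i<n. [:- g2 i t, 1:])"
    unfolding eventually_at_right_field by blast
  define \<epsilon> where "\<epsilon> = min e1 (min e2 e3)"
  have \<epsilon>: "\<epsilon> > 0" "\<epsilon> \<le> e1" "\<epsilon> \<le> e2" "\<epsilon> \<le> e3" using e1 e2 e3 by (auto simp: \<epsilon>_def)
  define h where "h i t = (if 0 < t then g1 i t else if t < 0 then g2 i (- t) else L i $ 0)" for i t
  have "definable_cfun (\<lambda>e. h i (e 0))" if "i < n" for i
    unfolding h_def
    by (intro definable_cfun_if definable_intros definable_cfun_const g1(1)[OF that] definable_cfun_comp[OF g2(1)[OF that]])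
  moreover have "smooth {-\<epsilon><..<\<epsilon>} (h i)" if i: "i < n" for i
  proof -
    have pos: "eventually (\<lambda>t. g1 i t = h i t) (at_right 0)" "eventually (\<lambda>t. g2 i t = h i (- t)) (at_right 0)"
      using eventually_at_right_less[of "0::real"] by (auto elim!: eventually_mono simp: h_def)
    have "Ck k {-\<epsilon><..<\<epsilon>} (h i)" for k
    proof (rule glue_Ck[OF \<epsilon>(1)])
      have "smooth {0<..<\<epsilon>} (g1 i)" using e1(2) i \<epsilon> by (auto intro: smooth_subset[of _ "{0<..<e1}"])
      then show "smooth {0<..<\<epsilon>} (h i)" by (rule smooth_cong[rotated 2]) (auto simp: h_def)
      have sg2: "smooth {0<..<\<epsilon>} (g2 i)" using e2(2) i \<epsilon> by (auto intro: smooth_subset[of _ "{0<..<e2}"])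
      have "smooth {-\<epsilon><..<0} (\<lambda>t. g2 i (- t))"
      proof (rule smooth_compose[OF sg2])
        show "(uminus has_vector_derivative (\<lambda>_. -1) t) (at t)" for t :: real
          by (auto intro!: derivative_eq_intros simp: has_vector_derivative_def)
      qed (auto simp: smooth_const)
      then show "smooth {-\<epsilon><..<0} (h i)" by (rule smooth_cong[rotated 2]) (auto simp: h_def)
      show "regular (h i) (L i)" by (rule regular_cong[OF g1(2)[OF i] pos(1)])
      show "regular (\<lambda>t. h i (- t)) (L i oo - fps_X)" by (rule regular_cong[OF g2(2)[OF i] pos(2)])
      show "h i 0 = L i $ 0" by (simp add: h_def)
    qed
    then show ?thesis by (simp add: smooth_def)
  qed
  moreover have "monic_poly n (\<lambda>j. b j (\<sigma> * t ^ N)) = (\<Prod>i<n. [:- h i t, 1:])" if t: "t \<in> {-\<epsilon><..<\<epsilon>}" for t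
  proof -
    consider "0 < t" | "t < 0" | "t = 0" by linarith
    then show ?thesis
    proof cases
      case 1
      then show ?thesis using e3(2)[of t] t \<epsilon> by (simp add: h_def)
    next
      case 2
      then show ?thesis using e3(3)[of "- t"] t \<epsilon> by (simp add: h_def)
    next
      case 3
      interpret z: coeff_hom "\<lambda>F :: complex fps. F $ 0" by (rule coeff_hom_nth0)
      have "map_poly (\<lambda>F. F $ 0) (monic_poly n (\<lambda>j. dilate N (B j oo scaled_X \<sigma>))) = monic_poly n (\<lambda>j. B j $ 0)"
        by (subst map_poly_monic_poly[OF coeff_hom_nth0]) simp
      also have "\<dots> = monic_poly n (\<lambda>j. b j 0)" by (rule monic_poly_cong) (rule B0)
      finally have "monic_poly n (\<lambda>j. b j 0) = (\<Prod>i<n. [:- (L i $ 0), 1:])"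
        unfolding L z.map_poly_prod_linear by simp
      then show ?thesis using 3 s(2) by (simp add: h_def zero_power)
    qed
  qed
  ultimately show ?thesis using \<epsilon>(1) by blast
qed

end

theorem theorem7p3:
  fixes M :: "nat \<Rightarrow> real list set set"
    and I :: "real set"
    and n :: nat
    and a :: "nat \<Rightarrow> real \<Rightarrow> complex"
    and t0 :: real
  assumes "o_minimal_structure M"
    and "open_interval I"
    and "\<And>j. j \<in> {1..n} \<Longrightarrow> definable_complex_on M I (a j)"
    and "\<And>j. j \<in> {1..n} \<Longrightarrow> C_infinity_on I (a j)"
    and "t0 \<in> I"
  shows "\<exists>N::nat. N > 0 \<and> (\<forall>\<sigma>\<in>{1, -1::real}.
           \<exists>(J :: real set) (\<Lambda> :: nat \<Rightarrow> real \<Rightarrow> complex).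
             open_interval J \<and> t0 \<in> J \<and>
             (\<forall>j\<in>{1..n}. definable_complex_on M J (\<Lambda> j) \<and> C_infinity_on J (\<Lambda> j)) \<and>
             (\<forall>t\<in>J. t0 + \<sigma> * (t - t0) ^ N \<in> I \<and>
                (\<forall>x::complex. poly (curve_poly n a (t0 + \<sigma> * (t - t0) ^ N)) x
                              = (\<Prod>j=1..n. (x - \<Lambda> j t)))))"
proof -
  interpret o_minimal_structure M by fact
  have I: "open I" using assms(2) by (simp add: open_interval_def)
  then obtain d where "d > 0" "\<And>t. dist t t0 < d \<Longrightarrow> t \<in> I"
    using assms(5) unfolding open_dist by blast
  then have d: "d > 0" "\<And>t. \<bar>t\<bar> < d \<Longrightarrow> t0 + t \<in> I"
    by (auto simp: dist_real_def)
  define b where "b j t = (if t0 + t \<in> I then a j (t0 + t) else 0)" for j t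
  define B where "B j = taylor (b j)" for j
  have cb: "definable_cfun (\<lambda>e. b j (e 0))" if "j \<in> {1..n}" for j
    unfolding b_def
    by (rule definable_cfun_comp[OF definable_total(1)[OF assms(3)[OF that]], of "\<lambda>e. t0 + e 0"]) (intro definable_intros)
  have sb: "smooth {-d<..<d} (b j)" if "j \<in> {1..n}" for j
  proof (rule smooth_cong)
    have "smooth I (a j)" using assms(4)[OF that] smooth_iff_C_infinity_on[OF I] by blast
    then show "smooth {-d<..<d} (\<lambda>t. a j (t0 + t))"
    proof (rule smooth_compose)
      show "((+) t0 has_vector_derivative (\<lambda>_. 1) t) (at t)" for t
        by (auto intro!: derivative_eq_intros simp: has_vector_derivative_def)
    qed (use d in \<open>auto simp: smooth_const\<close>)
  qed (use d in \<open>auto simp: b_def\<close>)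
  have eb: "expands (nhds 0) (b j) (B j)" if "j \<in> {1..n}" for j
    unfolding B_def using d(1) sb[OF that] by (intro expands_taylor[of "{-d<..<d}"]) auto
  have B0: "B j $ 0 = b j 0" for j by (simp add: B_def taylor_def)
  have "\<exists>N>0. \<exists>L. map_poly (dilate N) (monic_poly n (\<lambda>j. B j oo scaled_X \<sigma>)) = (\<Prod>i<n. [:- L i, 1:])" for \<sigma>
    by (intro puiseux degree_monic_poly lead_coeff_monic_poly)
  then obtain N1 L1 N2 L2 where
    N1: "N1 > 0" "map_poly (dilate N1) (monic_poly n (\<lambda>j. B j oo scaled_X 1)) = (\<Prod>i<n. [:- L1 i, 1:])" and
    N2: "N2 > 0" "map_poly (dilate N2) (monic_poly n (\<lambda>j. B j oo scaled_X (-1))) = (\<Prod>i<n. [:- L2 i, 1:])"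
    by metis
  \<comment> \<open>A common exponent for both signs.\<close>
  define N where "N = N1 * N2"
  have N: "N > 0" using N1 N2 by (simp add: N_def)
  have "map_poly (dilate N) (monic_poly n (\<lambda>j. B j oo scaled_X 1)) = (\<Prod>i<n. [:- dilate N2 (L1 i), 1:])"
    unfolding N_def by (rule puiseux_multiple[OF N1(2,1) N2(1)])
  moreover have "map_poly (dilate N) (monic_poly n (\<lambda>j. B j oo scaled_X (-1))) = (\<Prod>i<n. [:- dilate N1 (L2 i), 1:])"
    unfolding N_def mult.commute[of N1] by (rule puiseux_multiple[OF N2(2,1) N1(1)])
  ultimately have L: "\<exists>L. monic_poly n (\<lambda>j. dilate N (B j oo scaled_X \<sigma>)) = (\<Prod>i<n. [:- L i, 1:])"
    if "\<sigma> \<in> {1, -1}" for \<sigma>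
    using that unfolding map_poly_monic_poly[OF coeff_hom_dilate[OF N]] by auto
  show ?thesis
  proof (intro exI[of _ N] conjI ballI N)
    fix \<sigma> :: real assume \<sigma>: "\<sigma> \<in> {1, -1}"
    from L[OF \<sigma>] obtain L where L: "monic_poly n (\<lambda>j. dilate N (B j oo scaled_X \<sigma>)) = (\<Prod>i<n. [:- L i, 1:])" ..
    from two_sided_roots[OF cb sb d(1) eb B0 \<sigma> N L] obtain e h where e: "e > 0"
      and h: "\<And>i. i < n \<Longrightarrow> definable_cfun (\<lambda>e. h i (e 0))" "\<And>i. i < n \<Longrightarrow> smooth {-e<..<e} (h i)"
        "\<And>t. t \<in> {-e<..<e} \<Longrightarrow> monic_poly n (\<lambda>j. b j (\<sigma> * t ^ N)) = (\<Prod>i<n. [:- h i t, 1:])"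
      by blast
    define r where "r = min e (min d 1)"
    have r: "r > 0" "r \<le> e" "r \<le> d" "r \<le> 1" using e d by (auto simp: r_def)
    define J where "J = {t0 - r<..<t0 + r}"
    define \<Lambda> where "\<Lambda> j t = h (j - 1) (t - t0)" for j t
    have in_I: "t0 + \<sigma> * (t - t0) ^ N \<in> I" if "t \<in> J" for t
    proof -
      have "\<bar>t - t0\<bar> < r" using that by (auto simp: J_def)
      moreover have "\<bar>\<sigma> * (t - t0) ^ N\<bar> = \<bar>t - t0\<bar> ^ N" using \<sigma> by (auto simp: abs_mult power_abs)
      moreover have "\<bar>t - t0\<bar> ^ N \<le> \<bar>t - t0\<bar>"
        using N r calculation(1) power_decreasing[of 1 N "\<bar>t - t0\<bar>"] by simp
      ultimately show ?thesis using r by (intro d(2)) linarith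
    qed
    have DJ: "definable (\<lambda>e. e 0 \<in> J)" unfolding J_def greaterThanLessThan_iff by (intro definable_intros)
    have "definable_complex_on M J (\<Lambda> j) \<and> C_infinity_on J (\<Lambda> j)" if "j \<in> {1..n}" for j
    proof
      have j: "j - 1 < n" using that by auto
      have "definable_cfun (\<lambda>e. \<Lambda> j (e 0))"
        unfolding \<Lambda>_def by (rule definable_cfun_comp[OF h(1)[OF j]]) (intro definable_intros)
      then show "definable_complex_on M J (\<Lambda> j)" using DJ by (rule definable_from_total)
      have "smooth J (\<Lambda> j)"
        unfolding \<Lambda>_def
      proof (rule smooth_compose[OF h(2)[OF j]])
        show "((\<lambda>t. t - t0) has_vector_derivative (\<lambda>_. 1) t) (at t)" for t
          by (auto intro!: derivative_eq_intros simp: has_vector_derivative_def)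
      qed (use r in \<open>auto simp: J_def smooth_const\<close>)
      then show "C_infinity_on J (\<Lambda> j)" by (subst (asm) smooth_iff_C_infinity_on) (auto simp: J_def)
    qed
    moreover have "poly (curve_poly n a (t0 + \<sigma> * (t - t0) ^ N)) x = (\<Prod>j=1..n. (x - \<Lambda> j t))"
      if t: "t \<in> J" for t x
    proof -
      have "curve_poly n a (t0 + \<sigma> * (t - t0) ^ N) = monic_poly n (\<lambda>j. b j (\<sigma> * (t - t0) ^ N))"
        unfolding curve_poly_eq using in_I[OF t] by (simp add: b_def)
      also have "\<dots> = (\<Prod>i<n. [:- h i (t - t0), 1:])"
        using t r by (intro h(3)) (auto simp: J_def)
      finally have "poly (curve_poly n a (t0 + \<sigma> * (t - t0) ^ N)) x = (\<Prod>i<n. x - h i (t - t0))"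
        by (simp add: poly_prod)
      also have "\<dots> = (\<Prod>j=1..n. (x - \<Lambda> j t))"
        by (simp add: prod.atLeast1_atMost_eq \<Lambda>_def)
      finally show ?thesis .
    qed
    moreover have "open_interval J" "t0 \<in> J" using r by (auto simp: J_def open_interval_def is_interval_1)
    ultimately show "\<exists>J \<Lambda>. open_interval J \<and> t0 \<in> J \<and>
             (\<forall>j\<in>{1..n}. definable_complex_on M J (\<Lambda> j) \<and> C_infinity_on J (\<Lambda> j)) \<and>
             (\<forall>t\<in>J. t0 + \<sigma> * (t - t0) ^ N \<in> I \<and>
                (\<forall>x::complex. poly (curve_poly n a (t0 + \<sigma> * (t - t0) ^ N)) x
                              = (\<Prod>j=1..n. (x - \<Lambda> j t))))"
      using in_I by blast
  qed
qed

end
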